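(* Let $\varepsilon>0$, $\theta_0>0$, $T>0$, $N=2K+1$, $h=L/N$, and assume $\mathcal{M}\equiv1$. Let $\Phi$ be the exact solution of the Cahn–Hilliard equation $\partial_t\Phi=\Delta\mu$, $\mu=\ln(1+\Phi)-\ln(1-\Phi)-\theta_0\Phi-\varepsilon^2\Delta\Phi$ on the periodic domain $\Omega$, with initial data $\Phi(\cdot,0)\in C^6_{\rm per}(\Omega)$, and suppose $\Phi$ belongs to the regularity class $\mathcal{R}:=H^2(0,T;C_{\rm per}(\Omega))\cap H^1(0,T;C^2_{\rm per}(\Omega))\cap L^\infty(0,T;C^6_{\rm per}(\Omega))$. Let $\phi^m$ be the numerical solution of $$\frac{\phi^{m+1}-\phi^m}{\Delta t}=\Delta_h\mu^{m+1},\qquad \mu^{m+1}=\ln(1+\phi^{m+1})-\ln(1-\phi^{m+1})-\theta_0\phi^m-\varepsilon^2\Delta_h\phi^{m+1},$$ with $\phi^0=\mathcal{P}_h\Phi_N(\cdot,0)$, and let $\tilde\phi^m:=\mathcal{P}_h\Phi_N^m-\phi^m$. Then, provided $\Delta t$ and $h$ are sufficiently small, for all positive integers $n$ with $t_n\le T$, $$\|\tilde\phi^n\|_{-1,h}+\Big(\varepsilon^2\Delta t\sum_{m=1}^n\|\nabla_h\tilde\phi^m\|_2^2\Big)^{1/2}\le C(\Delta t+h^2),$$ where $C>0$ is independent of $n$, $\Delta t$ and $h$.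
   Context: $\Omega=(0,L)^3$, periodic; $p_i=(i-\tfrac12)h$; $t_m=m\Delta t$. $\mathcal{C}_{\rm per}$: real $N$-periodic grid functions on cell centers; $\langle\nu,\xi\rangle=h^3\sum_{i,j,k=1}^N\nu_{i,j,k}\xi_{i,j,k}$; $\mathring{\mathcal{C}}_{\rm per}$: those with $\langle\nu,1\rangle=0$. $\Phi_N(\cdot,t)=\mathcal{P}_N\Phi(\cdot,t)$ is the Fourier projection onto periodic trigonometric polynomials of degree at most $K$; $\Phi_N^m=\Phi_N(\cdot,t_m)$; $\mathcal{P}_h$ is evaluation at cell centers. $\Delta_h$: standard 7-point discrete Laplacian. $\|\nabla_h\nu\|_2^2=h^3\sum_{i,j,k=1}^N[(D_x\nu_{i+1/2,j,k})^2+(D_y\nu_{i,j+1/2,k})^2+(D_z\nu_{i,j,k+1/2})^2]$ with $D_x\nu_{i+1/2,j,k}=(\nu_{i+1,j,k}-\nu_{i,j,k})/h$ etc. For $\psi\in\mathring{\mathcal{C}}_{\rm per}$, $\|\psi\|_{-1,h}^2=\langle\psi,(-\Delta_h)^{-1}\psi\rangle$, where $(-\Delta_h)^{-1}\psi$ is the unique mean-zero $v$ with $-\Delta_h v=\psi$. *)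

theory Defs
  imports "HOL-Analysis.Analysis"
begin

type_synonym field3 = "real^3 \<Rightarrow> real"

definition pd :: "3 \<Rightarrow> field3 \<Rightarrow> field3" where
  "pd i f = (\<lambda>x. deriv (\<lambda>s. f (x + s *\<^sub>R axis i 1)) 0)"

fun Ck :: "nat \<Rightarrow> field3 \<Rightarrow> bool" where
  "Ck 0 f = continuous_on UNIV f"
| "Ck (Suc k) f = (continuous_on UNIV f \<and>
      (\<forall>i x. (\<lambda>s. f (x + s *\<^sub>R axis i 1)) differentiable (at 0)) \<and>
      (\<forall>i. Ck k (pd i f)))"

definition periodic3 :: "real \<Rightarrow> field3 \<Rightarrow> bool" where
  "periodic3 L f \<longleftrightarrow> (\<forall>i x. f (x + L *\<^sub>R axis i 1) = f x)"

definition Cper :: "nat \<Rightarrow> real \<Rightarrow> field3 \<Rightarrow> bool" where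
  "Cper k L f \<longleftrightarrow> Ck k f \<and> periodic3 L f"

definition dpd :: "3 list \<Rightarrow> field3 \<Rightarrow> field3" where
  "dpd ds f = foldr pd ds f"

definition Ck_norm :: "nat \<Rightarrow> field3 \<Rightarrow> real" where
  "Ck_norm k f = (SUP ds \<in> {ds. length ds \<le> k}. SUP x. \<bar>dpd ds f x\<bar>)"

definition lapl :: "field3 \<Rightarrow> field3" where
  "lapl f = (\<lambda>x. \<Sum>i\<in>UNIV. pd i (pd i f) x)"

text \<open>u : (0,T) -> C^k_per is strongly measurable and in L^2 (C^k_per is separable,
  and evaluations of derivatives at points form a norming family, so strong measurability
  is equivalent to measurability of all these scalar functions).\<close>
definition L2_Ck :: "nat \<Rightarrow> real \<Rightarrow> real \<Rightarrow> (real \<Rightarrow> field3) \<Rightarrow> bool" where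
  "L2_Ck k L T u \<longleftrightarrow>
     (AE t in lebesgue_on {0<..<T}. Cper k L (u t)) \<and>
     (\<forall>ds x. length ds \<le> k \<longrightarrow> (\<lambda>t. dpd ds (u t) x) \<in> borel_measurable (lebesgue_on {0<..<T})) \<and>
     (\<integral>\<^sup>+ t. ennreal ((Ck_norm k (u t))\<^sup>2) \<partial>(lebesgue_on {0<..<T})) < \<infinity>"

definition Linf_Ck :: "nat \<Rightarrow> real \<Rightarrow> real \<Rightarrow> (real \<Rightarrow> field3) \<Rightarrow> bool" where
  "Linf_Ck k L T u \<longleftrightarrow>
     (AE t in lebesgue_on {0<..<T}. Cper k L (u t)) \<and>
     (\<forall>ds x. length ds \<le> k \<longrightarrow> (\<lambda>t. dpd ds (u t) x) \<in> borel_measurable (lebesgue_on {0<..<T})) \<and>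
     (\<exists>M. AE t in lebesgue_on {0<..<T}. Ck_norm k (u t) \<le> M)"

definition test_fun :: "real \<Rightarrow> (real \<Rightarrow> real) \<Rightarrow> bool" where
  "test_fun T \<psi> \<longleftrightarrow> (\<forall>n t. ((deriv ^^ n) \<psi>) differentiable (at t)) \<and>
     (\<exists>a b. 0 < a \<and> b < T \<and> (\<forall>t. t \<notin> {a..b} \<longrightarrow> \<psi> t = 0))"

text \<open>g is the weak time derivative of u on (0,T) (tested pointwise in x; point evaluations
  are continuous linear functionals separating points).\<close>
definition weak_time_deriv :: "real \<Rightarrow> (real \<Rightarrow> field3) \<Rightarrow> (real \<Rightarrow> field3) \<Rightarrow> bool" where
  "weak_time_deriv T u g \<longleftrightarrow> (\<forall>x \<psi>. test_fun T \<psi> \<longrightarrow>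
     (LINT t|lebesgue_on {0<..<T}. u t x * deriv \<psi> t) = - (LINT t|lebesgue_on {0<..<T}. g t x * \<psi> t))"

definition H1_Ck :: "nat \<Rightarrow> real \<Rightarrow> real \<Rightarrow> (real \<Rightarrow> field3) \<Rightarrow> bool" where
  "H1_Ck k L T u \<longleftrightarrow> L2_Ck k L T u \<and> (\<exists>g. L2_Ck k L T g \<and> weak_time_deriv T u g)"

definition H2_Ck :: "nat \<Rightarrow> real \<Rightarrow> real \<Rightarrow> (real \<Rightarrow> field3) \<Rightarrow> bool" where
  "H2_Ck k L T u \<longleftrightarrow> L2_Ck k L T u \<and> (\<exists>g1 g2. L2_Ck k L T g1 \<and> L2_Ck k L T g2 \<and>
     weak_time_deriv T u g1 \<and> weak_time_deriv T g1 g2)"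

definition CH_mu :: "real \<Rightarrow> real \<Rightarrow> field3 \<Rightarrow> field3" where
  "CH_mu eps theta0 f = (\<lambda>x. ln (1 + f x) - ln (1 - f x) - theta0 * f x - eps\<^sup>2 * lapl f x)"

definition CH_exact_solution :: "real \<Rightarrow> real \<Rightarrow> real \<Rightarrow> real \<Rightarrow> (real \<Rightarrow> field3) \<Rightarrow> bool" where
  "CH_exact_solution eps theta0 L T \<Phi> \<longleftrightarrow>
     Cper 6 L (\<Phi> 0) \<and>
     H2_Ck 0 L T \<Phi> \<and> H1_Ck 2 L T \<Phi> \<and> Linf_Ck 6 L T \<Phi> \<and>
     continuous_on ({0..T} \<times> UNIV) (\<lambda>(t, x). \<Phi> t x) \<and>
     (\<forall>t\<in>{0..T}. \<forall>x. \<bar>\<Phi> t x\<bar> < 1) \<and>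
     weak_time_deriv T \<Phi> (\<lambda>t. lapl (CH_mu eps theta0 (\<Phi> t)))"

definition fourier_coeff :: "real \<Rightarrow> field3 \<Rightarrow> int \<Rightarrow> int \<Rightarrow> int \<Rightarrow> complex" where
  "fourier_coeff L f k1 k2 k3 =
     integral (cbox 0 (\<chi> _. L))
       (\<lambda>x. complex_of_real (f x) *
            cis (- (2 * pi / L) * (of_int k1 * x$1 + of_int k2 * x$2 + of_int k3 * x$3))) / (of_real L ^ 3)"

definition fourier_proj :: "nat \<Rightarrow> real \<Rightarrow> field3 \<Rightarrow> field3" where
  "fourier_proj K L f = (\<lambda>x. Re (\<Sum>k1\<in>{-int K..int K}. \<Sum>k2\<in>{-int K..int K}. \<Sum>k3\<in>{-int K..int K}.
       fourier_coeff L f k1 k2 k3 *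
       cis ((2 * pi / L) * (of_int k1 * x$1 + of_int k2 * x$2 + of_int k3 * x$3))))"

type_synonym grid = "int \<Rightarrow> int \<Rightarrow> int \<Rightarrow> real"

definition gper :: "nat \<Rightarrow> grid \<Rightarrow> bool" where
  "gper N v \<longleftrightarrow> (\<forall>i j k. v (i + int N) j k = v i j k \<and> v i (j + int N) k = v i j k \<and> v i j (k + int N) = v i j k)"

definition grid_eval :: "real \<Rightarrow> nat \<Rightarrow> field3 \<Rightarrow> grid" where
  "grid_eval h N f = (\<lambda>i j k. f (vector [(of_int i - 1/2) * h, (of_int j - 1/2) * h, (of_int k - 1/2) * h]))"

definition ginner :: "nat \<Rightarrow> real \<Rightarrow> grid \<Rightarrow> grid \<Rightarrow> real" where
  "ginner N h v w = h ^ 3 * (\<Sum>i\<in>{1..int N}. \<Sum>j\<in>{1..int N}. \<Sum>k\<in>{1..int N}. v i j k * w i j k)"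

definition glap :: "real \<Rightarrow> grid \<Rightarrow> grid" where
  "glap h v = (\<lambda>i j k. (v (i+1) j k + v (i-1) j k + v i (j+1) k + v i (j-1) k
                        + v i j (k+1) + v i j (k-1) - 6 * v i j k) / h\<^sup>2)"

definition ggrad_sq :: "nat \<Rightarrow> real \<Rightarrow> grid \<Rightarrow> real" where
  "ggrad_sq N h v = h ^ 3 * (\<Sum>i\<in>{1..int N}. \<Sum>j\<in>{1..int N}. \<Sum>k\<in>{1..int N}.
       ((v (i+1) j k - v i j k) / h)\<^sup>2 + ((v i (j+1) k - v i j k) / h)\<^sup>2 + ((v i j (k+1) - v i j k) / h)\<^sup>2)"

definition ginvlap :: "nat \<Rightarrow> real \<Rightarrow> grid \<Rightarrow> grid" where
  "ginvlap N h psi = (THE v. gper N v \<and> ginner N h v (\<lambda>_ _ _. 1) = 0 \<and> (\<forall>i j k. - glap h v i j k = psi i j k))"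

definition gneg_norm :: "nat \<Rightarrow> real \<Rightarrow> grid \<Rightarrow> real" where
  "gneg_norm N h psi = sqrt (ginner N h psi (ginvlap N h psi))"

definition disc_mu :: "real \<Rightarrow> real \<Rightarrow> real \<Rightarrow> grid \<Rightarrow> grid \<Rightarrow> grid" where
  "disc_mu eps theta0 h old new = (\<lambda>i j k.
     ln (1 + new i j k) - ln (1 - new i j k) - theta0 * old i j k - eps\<^sup>2 * glap h new i j k)"

definition CH_scheme :: "real \<Rightarrow> real \<Rightarrow> nat \<Rightarrow> real \<Rightarrow> real \<Rightarrow> real \<Rightarrow> (nat \<Rightarrow> grid) \<Rightarrow> bool" where
  "CH_scheme eps theta0 N h dt T phi \<longleftrightarrow>
     (\<forall>m. real (Suc m) * dt \<le> T \<longrightarrow>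
        gper N (phi (Suc m)) \<and> (\<forall>i j k. \<bar>phi (Suc m) i j k\<bar> < 1) \<and>
        (\<forall>i j k. (phi (Suc m) i j k - phi m i j k) / dt
                  = glap h (disc_mu eps theta0 h (phi m) (phi (Suc m))) i j k))"

end

theory Submission
  imports Defs
begin

text \<open>
  The numerical solution is compared with the nodal values of the exact solution, shifted by a constant so that
  the difference has discrete mean zero. Since \<open>\<Phi>(t + \<Delta>t) - \<Phi>(t)\<close> is the time integral of \<open>\<Delta>\<mu>\<close>, the shifted nodal
  values satisfy the scheme up to terms \<open>A + \<Delta>\<^sub>h B\<close> with \<open>A\<close> and \<open>B\<close> bounded by \<open>\<Delta>t + h\<^sup>2\<close>; only uniform bounds on six spatial
  derivatives are needed, because bounding \<open>\<Delta>\<mu>\<close> also controls the modulus of continuity in time. Testing the error equation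
  with \<open>(-\<Delta>\<^sub>h)\<^sup>-\<^sup>1\<close> of the error, the logarithmic terms have a favourable sign by monotonicity, the discrete Poincare inequality
  absorbs the consistency terms in the gradient, and the discrete Gronwall lemma applies. Finally the nodal values of the exact
  solution are replaced by those of its Fourier projection: they differ by \<open>O(h\<^sup>3)\<close>, which costs \<open>O(h\<^sup>2)\<close> after one difference quotient.
\<close>

section \<open>Grid functions and the discrete inverse Laplacian\<close>

text \<open>The shift is forced by the negative norm: it needs mean-zero data, while the grid mean
  of the nodal values of \<Phi> drifts in time by the consistency error and the scheme keeps its
  mean exactly. The projection has no such drift. With N = 2K + 1 nodes per direction no nonzero
  frequency up to K aliases to zero, so its grid mean is the zeroth Fourier coefficient, a conserved
  quantity. Yet the comparison is made with \<Phi> itself: pointwise Taylor expansion then gives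
  consistency, and compactness of one period in space and time keeps |\<Phi>| at a fixed distance
  \<delta> from 1, where the logarithms are Lipschitz.

  The projection rate is crude but sufficient. Six derivatives make the coefficients decay like
  |k|^-6, so a one-dimensional tail is O(K^-5); passing through the partial sums in the other two
  variables, each bounded by its number of modes, costs K^2.

  The spatial regularity holds only for almost every time. Estimates are therefore made off a null
  set of times and reach every time through time integrals or by continuity.\<close>

definition gsum :: "nat \<Rightarrow> grid \<Rightarrow> real" where
  "gsum N v = (\<Sum>i\<in>{1..int N}. \<Sum>j\<in>{1..int N}. \<Sum>k\<in>{1..int N}. v i j k)"

abbreviation gdot :: "grid \<Rightarrow> grid \<Rightarrow> grid" where
  "gdot u w \<equiv> \<lambda>i j k.
     (u (i+1) j k - u i j k) * (w (i+1) j k - w i j k)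
   + (u i (j+1) k - u i j k) * (w i (j+1) k - w i j k)
   + (u i j (k+1) - u i j k) * (w i j (k+1) - w i j k)"

text \<open>The discrete Dirichlet form: cell volume h^3 times two difference quotients leaves a
  single factor h. Both quantities of the final estimate are diagonal values of it, the gradient
  term at the error itself and the negative norm at the potential of the error.\<close>

definition gform :: "nat \<Rightarrow> real \<Rightarrow> grid \<Rightarrow> grid \<Rightarrow> real" where
  "gform N h u w = h * gsum N (gdot u w)"

lemma ginner_eq_gsum: "ginner N h v w = h ^ 3 * gsum N (\<lambda>i j k. v i j k * w i j k)"
  by (simp add: ginner_def gsum_def)

lemma gsum_add: "gsum N (\<lambda>i j k. u i j k + v i j k) = gsum N u + gsum N v"
  by (simp add: gsum_def sum.distrib)

lemma gsum_diff: "gsum N (\<lambda>i j k. u i j k - v i j k) = gsum N u - gsum N v"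
  by (simp add: gsum_def sum_subtractf)

lemma gsum_minus: "gsum N (\<lambda>i j k. - u i j k) = - gsum N u"
  by (simp add: gsum_def sum_negf)

lemma gsum_cmult: "gsum N (\<lambda>i j k. c * u i j k) = c * gsum N u"
  by (simp add: gsum_def sum_distrib_left)

lemma gsum_divide: "gsum N (\<lambda>i j k. u i j k / c) = gsum N u / c"
  by (simp add: gsum_def sum_divide_distrib)

lemma gsum_const: "gsum N (\<lambda>i j k. c) = real N ^ 3 * c"
  by (simp add: gsum_def power3_eq_cube)

lemma gsum_mono: "(\<And>i j k. u i j k \<le> v i j k) \<Longrightarrow> gsum N u \<le> gsum N v"
  unfolding gsum_def by (intro sum_mono) auto

lemma gsum_nonneg: "(\<And>i j k. 0 \<le> u i j k) \<Longrightarrow> 0 \<le> gsum N u"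
  unfolding gsum_def by (intro sum_nonneg) auto

section \<open>Periodic sums and summation by parts\<close>

text \<open>Stated over any commutative monoid because it serves both real grid values and the
  complex exponentials in \<open>sum_fexp_grid\<close>.\<close>

lemma sum_periodic_shift:
  fixes a :: "int \<Rightarrow> 'a::comm_monoid_add"
  assumes "\<And>i. a (i + int N) = a i"
  shows "(\<Sum>i\<in>{1..int N}. a (i + 1)) = (\<Sum>i\<in>{1..int N}. a i)"
proof (cases "N = 0")
  case False
  have "(\<Sum>i\<in>{1..int N}. a (i + 1)) = (\<Sum>i\<in>{2..int N + 1}. a i)"
    by (rule sum.reindex_bij_witness[of _ "\<lambda>i. i - 1" "\<lambda>i. i + 1"]) auto
  also have "{2..int N + 1} = insert (int N + 1) {2..int N}"
    using False by auto
  also have "sum a \<dots> = a (int N + 1) + sum a {2..int N}" by simp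
  also have "a (int N + 1) = a 1" using assms[of 1] by (simp add: add.commute)
  also have "a 1 + sum a {2..int N} = sum a (insert 1 {2..int N})" by simp
  also have "insert 1 {2..int N} = {1..int N}" using False by auto
  finally show ?thesis .
qed simp

lemma gsum_shift:
  assumes "gper N v"
  shows "gsum N (\<lambda>i j k. v (i+1) j k) = gsum N v"
    and "gsum N (\<lambda>i j k. v i (j+1) k) = gsum N v"
    and "gsum N (\<lambda>i j k. v i j (k+1)) = gsum N v"
proof -
  have p: "v (i + int N) j k = v i j k" "v i (j + int N) k = v i j k" "v i j (k + int N) = v i j k" for i j k
    using assms by (auto simp: gper_def)
  show "gsum N (\<lambda>i j k. v (i+1) j k) = gsum N v"
    unfolding gsum_def by (rule sum_periodic_shift) (intro sum.cong refl p)
  show "gsum N (\<lambda>i j k. v i (j+1) k) = gsum N v"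
    unfolding gsum_def by (intro sum.cong refl sum_periodic_shift p)
  show "gsum N (\<lambda>i j k. v i j (k+1)) = gsum N v"
    unfolding gsum_def by (intro sum.cong refl sum_periodic_shift p)
qed

lemma gper_shift:
  assumes "gper N v"
  shows "gper N (\<lambda>i j k. v (i + a) (j + b) (k + c))"
proof -
  have p: "v (i + int N) j k = v i j k" "v i (j + int N) k = v i j k" "v i j (k + int N) = v i j k" for i j k
    using assms by (auto simp: gper_def)
  show ?thesis
    unfolding gper_def using p[of "_ + a" "_ + b" "_ + c"] by (simp add: add.assoc add.commute[of "int N"])
qed

lemma gper_comp1:
  assumes "gper N v" shows "gper N (\<lambda>i j k. F (v i j k))"
  using assms by (simp add: gper_def)

lemma gper_comp2:
  assumes "gper N v" "gper N w" shows "gper N (\<lambda>i j k. F (v i j k) (w i j k))"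
  using assms by (simp add: gper_def)

lemma gper_glap:
  assumes "gper N v" shows "gper N (glap h v)"
proof -
  have s: "gper N (\<lambda>i j k. v (i+1) j k)" "gper N (\<lambda>i j k. v (i-1) j k)"
    "gper N (\<lambda>i j k. v i (j+1) k)" "gper N (\<lambda>i j k. v i (j-1) k)"
    "gper N (\<lambda>i j k. v i j (k+1))" "gper N (\<lambda>i j k. v i j (k-1))"
    using gper_shift[OF assms, of 1 0 0] gper_shift[OF assms, of "-1" 0 0]
      gper_shift[OF assms, of 0 1 0] gper_shift[OF assms, of 0 "-1" 0]
      gper_shift[OF assms, of 0 0 1] gper_shift[OF assms, of 0 0 "-1"] by simp_all
  show ?thesis unfolding glap_def
    by (intro gper_comp2[where F="\<lambda>x y. (x - y) / h\<^sup>2"] gper_comp2[where F="(+)"] s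
        gper_comp1[where F="\<lambda>x. 6 * x"] assms)
qed

lemma glap_add: "glap h (\<lambda>i j k. u i j k + v i j k) i j k = glap h u i j k + glap h v i j k"
  unfolding glap_def by (simp add: field_simps add_divide_distrib[symmetric])

lemma glap_diff: "glap h (\<lambda>i j k. u i j k - v i j k) i j k = glap h u i j k - glap h v i j k"
  unfolding glap_def by (simp add: diff_divide_distrib[symmetric] algebra_simps)

lemma glap_cmult: "glap h (\<lambda>i j k. c * u i j k) i j k = c * glap h u i j k"
  unfolding glap_def by (simp add: algebra_simps)

lemma glap_const: "glap h (\<lambda>i j k. c) i j k = 0"
  unfolding glap_def by simp

text \<open>Discrete Green formula. With the backward difference of u times w as flux in each
  direction, the Laplacian times w is a difference of neighbouring fluxes minus the product of
  forward differences; the flux differences cancel over a period.\<close>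

lemma gsum_glap_mult:
  assumes "gper N u" "gper N w" "h > 0"
  shows "h ^ 3 * gsum N (\<lambda>i j k. glap h u i j k * w i j k) = - gform N h u w"
proof -
  define X where "X = (\<lambda>i j k. (u i j k - u (i-1) j k) * w i j k)"
  define Y where "Y = (\<lambda>i j k. (u i j k - u i (j-1) k) * w i j k)"
  define Z where "Z = (\<lambda>i j k. (u i j k - u i j (k-1)) * w i j k)"
  have per: "gper N X" "gper N Y" "gper N Z"
    unfolding X_def Y_def Z_def
    using gper_shift[OF assms(1), of "-1" 0 0] gper_shift[OF assms(1), of 0 "-1" 0]
      gper_shift[OF assms(1), of 0 0 "-1"] assms(1,2)
    by (simp_all add: gper_def)
  let ?D = "\<lambda>i j k. gdot u w i j k"
  have "h\<^sup>2 * (glap h u i j k * w i j k) =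
     (X (i+1) j k - X i j k) + (Y i (j+1) k - Y i j k) + (Z i j (k+1) - Z i j k) - ?D i j k" for i j k
    using assms(3) unfolding glap_def X_def Y_def Z_def by (simp add: field_simps)
  then have "h\<^sup>2 * gsum N (\<lambda>i j k. glap h u i j k * w i j k) = gsum N (\<lambda>i j k.
     (X (i+1) j k - X i j k) + (Y i (j+1) k - Y i j k) + (Z i j (k+1) - Z i j k) - ?D i j k)"
    unfolding gsum_cmult[symmetric] by simp
  also have "\<dots> = - gsum N ?D"
    using gsum_shift(1)[OF per(1)] gsum_shift(2)[OF per(2)] gsum_shift(3)[OF per(3)]
    by (simp only: gsum_diff gsum_add)
  finally have "h * (h\<^sup>2 * gsum N (\<lambda>i j k. glap h u i j k * w i j k)) = - gform N h u w"
    unfolding gform_def by simp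
  then show ?thesis by (simp add: power3_eq_cube power2_eq_square mult.assoc)
qed

lemma gform_commute: "gform N h u w = gform N h w u"
  unfolding gform_def by (simp add: mult.commute)

lemma gform_diag_nonneg: "h > 0 \<Longrightarrow> 0 \<le> gform N h u u"
  unfolding gform_def by (intro mult_nonneg_nonneg gsum_nonneg add_nonneg_nonneg zero_le_square) simp

lemma ggrad_sq_eq_gform: "h > 0 \<Longrightarrow> ggrad_sq N h u = gform N h u u"
proof -
  assume h: "h > 0"
  have "ggrad_sq N h u = h^3 * gsum N (\<lambda>i j k. (inverse h)\<^sup>2 * (
     gdot u u i j k))"
    unfolding ggrad_sq_def gsum_def
    by (intro arg_cong2[where f="(*)"] sum.cong refl)
      (simp add: divide_inverse power_mult_distrib distrib_left mult.commute power2_eq_square[of "_ - _"])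
  then show ?thesis using h unfolding gsum_cmult gform_def
    by (simp add: field_simps power2_eq_square power3_eq_cube)
qed

section \<open>Weighted inequalities for the Dirichlet form\<close>

lemma young: "x * y \<le> a * x\<^sup>2 + y\<^sup>2 / (4 * a)" if "a > 0" for x y a :: real
proof -
  have "0 \<le> (2 * a * x - y)\<^sup>2 / (4 * a)" using that by simp
  also have "\<dots> = a * x\<^sup>2 - x * y + y\<^sup>2 / (4 * a)"
    using that by (simp add: power2_eq_square field_simps)
  finally show ?thesis by simp
qed

lemma gform_young:
  assumes "h > 0" "a > 0"
  shows "gform N h u w \<le> a * gform N h u u + gform N h w w / (4 * a)"
proof -
  have "gsum N (gdot u w) \<le> gsum N (\<lambda>i j k. a *
     (gdot u u i j k) +
     (gdot w w i j k) / (4 * a))" (is "gsum N ?l \<le> gsum N ?r")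
  proof (intro gsum_mono)
    fix i j k
    have "x1 * y1 + x2 * y2 + x3 * y3 \<le> a * (x1 * x1 + x2 * x2 + x3 * x3) + (y1 * y1 + y2 * y2 + y3 * y3) / (4 * a)"
      for x1 x2 x3 y1 y2 y3
      using young[OF assms(2), of x1 y1] young[OF assms(2), of x2 y2] young[OF assms(2), of x3 y3]
      by (simp add: power2_eq_square distrib_left add_divide_distrib)
    then show "?l i j k \<le> ?r i j k" .
  qed
  from mult_left_mono[OF this, of h] assms(1) show ?thesis
    unfolding gform_def gsum_add gsum_cmult gsum_divide by (simp add: algebra_simps)
qed

lemma gform_add_le:
  assumes "h > 0"
  shows "gform N h (\<lambda>i j k. u i j k + w i j k) (\<lambda>i j k. u i j k + w i j k)
     \<le> 2 * gform N h u u + 2 * gform N h w w"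
proof -
  have sq: "(x + y) * (x + y) \<le> 2 * (x * x) + 2 * (y * y)" for x y :: real
    using sum_squares_bound[of x y] by (simp add: algebra_simps power2_eq_square)
  have "h * gsum N (\<lambda>i j k.
     ((u (i+1) j k + w (i+1) j k) - (u i j k + w i j k)) * ((u (i+1) j k + w (i+1) j k) - (u i j k + w i j k))
   + ((u i (j+1) k + w i (j+1) k) - (u i j k + w i j k)) * ((u i (j+1) k + w i (j+1) k) - (u i j k + w i j k))
   + ((u i j (k+1) + w i j (k+1)) - (u i j k + w i j k)) * ((u i j (k+1) + w i j (k+1)) - (u i j k + w i j k)))
   \<le> h * gsum N (\<lambda>i j k. 2 *
     (gdot u u i j k) + 2 *
     (gdot w w i j k))" (is "h * gsum N ?l \<le> h * gsum N ?r")
  proof (intro mult_left_mono gsum_mono)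
    fix i j k
    have *: "(a + b) - (c + d) = (a - c) + (b - d)" for a b c d :: real by simp
    have "(x1 + y1) * (x1 + y1) + (x2 + y2) * (x2 + y2) + (x3 + y3) * (x3 + y3)
        \<le> 2 * (x1 * x1 + x2 * x2 + x3 * x3) + 2 * (y1 * y1 + y2 * y2 + y3 * y3)"
      for x1 x2 x3 y1 y2 y3 :: real
      using sq[of x1 y1] sq[of x2 y2] sq[of x3 y3] by (simp add: algebra_simps)
    then show "?l i j k \<le> ?r i j k" unfolding * .
  qed (use assms in simp)
  then show ?thesis unfolding gform_def gsum_add gsum_cmult by (simp add: algebra_simps)
qed

section \<open>The discrete Poincare inequality\<close>

text \<open>Telescoping along the segment between the two indices and Cauchy-Schwarz; the segment
  has at most N steps, all inside the period cell.\<close>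

lemma sq_diff_le_sum_sq_steps:
  fixes a :: "int \<Rightarrow> real"
  assumes "i \<in> {1..int N}" "i' \<in> {1..int N}"
  shows "(a i - a i')\<^sup>2 \<le> real N * (\<Sum>l\<in>{1..int N}. (a (l + 1) - a l)\<^sup>2)"
proof -
  have main: "(a i - a i')\<^sup>2 \<le> real N * (\<Sum>l\<in>{1..int N}. (a (l + 1) - a l)\<^sup>2)"
    if ii: "i \<in> {1..int N}" "i' \<in> {1..int N}" "i' \<le> i" for i i'
  proof -
    have tele: "(\<Sum>l\<in>{i'..<i' + int n}. a (l + 1) - a l) = a (i' + int n) - a i'" for n
    proof (induction n)
      case (Suc n)
      have "{i'..<i' + int (Suc n)} = insert (i' + int n) {i'..<i' + int n}" by auto
      then show ?case using Suc by (simp add: add.commute add.left_commute)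
    qed simp
    have "a i - a i' = (\<Sum>l\<in>{i'..<i}. a (l + 1) - a l)"
      using tele[of "nat (i - i')"] ii by simp
    then have "(a i - a i')\<^sup>2 \<le> real (card {i'..<i}) * (\<Sum>l\<in>{i'..<i}. (a (l + 1) - a l)\<^sup>2)"
      using sum_squared_le_sum_of_squares[of "\<lambda>l. a (l + 1) - a l" "{i'..<i}"] by (simp add: mult.commute)
    also have "\<dots> \<le> real N * (\<Sum>l\<in>{1..int N}. (a (l + 1) - a l)\<^sup>2)"
      using ii by (intro mult_mono sum_mono2 sum_nonneg) auto
    finally show ?thesis .
  qed
  show ?thesis
  proof (cases "i' \<le> i")
    case False
    then have "(a i' - a i)\<^sup>2 \<le> real N * (\<Sum>l\<in>{1..int N}. (a (l + 1) - a l)\<^sup>2)"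
      using main[of i' i] assms by simp
    then show ?thesis by (simp add: power2_commute)
  qed (use main assms in blast)
qed

lemma gsum_mono_cell:
  assumes "\<And>i j k. i \<in> {1..int N} \<Longrightarrow> j \<in> {1..int N} \<Longrightarrow> k \<in> {1..int N} \<Longrightarrow> u i j k \<le> v i j k"
  shows "gsum N u \<le> gsum N v"
  unfolding gsum_def by (intro sum_mono assms)

text \<open>All squared differences over pairs of nodes are summed. Mean zero removes the cross
  terms and gives 2 N^3 times the square sum. From above, each pair is joined by a path changing one
  coordinate at a time; every directional energy then depends on two of the six indices and is
  counted N^4 times. Dividing 3 N^5 by 2 N^3 yields the constant.\<close>

lemma gsum_sq_le_steps:
  assumes "gsum N u = 0"
  shows "gsum N (\<lambda>i j k. (u i j k)\<^sup>2) \<le> 3 / 2 * (real N)\<^sup>2 * gsum N (gdot u u)"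
proof (cases "N = 0")
  case False
  define S where "S = gsum N (\<lambda>i j k. (u i j k)\<^sup>2)"
  define X where "X = (\<lambda>j k. \<Sum>l\<in>{1..int N}. (u (l+1) j k - u l j k)\<^sup>2)"
  define Y where "Y = (\<lambda>i k. \<Sum>l\<in>{1..int N}. (u i (l+1) k - u i l k)\<^sup>2)"
  define Z where "Z = (\<lambda>i j. \<Sum>l\<in>{1..int N}. (u i j (l+1) - u i j l)\<^sup>2)"
  define DX where "DX = gsum N (\<lambda>i j k. (u (i+1) j k - u i j k)\<^sup>2)"
  define DY where "DY = gsum N (\<lambda>i j k. (u i (j+1) k - u i j k)\<^sup>2)"
  define DZ where "DZ = gsum N (\<lambda>i j k. (u i j (k+1) - u i j k)\<^sup>2)"
  have inner: "gsum N (\<lambda>i' j' k'. (a - u i' j' k')\<^sup>2) = real N ^ 3 * a\<^sup>2 + S" for a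
  proof -
    have "gsum N (\<lambda>i' j' k'. (a - u i' j' k')\<^sup>2) =
       gsum N (\<lambda>i' j' k'. (a\<^sup>2 + (u i' j' k')\<^sup>2) - (2 * a) * u i' j' k')"
      by (simp add: power2_diff)
    then show ?thesis unfolding gsum_diff gsum_add gsum_cmult gsum_const S_def by (simp add: assms)
  qed
  have "gsum N (\<lambda>i j k. gsum N (\<lambda>i' j' k'. (u i j k - u i' j' k')\<^sup>2)) = 2 * real N ^ 3 * S"
    unfolding inner gsum_add gsum_cmult gsum_const by (simp add: S_def)
  moreover have "gsum N (\<lambda>i j k. gsum N (\<lambda>i' j' k'. (u i j k - u i' j' k')\<^sup>2)) \<le>
     gsum N (\<lambda>i j k. gsum N (\<lambda>i' j' k'. 3 * real N * (X j k + Y i' k + Z i' j')))"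
  proof (intro gsum_mono_cell)
    fix i j k i' j' k' assume c: "i \<in> {1..int N}" "j \<in> {1..int N}" "k \<in> {1..int N}"
      "i' \<in> {1..int N}" "j' \<in> {1..int N}" "k' \<in> {1..int N}"
    have x: "(u i j k - u i' j k)\<^sup>2 \<le> real N * X j k"
      unfolding X_def using c by (intro sq_diff_le_sum_sq_steps) auto
    have y: "(u i' j k - u i' j' k)\<^sup>2 \<le> real N * Y i' k"
      unfolding Y_def using c by (intro sq_diff_le_sum_sq_steps) auto
    have z: "(u i' j' k - u i' j' k')\<^sup>2 \<le> real N * Z i' j'"
      unfolding Z_def using c by (intro sq_diff_le_sum_sq_steps) auto
    have "(p + q + r)\<^sup>2 \<le> 3 * (p\<^sup>2 + q\<^sup>2 + r\<^sup>2)" for p q r :: real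
    proof -
      have "0 \<le> (p - q)\<^sup>2 + (q - r)\<^sup>2 + (p - r)\<^sup>2" by simp
      then show ?thesis by (simp add: power2_eq_square algebra_simps)
    qed
    from this[of "u i j k - u i' j k" "u i' j k - u i' j' k" "u i' j' k - u i' j' k'"]
    have "(u i j k - u i' j' k')\<^sup>2 \<le> 3 * ((u i j k - u i' j k)\<^sup>2
        + (u i' j k - u i' j' k)\<^sup>2 + (u i' j' k - u i' j' k')\<^sup>2)" by simp
    then show "(u i j k - u i' j' k')\<^sup>2 \<le> 3 * real N * (X j k + Y i' k + Z i' j')"
      using x y z by (simp add: algebra_simps)
  qed
  moreover have "gsum N (\<lambda>i j k. gsum N (\<lambda>i' j' k'. 3 * real N * (X j k + Y i' k + Z i' j')))
     = 3 * real N * (real N ^ 4 * (DX + DY + DZ))"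
  proof -
    have dx: "(\<Sum>j\<in>{1..int N}. \<Sum>k\<in>{1..int N}. X j k) = DX"
    proof -
      have "DX = (\<Sum>j\<in>{1..int N}. \<Sum>i\<in>{1..int N}. \<Sum>k\<in>{1..int N}. (u (i+1) j k - u i j k)\<^sup>2)"
        unfolding DX_def gsum_def by (rule sum.swap)
      also have "\<dots> = (\<Sum>j\<in>{1..int N}. \<Sum>k\<in>{1..int N}. X j k)"
        unfolding X_def by (intro sum.cong refl sum.swap)
      finally show ?thesis by simp
    qed
    have dy: "(\<Sum>i\<in>{1..int N}. \<Sum>k\<in>{1..int N}. Y i k) = DY"
      unfolding DY_def gsum_def Y_def by (intro sum.cong refl sum.swap)
    have dz: "(\<Sum>i\<in>{1..int N}. \<Sum>j\<in>{1..int N}. Z i j) = DZ"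
      unfolding DZ_def gsum_def Z_def by simp
    have gx: "gsum N (\<lambda>i j k. gsum N (\<lambda>i' j' k'. X j k)) = real N ^ 4 * DX"
      unfolding gsum_const unfolding gsum_cmult unfolding gsum_def by (simp add: dx power_numeral_reduce)
    have gy: "gsum N (\<lambda>i j k. gsum N (\<lambda>i' j' k'. Y i' k)) = real N ^ 4 * DY"
    proof -
      have "(\<Sum>k\<in>{1..int N}. \<Sum>i\<in>{1..int N}. Y i k) = DY" unfolding dy[symmetric] by (rule sum.swap)
      then show ?thesis
        unfolding gsum_def by (simp add: sum_distrib_left[symmetric] power_numeral_reduce)
    qed
    have gz: "gsum N (\<lambda>i j k. gsum N (\<lambda>i' j' k'. Z i' j')) = real N ^ 4 * DZ"
      unfolding gsum_const unfolding gsum_def by (simp add: dz sum_distrib_left[symmetric] power_numeral_reduce)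
    show ?thesis unfolding gsum_cmult gsum_add gx gy gz by (simp add: algebra_simps)
  qed
  ultimately have "2 * real N ^ 3 * S \<le> 3 * real N * (real N ^ 4 * (DX + DY + DZ))" by simp
  then have "real N ^ 3 * (2 * S) \<le> real N ^ 3 * (3 * (real N)\<^sup>2 * (DX + DY + DZ))"
    by (simp add: power_numeral_reduce algebra_simps)
  then have "2 * S \<le> 3 * (real N)\<^sup>2 * (DX + DY + DZ)" using False by simp
  then show ?thesis
    unfolding S_def[symmetric] gsum_add DX_def DY_def DZ_def power2_eq_square[symmetric] by simp
qed (simp add: gsum_def)

lemma discrete_poincare:
  assumes "gsum N u = 0" "h > 0"
  shows "h ^ 3 * gsum N (\<lambda>i j k. (u i j k)\<^sup>2) \<le> 3 / 2 * (real N * h)\<^sup>2 * gform N h u u"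
  using mult_left_mono[OF gsum_sq_le_steps[OF assms(1)], of "h ^ 3"] assms(2)
  unfolding gform_def by (simp add: power_numeral_reduce algebra_simps)

section \<open>Solvability of the discrete Poisson problem\<close>

text \<open>Gaussian elimination by induction on the equations: a pivot p removes one unknown, and
  its value is recovered from the eliminated equation. Arbitrary finite index sets allow the
  unknowns to be indexed by triples of integers.\<close>

lemma homogeneous_system_nontrivial:
  fixes A :: "'j \<Rightarrow> 'i \<Rightarrow> real"
  assumes "finite J" "finite I" "card J < card I"
  shows "\<exists>x. (\<exists>i\<in>I. x i \<noteq> 0) \<and> (\<forall>j\<in>J. (\<Sum>i\<in>I. A j i * x i) = 0)"
  using assms
proof (induction J arbitrary: A I rule: finite_induct)
  case empty
  then have "I \<noteq> {}" by auto
  then show ?case by (auto intro!: exI[of _ "\<lambda>_. 1"])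
next
  case (insert j J)
  show ?case
  proof (cases "\<forall>i\<in>I. A j i = 0")
    case True
    obtain x where "\<exists>i\<in>I. x i \<noteq> 0" "\<forall>j\<in>J. (\<Sum>i\<in>I. A j i * x i) = 0"
      using insert.IH[of I A] insert.prems insert.hyps by auto
    then show ?thesis using True by (intro exI[of _ x]) auto
  next
    case False
    then obtain p where p: "p \<in> I" "A j p \<noteq> 0" by auto
    define A' where "A' = (\<lambda>l i. A l i - A l p / A j p * A j i)"
    obtain x where x: "\<exists>i\<in>I - {p}. x i \<noteq> 0" "\<forall>l\<in>J. (\<Sum>i\<in>I - {p}. A' l i * x i) = 0"
      using insert.IH[of "I - {p}" A'] insert.prems insert.hyps p by (auto simp: less_diff_conv)
    define s where "s = (\<lambda>l. \<Sum>i\<in>I - {p}. A l i * x i)"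
    define y where "y = x(p := - s j / A j p)"
    have sum_y: "(\<Sum>i\<in>I. A l i * y i) = s l - A l p * (s j / A j p)" for l
    proof -
      have "(\<Sum>i\<in>I. A l i * y i) = A l p * y p + (\<Sum>i\<in>I - {p}. A l i * y i)"
        using p insert.prems by (subst sum.remove[of I p]) auto
      also have "(\<Sum>i\<in>I - {p}. A l i * y i) = s l"
        unfolding s_def by (intro sum.cong) (auto simp: y_def)
      finally show ?thesis by (simp add: y_def)
    qed
    have "(\<Sum>i\<in>I. A l i * y i) = 0" if "l \<in> J" for l
    proof -
      have "0 = (\<Sum>i\<in>I - {p}. A l i * x i - A l p / A j p * (A j i * x i))"
        using x(2) that by (simp add: A'_def left_diff_distrib mult.assoc)
      also have "\<dots> = s l - A l p / A j p * s j"
        unfolding s_def by (simp only: sum_subtractf sum_distrib_left)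
      finally show ?thesis unfolding sum_y by simp
    qed
    moreover have "(\<Sum>i\<in>I. A j i * y i) = 0" unfolding sum_y using p by simp
    moreover have "\<exists>i\<in>I. y i \<noteq> 0" using x(1) by (auto simp: y_def)
    ultimately show ?thesis by (intro exI[of _ y]) auto
  qed
qed

text \<open>The column -b, indexed by \<open>None\<close>, gives one unknown more than equations and
  hence a nontrivial kernel vector. Injectivity excludes a zero entry at \<open>None\<close>, and
  dividing by that entry turns the kernel vector into a solution.\<close>

lemma square_system_solvable:
  fixes A :: "'i \<Rightarrow> 'i \<Rightarrow> real"
  assumes "finite I"
    and inj: "\<And>x. (\<forall>j\<in>I. (\<Sum>i\<in>I. A j i * x i) = 0) \<Longrightarrow> \<forall>i\<in>I. x i = 0"
  shows "\<exists>x. \<forall>j\<in>I. (\<Sum>i\<in>I. A j i * x i) = b j"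
proof -
  define I' where "I' = insert None (Some ` I)"
  define A' where "A' = (\<lambda>j i. case i of None \<Rightarrow> - b j | Some i \<Rightarrow> A j i)"
  have "card I' = Suc (card I)" unfolding I'_def using assms(1) by (subst card_insert_disjoint) (auto simp: card_image)
  then obtain x where x: "\<exists>i\<in>I'. x i \<noteq> 0" "\<forall>j\<in>I. (\<Sum>i\<in>I'. A' j i * x i) = 0"
    using homogeneous_system_nontrivial[of I I' A'] assms(1) by (auto simp: I'_def)
  define y where "y = (\<lambda>i. x (Some i))"
  have eq: "(\<Sum>i\<in>I. A j i * y i) = b j * x None" if "j \<in> I" for j
  proof -
    have "(\<Sum>i\<in>I'. A' j i * x i) = - b j * x None + (\<Sum>i\<in>I. A j i * y i)"
      unfolding I'_def using assms(1)
      by (subst sum.insert) (auto simp: sum.reindex A'_def y_def)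
    then show ?thesis using x(2) that by simp
  qed
  have "x None \<noteq> 0"
  proof
    assume "x None = 0"
    then have "\<forall>i\<in>I. y i = 0" using inj[of y] eq by simp
    then show False using x(1) \<open>x None = 0\<close> by (auto simp: I'_def y_def)
  qed
  then have "\<forall>j\<in>I. (\<Sum>i\<in>I. A j i * (y i / x None)) = b j"
    using eq by (simp add: sum_divide_distrib[symmetric])
  then show ?thesis by (intro exI[of _ "\<lambda>i. y i / x None"])
qed

text \<open>Reduces every index to its representative in the cell 1..N; subtracting and adding 1
  around \<open>mod\<close> accounts for a cell that starts at 1 rather than 0.\<close>

lemma gper_mod:
  assumes "gper N v"
  shows "v ((i - 1) mod int N + 1) ((j - 1) mod int N + 1) ((k - 1) mod int N + 1) = v i j k"
proof -
  have per: "a (x + m * int N) = a x" if a: "\<And>x. a (x + int N) = a x" for a :: "int \<Rightarrow> real" and x m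
  proof (induction m rule: int_induct[where k=0])
    case (step1 m)
    then show ?case using a[of "x + m * int N"] by (simp add: algebra_simps)
  next
    case (step2 m)
    then show ?case using a[of "x + (m - 1) * int N"] by (simp add: algebra_simps)
  qed simp
  have r: "x = ((x - 1) mod int N + 1) + ((x - 1) div int N) * int N" for x
    using div_mult_mod_eq[of "x - 1" "int N"] by linarith
  have p: "v (i + int N) j k = v i j k" "v i (j + int N) k = v i j k" "v i j (k + int N) = v i j k" for i j k
    using assms by (auto simp: gper_def)
  define i' j' k' where d: "i' = (i - 1) mod int N + 1" "j' = (j - 1) mod int N + 1" "k' = (k - 1) mod int N + 1"
  have "v i j k = v i' j k" using per[of "\<lambda>x. v x j k" i' "(i - 1) div int N"] r[of i] p d by simp
  also have "\<dots> = v i' j' k" using per[of "\<lambda>x. v i' x k" j' "(j - 1) div int N"] r[of j] p d by simp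
  also have "\<dots> = v i' j' k'" using per[of "\<lambda>x. v i' j' x" k' "(k - 1) div int N"] r[of k] p d by simp
  finally show ?thesis unfolding d by simp
qed

lemma gper_eq_zero_iff:
  assumes "gper N v" "N > 0" "gsum N (\<lambda>i j k. (v i j k)\<^sup>2) \<le> 0"
  shows "v i j k = 0"
proof -
  have z: "v i j k = 0" if "i \<in> {1..int N}" "j \<in> {1..int N}" "k \<in> {1..int N}" for i j k
  proof -
    have "(\<Sum>(i,j,k)\<in>{1..int N} \<times> {1..int N} \<times> {1..int N}. (v i j k)\<^sup>2) \<le> 0"
      using assms(3) by (simp add: gsum_def sum.cartesian_product)
    moreover have "(v i j k)\<^sup>2 \<le> (\<Sum>(i,j,k)\<in>{1..int N} \<times> {1..int N} \<times> {1..int N}. (v i j k)\<^sup>2)"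
      using member_le_sum[of "(i,j,k)" "{1..int N} \<times> {1..int N} \<times> {1..int N}" "\<lambda>(i,j,k). (v i j k)\<^sup>2"] that
      by auto
    ultimately show ?thesis by (smt (verit) zero_le_power2 power2_eq_iff_nonneg zero_power2 power_zero_numeral zero_eq_power2)
  qed
  have "(x - 1) mod int N + 1 \<in> {1..int N}" for x
    using pos_mod_sign[of "int N" "x - 1"] pos_mod_bound[of "int N" "x - 1"] assms(2) by (auto simp: add1_zle_eq)
  then show ?thesis using z gper_mod[OF assms(1), of i j k] by metis
qed

lemma gsum_glap:
  assumes "gper N v" "h > 0"
  shows "gsum N (glap h v) = 0"
  using gsum_glap_mult[OF assms(1) _ assms(2), of "\<lambda>_ _ _. 1"] assms(2)
  by (simp add: gper_def gform_def gsum_const)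

text \<open>Testing the equation with v itself makes the gradient vanish, and the discrete Poincare
  inequality then makes v vanish. This gives both injectivity for \<open>glap_solvable\<close> and
  uniqueness of the inverse Laplacian.\<close>

lemma gper_glap_zero:
  assumes "gper N v" "gsum N v = 0" "\<And>i j k. glap h v i j k = 0" "h > 0" "N > 0"
  shows "v i j k = 0"
proof (rule gper_eq_zero_iff[OF assms(1,5)])
  have "gform N h v v = 0"
    using gsum_glap_mult[OF assms(1,1,4)] assms(3) by (simp add: gsum_const)
  then have "h ^ 3 * gsum N (\<lambda>i j k. (v i j k)\<^sup>2) \<le> 0"
    using discrete_poincare[OF assms(2,4)] by simp
  then show "gsum N (\<lambda>i j k. (v i j k)\<^sup>2) \<le> 0" using assms(4) by (simp add: mult_le_0_iff)
qed

lemma glap_sum: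
  assumes "finite I"
  shows "glap h (\<lambda>i j k. \<Sum>p\<in>I. x p * d p i j k) i j k = (\<Sum>p\<in>I. x p * glap h (d p) i j k)"
  using assms by (induction I rule: finite_induct) (simp_all add: glap_const glap_add glap_cmult)

lemma gsum_sum:
  assumes "finite I"
  shows "gsum N (\<lambda>i j k. \<Sum>p\<in>I. x p * d p i j k) = (\<Sum>p\<in>I. x p * gsum N (d p))"
  using assms by (induction I rule: finite_induct) (simp_all add: gsum_const gsum_add gsum_cmult)

text \<open>The rank-one term \<open>gsum N v\<close> added to the Laplacian makes the square system injective; summing
  the solved system over a period shows that it vanishes when the right-hand side has mean zero.\<close>
lemma glap_solvable:
  assumes "gper N \<psi>" "gsum N \<psi> = 0" "h > 0" "N > 0"
  shows "\<exists>v. gper N v \<and> gsum N v = 0 \<and> (\<forall>i j k. - glap h v i j k = \<psi> i j k)"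
proof -
  define I where "I = {1..int N} \<times> {1..int N} \<times> {1..int N}"
  define r where "r = (\<lambda>i. (i - 1) mod int N + 1)"
  \<comment> \<open>\<open>d p\<close> is the N-periodic extension of the unit grid function at p,
    so \<open>E x\<close> extends the cell values x periodically and the unknowns form a finite
    family.\<close>
  define d :: "int \<times> int \<times> int \<Rightarrow> grid" where "d = (\<lambda>p i j k. if p = (r i, r j, r k) then 1 else 0)"
  define E where "E = (\<lambda>x i j k. \<Sum>p\<in>I. x p * d p i j k)"
  define A where "A = (\<lambda>(i,j,k) p. gsum N (d p) - glap h (d p) i j k)"
  have finI: "finite I" by (simp add: I_def)
  have r_in: "r i \<in> {1..int N}" for i
    using pos_mod_sign[of "int N" "i - 1"] pos_mod_bound[of "int N" "i - 1"] assms(4)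
    by (auto simp: r_def add1_zle_eq)
  have r_id: "r i = i" if "i \<in> {1..int N}" for i
    using that unfolding r_def by (subst mod_pos_pos_trivial) auto
  have r_per: "r (i + int N) = r i" for i
    unfolding r_def using mod_add_self2[of "i - 1" "int N"] by (simp add: algebra_simps)
  have E_per: "gper N (E x)" for x
    unfolding gper_def E_def d_def by (simp add: r_per)
  have E_at: "E x i j k = x (i,j,k)" if "(i,j,k) \<in> I" for x i j k
  proof -
    have "E x i j k = (\<Sum>p\<in>I. if p = (i,j,k) then x p else 0)"
      unfolding E_def d_def using that by (intro sum.cong) (auto simp: I_def r_id)
    then show ?thesis using that finI by simp
  qed
  have A_app: "(\<Sum>p\<in>I. A (i,j,k) p * x p) = gsum N (E x) - glap h (E x) i j k" for x i j k
    unfolding A_def E_def glap_sum[OF finI] gsum_sum[OF finI]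
    by (simp add: left_diff_distrib sum_subtractf mult.commute[of "x _"])
  have solved: "gsum N (E x) = 0 \<and> (\<forall>i j k. - glap h (E x) i j k = b i j k)"
    if eq: "\<forall>q\<in>I. (\<Sum>p\<in>I. A q p * x p) = (case q of (i,j,k) \<Rightarrow> b i j k)"
      and b: "gper N b" "gsum N b = 0" for x b
  proof -
    define w where "w = (\<lambda>i j k. gsum N (E x) - glap h (E x) i j k - b i j k)"
    have w_per: "gper N w" using gper_glap[OF E_per, of h x] b(1) unfolding w_def
      by (intro gper_comp2[where F="(-)"] gper_comp1[where F="\<lambda>y. gsum N (E x) - y"])
    have w0: "w i j k = 0" for i j k
    proof -
      have "(r i, r j, r k) \<in> I" using r_in by (auto simp: I_def)
      then have "w (r i) (r j) (r k) = 0" using eq A_app[of "r i" "r j" "r k" x] by (auto simp: w_def)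
      then show ?thesis using gper_mod[OF w_per, of i j k] by (simp add: r_def)
    qed
    then have "gsum N w = 0" by (simp add: gsum_def)
    moreover have "gsum N w = real N ^ 3 * gsum N (E x)"
      unfolding w_def gsum_diff gsum_const using gsum_glap[OF E_per assms(3)] b(2) by simp
    ultimately have "gsum N (E x) = 0" using assms(4) by simp
    then show ?thesis using w0 by (simp add: w_def)
  qed
  have "\<exists>x. \<forall>q\<in>I. (\<Sum>p\<in>I. A q p * x p) = (case q of (i,j,k) \<Rightarrow> \<psi> i j k)"
  proof (rule square_system_solvable[OF finI])
    fix x assume "\<forall>q\<in>I. (\<Sum>p\<in>I. A q p * x p) = 0"
    then have s: "gsum N (E x) = 0 \<and> (\<forall>i j k. - glap h (E x) i j k = 0)"
      using solved[of x "\<lambda>_ _ _. 0"] by (simp add: gper_def gsum_const)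
    then have "E x i j k = 0" for i j k
      using gper_glap_zero[OF E_per _ _ assms(3,4)] by simp
    then show "\<forall>p\<in>I. x p = 0" using E_at[of _ _ _ x] by (auto simp: I_def)
  qed
  then obtain x where "\<forall>q\<in>I. (\<Sum>p\<in>I. A q p * x p) = (case q of (i,j,k) \<Rightarrow> \<psi> i j k)" by blast
  from solved[OF this assms(1,2)] E_per show ?thesis by blast
qed

section \<open>The discrete negative norm\<close>

text \<open>Removes the definite description in \<open>ginvlap\<close>: any periodic mean-zero
  potential computes the norm, since two such potentials differ by a mean-zero discrete harmonic
  function, which is zero.\<close>

lemma gneg_norm_eq:
  assumes "gper N v" "gsum N v = 0" "\<And>i j k. - glap h v i j k = \<psi> i j k" "h > 0" "N > 0"
  shows "gneg_norm N h \<psi> = sqrt (gform N h v v)"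
proof -
  have "ginvlap N h \<psi> = v"
    unfolding ginvlap_def
  proof (rule the_equality)
    show "gper N v \<and> ginner N h v (\<lambda>_ _ _. 1) = 0 \<and> (\<forall>i j k. - glap h v i j k = \<psi> i j k)"
      using assms by (simp add: ginner_eq_gsum)
    fix w assume w: "gper N w \<and> ginner N h w (\<lambda>_ _ _. 1) = 0 \<and> (\<forall>i j k. - glap h w i j k = \<psi> i j k)"
    have "gsum N w = 0" using w assms(4) by (simp add: ginner_eq_gsum)
    moreover have "glap h (\<lambda>i j k. w i j k - v i j k) i j k = 0" for i j k
      unfolding glap_diff using w assms(3) by (metis diff_self neg_equal_iff_equal)
    ultimately have "w i j k - v i j k = 0" for i j k
      using gper_glap_zero[OF gper_comp2[where F="(-)", of N w v], of h i j k] w assms(1,2,4,5)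
      by (simp add: gsum_diff)
    then show "w = v" by (intro ext) simp
  qed
  then have "ginner N h \<psi> (ginvlap N h \<psi>) = h ^ 3 * gsum N (\<lambda>i j k. - glap h v i j k * v i j k)"
    unfolding ginner_eq_gsum using assms(3) by simp
  also have "\<dots> = gform N h v v"
    using gsum_glap_mult[OF assms(1,1,4)] by (simp add: gsum_minus)
  finally show ?thesis by (simp add: gneg_norm_def)
qed

text \<open>The negative norm is controlled by the discrete L2 norm. The equation is tested with v;
  the Young weight P/2 is chosen so that the Poincare inequality turns the v term into exactly half
  of the left-hand side.\<close>

lemma gform_inverse_le:
  assumes "gper N v" "gsum N v = 0" "\<And>i j k. - glap h v i j k = \<psi> i j k" "h > 0" "N > 0"
  shows "gform N h v v \<le> 3 / 2 * (real N * h)\<^sup>2 * (h ^ 3 * gsum N (\<lambda>i j k. (\<psi> i j k)\<^sup>2))"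
proof -
  define P where "P = 3 / 2 * (real N * h)\<^sup>2"
  have P: "P > 0" using assms by (simp add: P_def)
  have "gform N h v v = h ^ 3 * gsum N (\<lambda>i j k. \<psi> i j k * v i j k)"
    using gsum_glap_mult[OF assms(1,1,4)] by (simp add: assms(3)[symmetric] gsum_minus)
  also have "\<dots> \<le> h ^ 3 * gsum N (\<lambda>i j k. (P / 2) * (\<psi> i j k)\<^sup>2 + (v i j k)\<^sup>2 / (2 * P))"
  proof (intro mult_left_mono gsum_mono)
    fix i j k
    show "\<psi> i j k * v i j k \<le> (P / 2) * (\<psi> i j k)\<^sup>2 + (v i j k)\<^sup>2 / (2 * P)"
      using young[of "P / 2" "\<psi> i j k" "v i j k"] P by simp
  qed (use assms in simp)
  also have "\<dots> = P / 2 * (h ^ 3 * gsum N (\<lambda>i j k. (\<psi> i j k)\<^sup>2)) + (h ^ 3 * gsum N (\<lambda>i j k. (v i j k)\<^sup>2)) / (2 * P)"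
    unfolding gsum_add gsum_cmult gsum_divide by (simp add: algebra_simps)
  also have "(h ^ 3 * gsum N (\<lambda>i j k. (v i j k)\<^sup>2)) / (2 * P) \<le> (P * gform N h v v) / (2 * P)"
    using discrete_poincare[OF assms(2,4)] P by (intro divide_right_mono) (auto simp: P_def)
  finally have "gform N h v v \<le> P * (h ^ 3 * gsum N (\<lambda>i j k. (\<psi> i j k)\<^sup>2))" using P by simp
  then show ?thesis unfolding P_def .
qed

lemma gsum_young:
  assumes "c > 0" "h > 0"
  shows "h ^ 3 * gsum N (\<lambda>i j k. u i j k * v i j k)
     \<le> c * (h ^ 3 * gsum N (\<lambda>i j k. (u i j k)\<^sup>2)) + h ^ 3 * gsum N (\<lambda>i j k. (v i j k)\<^sup>2) / (4 * c)"
proof -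
  have "h ^ 3 * gsum N (\<lambda>i j k. u i j k * v i j k)
     \<le> h ^ 3 * gsum N (\<lambda>i j k. c * (u i j k)\<^sup>2 + (v i j k)\<^sup>2 / (4 * c))"
    using assms by (intro mult_left_mono gsum_mono young) auto
  also have "\<dots> = c * (h ^ 3 * gsum N (\<lambda>i j k. (u i j k)\<^sup>2)) + h ^ 3 * gsum N (\<lambda>i j k. (v i j k)\<^sup>2) / (4 * c)"
    unfolding gsum_add gsum_cmult gsum_divide by (simp add: algebra_simps)
  finally show ?thesis .
qed

lemma gsum_sq_le_bound:
  assumes "h > 0" "\<And>i j k. \<bar>u i j k\<bar> \<le> R"
  shows "h ^ 3 * gsum N (\<lambda>i j k. (u i j k)\<^sup>2) \<le> (real N * h) ^ 3 * R\<^sup>2"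
proof -
  have "h ^ 3 * gsum N (\<lambda>i j k. (u i j k)\<^sup>2) \<le> h ^ 3 * gsum N (\<lambda>i j k. R\<^sup>2)"
    using assms by (intro mult_left_mono gsum_mono) (simp_all add: abs_le_square_iff[symmetric] order.trans[OF _ abs_ge_self])
  then show ?thesis by (simp add: gsum_const power_mult_distrib mult.commute mult.left_commute)
qed

section \<open>One energy step and its iteration\<close>

lemma log_difference_monotone:
  fixes a b :: real
  assumes "\<bar>a\<bar> < 1" "\<bar>b\<bar> < 1"
  shows "0 \<le> (a - b) * ((ln (1 + a) - ln (1 - a)) - (ln (1 + b) - ln (1 - b)))"
proof (cases "b \<le> a")
  case True
  then have "ln (1 + b) \<le> ln (1 + a)" "ln (1 - a) \<le> ln (1 - b)" using assms by auto
  then show ?thesis using True by (intro mult_nonneg_nonneg) auto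
next
  case False
  then have "ln (1 + a) \<le> ln (1 + b)" "ln (1 - b) \<le> ln (1 - a)" using assms by auto
  then show ?thesis using False by (intro mult_nonpos_nonpos) auto
qed

text \<open>The error equation tested with the new potential \<open>v1\<close>. The term A meets
  \<open>v1\<close> directly; the defect B stands under the Laplacian and so meets only
  -\<open>e1\<close>. The explicit term is rewritten as the Dirichlet form of \<open>v0\<close> and
  \<open>e1\<close>, which produces the growth factor on the old energy. Of the dissipation eps^2
  |grad e1|^2, one quarter absorbs the explicit term and one eighth each A and B, leaving one
  half.\<close>

lemma energy_step:
  fixes eps theta0 h dt R \<kappa> :: real
  assumes pos: "eps > 0" "theta0 > 0" "h > 0" "N > 0" "dt > 0"
    and per: "gper N W0" "gper N W1" "gper N p0" "gper N p1" "gper N A" "gper N B"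
    and bnd: "\<And>i j k. \<bar>W1 i j k\<bar> < 1" "\<And>i j k. \<bar>p1 i j k\<bar> < 1"
      "\<And>i j k. \<bar>A i j k\<bar> \<le> R" "\<And>i j k. \<bar>B i j k\<bar> \<le> R"
    and e: "e0 = (\<lambda>i j k. W0 i j k - p0 i j k)" "e1 = (\<lambda>i j k. W1 i j k - p1 i j k)"
    and v0: "gper N v0" "gsum N v0 = 0" "\<And>i j k. - glap h v0 i j k = e0 i j k"
    and v1: "gper N v1" "gsum N v1 = 0" "\<And>i j k. - glap h v1 i j k = e1 i j k"
    and mean: "gsum N e1 = 0"
    and scheme: "\<And>i j k. (p1 i j k - p0 i j k) / dt = glap h (disc_mu eps theta0 h p0 p1) i j k"
    and consistent: "\<And>i j k. (W1 i j k - W0 i j k) / dt + \<kappa> =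
        glap h (disc_mu eps theta0 h W0 W1) i j k + glap h B i j k + A i j k"
  defines "P \<equiv> 3 / 2 * (real N * h)\<^sup>2"
  shows "gform N h v1 v1 + eps\<^sup>2 * dt * gform N h e1 e1 \<le>
     (1 + dt * (2 * theta0\<^sup>2 / eps\<^sup>2)) * gform N h v0 v0
     + dt * (4 * (P + P ^ 3) / eps\<^sup>2 * (real N * h) ^ 3 * R\<^sup>2)"
proof -
  define I where "I = (\<lambda>u v. h ^ 3 * gsum N (\<lambda>i j k. u i j k * v i j k))"
  have I_sq: "I u u = h ^ 3 * gsum N (\<lambda>i j k. (u i j k)\<^sup>2)" for u
    by (simp add: I_def power2_eq_square)
  have I_glap: "I (glap h u) w = - gform N h u w" if "gper N u" "gper N w" for u w
    unfolding I_def by (rule gsum_glap_mult[OF that pos(3)])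
  have P: "P > 0" using pos by (simp add: P_def)
  define G where "G = (\<lambda>i j k. (ln (1 + W1 i j k) - ln (1 - W1 i j k)) - (ln (1 + p1 i j k) - ln (1 - p1 i j k)))"
  define Y where "Y = (\<lambda>i j k. G i j k - theta0 * e0 i j k - eps\<^sup>2 * glap h e1 i j k + B i j k)"
  have e_per: "gper N e0" "gper N e1" unfolding e by (intro gper_comp2[where F="(-)"] per)+
  have G_per: "gper N G" unfolding G_def
    by (intro gper_comp2[where F="\<lambda>x y. (ln (1 + x) - ln (1 - x)) - (ln (1 + y) - ln (1 - y))"] per)
  have Y_per: "gper N Y" unfolding Y_def
    by (intro gper_comp2[where F="(+)"] gper_comp2[where F="\<lambda>x y. x - eps\<^sup>2 * y"]
        gper_comp2[where F="\<lambda>x y. x - theta0 * y"] G_per e_per per gper_glap)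
  have Y_eq: "Y = (\<lambda>i j k. (disc_mu eps theta0 h W0 W1 i j k - disc_mu eps theta0 h p0 p1 i j k) + B i j k)"
    unfolding Y_def G_def e disc_mu_def glap_diff by (intro ext) (simp add: algebra_simps)
  have eqn: "e1 i j k - e0 i j k = dt * (glap h Y i j k + A i j k - \<kappa>)" for i j k
  proof -
    have "glap h Y i j k + A i j k - \<kappa> = (W1 i j k - W0 i j k) / dt - (p1 i j k - p0 i j k) / dt"
      unfolding Y_eq glap_add glap_diff scheme using consistent[of i j k] by simp
    then have "dt * (glap h Y i j k + A i j k - \<kappa>) = (W1 i j k - W0 i j k) - (p1 i j k - p0 i j k)"
      using pos(5) by (simp add: diff_divide_distrib[symmetric])
    then show ?thesis unfolding e by simp
  qed
  have "I e1 v1 - I e0 v1 = I (\<lambda>i j k. e1 i j k - e0 i j k) v1"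
    unfolding I_def left_diff_distrib gsum_diff by (simp add: right_diff_distrib)
  \<comment> \<open>The constant \<kappa> drops out because \<open>v1\<close> has mean zero; the
    shift of the exact solution thus contributes nothing, whatever its rate of change in
    time.\<close>
  also have "\<dots> = dt * (I (glap h Y) v1 + I A v1)"
  proof -
    have "gsum N (\<lambda>i j k. dt * (glap h Y i j k + A i j k - \<kappa>) * v1 i j k) =
      gsum N (\<lambda>i j k. dt * (glap h Y i j k * v1 i j k + A i j k * v1 i j k - \<kappa> * v1 i j k))"
      by (simp add: algebra_simps)
    then show ?thesis unfolding I_def eqn unfolding gsum_cmult gsum_diff gsum_add using v1(2)
      by (simp add: algebra_simps)
  qed
  \<comment> \<open>Self-adjointness moves the Laplacian from Y to the potential, where it becomes
    -\<open>e1\<close>; no difference of the logarithms or of B has to be estimated.\<close>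
  also have "I (glap h Y) v1 = I (glap h v1) Y"
    using I_glap[OF Y_per v1(1)] I_glap[OF v1(1) Y_per] gform_commute[of N h Y v1] by simp
  also have "I (glap h v1) Y = - I e1 Y"
    unfolding I_def v1(3)[symmetric] by (simp add: gsum_minus)
  also have "I e1 Y = I e1 G - theta0 * I e0 e1 - eps\<^sup>2 * I (glap h e1) e1 + I e1 B"
  proof -
    have "gsum N (\<lambda>i j k. e1 i j k * Y i j k) = gsum N (\<lambda>i j k. e1 i j k * G i j k
       - theta0 * (e0 i j k * e1 i j k) - eps\<^sup>2 * (glap h e1 i j k * e1 i j k) + e1 i j k * B i j k)"
      unfolding Y_def by (simp add: algebra_simps)
    then show ?thesis unfolding I_def by (simp only: gsum_cmult gsum_diff gsum_add distrib_left right_diff_distrib mult.left_commute)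
  qed
  also have "I (glap h e1) e1 = - gform N h e1 e1" by (rule I_glap[OF e_per(2,2)])
  finally have main: "I e1 v1 - I e0 v1 = dt * (- (I e1 G - theta0 * I e0 e1 - eps\<^sup>2 * - gform N h e1 e1 + I e1 B) + I A v1)" .
  have inv: "I e1 u = gform N h v1 u" "I e0 u = gform N h v0 u" if "gper N u" for u
    using I_glap[OF v1(1) that] I_glap[OF v0(1) that] unfolding I_def
    by (simp_all add: v1(3)[symmetric] v0(3)[symmetric] gsum_minus)
  define a0 a1 g1 where "a0 = gform N h v0 v0" and "a1 = gform N h v1 v1" and "g1 = gform N h e1 e1"
  have b1: "I e0 v1 \<le> a0 / 2 + a1 / 2"
    using gform_young[OF pos(3), of "1/2" N v0 v1] inv(2)[OF v1(1)] by (simp add: a0_def a1_def)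
  have b2: "0 \<le> I e1 G"
    unfolding I_def e G_def using pos(3)
    by (intro mult_nonneg_nonneg[of "h ^ 3"] gsum_nonneg log_difference_monotone bnd(1,2)) simp
  \<comment> \<open>The weight theta0/eps^2 is the one that leaves a quarter of the dissipation
    after multiplication by theta0.\<close>
  have b3: "theta0 * I e0 e1 \<le> theta0\<^sup>2 / eps\<^sup>2 * a0 + eps\<^sup>2 * g1 / 4"
  proof -
    have "I e0 e1 \<le> theta0 / eps\<^sup>2 * a0 + g1 / (4 * (theta0 / eps\<^sup>2))"
      using gform_young[OF pos(3), of "theta0 / eps\<^sup>2" N v0 e1] inv(2)[OF e_per(2)] pos by (simp add: a0_def g1_def)
    from mult_left_mono[OF this, of theta0] pos
    have "theta0 * I e0 e1 \<le> theta0 * (theta0 / eps\<^sup>2 * a0 + g1 / (4 * (theta0 / eps\<^sup>2)))" by simp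
    also have "\<dots> = theta0\<^sup>2 / eps\<^sup>2 * a0 + eps\<^sup>2 * g1 / 4"
      using pos by (simp add: field_simps power2_eq_square)
    finally show ?thesis .
  qed
  have poin: "I e1 e1 \<le> P * g1" "I v1 v1 \<le> P * a1"
    unfolding I_sq P_def g1_def a1_def by (intro discrete_poincare mean v1 pos)+
  have a1_le: "a1 \<le> P * I e1 e1"
    using gform_inverse_le[OF v1(1,2,3) pos(3,4)] unfolding a1_def I_sq P_def by simp
  define V where "V = (real N * h) ^ 3 * R\<^sup>2"
  have b4: "- I e1 B \<le> 2 * P / eps\<^sup>2 * V + eps\<^sup>2 * g1 / 8"
  proof -
    have "- I e1 B = I (\<lambda>i j k. - B i j k) e1"
      unfolding I_def by (simp add: gsum_minus mult.commute)
    also have "\<dots> \<le> 2 * P / eps\<^sup>2 * (h ^ 3 * gsum N (\<lambda>i j k. (- B i j k)\<^sup>2)) + I e1 e1 / (4 * (2 * P / eps\<^sup>2))"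
      unfolding I_def using gsum_young[of "2 * P / eps\<^sup>2" h N "\<lambda>i j k. - B i j k" e1] P pos
      by (simp add: power2_eq_square)
    also have "\<dots> \<le> 2 * P / eps\<^sup>2 * V + (P * g1) / (4 * (2 * P / eps\<^sup>2))"
      unfolding V_def using P pos poin(1) bnd(4)
      by (intro add_mono mult_left_mono divide_right_mono gsum_sq_le_bound) auto
    also have "(P * g1) / (4 * (2 * P / eps\<^sup>2)) = eps\<^sup>2 * g1 / 8" using P pos by (simp add: field_simps)
    finally show ?thesis .
  qed
  \<comment> \<open>Three factors P occur because \<open>v1\<close> reaches the gradient of
    \<open>e1\<close> in three steps: Poincare for \<open>v1\<close>, the negative norm bounded by
    the L2 norm of \<open>e1\<close>, Poincare for \<open>e1\<close>.\<close>
  have b5: "I A v1 \<le> 2 * P ^ 3 / eps\<^sup>2 * V + eps\<^sup>2 * g1 / 8"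
  proof -
    have "I A v1 \<le> 2 * P ^ 3 / eps\<^sup>2 * (h ^ 3 * gsum N (\<lambda>i j k. (A i j k)\<^sup>2)) + I v1 v1 / (4 * (2 * P ^ 3 / eps\<^sup>2))"
      unfolding I_def using gsum_young[of "2 * P ^ 3 / eps\<^sup>2" h N A v1] P pos
      by (simp add: power2_eq_square)
    also have "I v1 v1 \<le> P * (P * (P * g1))"
      using poin(2) a1_le poin(1) P by (smt (verit, best) mult_left_mono)
    also have "h ^ 3 * gsum N (\<lambda>i j k. (A i j k)\<^sup>2) \<le> V"
      unfolding V_def using pos bnd(3) by (intro gsum_sq_le_bound) auto
    also have "P * (P * (P * g1)) / (4 * (2 * P ^ 3 / eps\<^sup>2)) = eps\<^sup>2 * g1 / 8"
      using P pos by (simp add: field_simps power3_eq_cube)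
    finally show ?thesis using P pos by (simp add: divide_right_mono mult_left_mono)
  qed
  have "I e1 v1 = a1" using inv(1)[OF v1(1)] by (simp add: a1_def)
  with main have "a1 - I e0 v1 = dt * (- I e1 G + theta0 * I e0 e1 - eps\<^sup>2 * g1 - I e1 B + I A v1)"
    by (simp add: g1_def algebra_simps)
  also have "\<dots> \<le> dt * (theta0\<^sup>2 / eps\<^sup>2 * a0 - eps\<^sup>2 * g1 / 2 + (2 * P / eps\<^sup>2 * V + 2 * P ^ 3 / eps\<^sup>2 * V))"
    using b2 b3 b4 b5 pos(5) by (intro mult_left_mono) auto
  finally have "a1 - (a0 / 2 + a1 / 2) \<le> dt * (theta0\<^sup>2 / eps\<^sup>2 * a0 - eps\<^sup>2 * g1 / 2 + (2 * P / eps\<^sup>2 * V + 2 * P ^ 3 / eps\<^sup>2 * V))"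
    using b1 by linarith
  \<comment> \<open>Half of the new energy was absorbed on the left, so everything is doubled; the
    remaining half of the dissipation becomes the full term of the conclusion.\<close>
  moreover have "x1 + dt * e \<le> x0 + dt * (2 * s) + dt * (2 * w)"
    if "x1 - (x0 / 2 + x1 / 2) \<le> dt * (s - e / 2 + w)" for x0 x1 s e w :: real
    using that by (simp add: algebra_simps)
  ultimately have "a1 + dt * (eps\<^sup>2 * g1) \<le> a0 + dt * (2 * (theta0\<^sup>2 / eps\<^sup>2 * a0))
      + dt * (2 * (2 * P / eps\<^sup>2 * V + 2 * P ^ 3 / eps\<^sup>2 * V))" by blast
  moreover have "2 * (2 * P / eps\<^sup>2 * V + 2 * P ^ 3 / eps\<^sup>2 * V) = 4 * (P + P ^ 3) / eps\<^sup>2 * V"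
    by (simp add: add_divide_distrib distrib_left distrib_right)
  ultimately have "a1 + eps\<^sup>2 * dt * g1 \<le> (1 + dt * (2 * theta0\<^sup>2 / eps\<^sup>2)) * a0
     + dt * (4 * (P + P ^ 3) / eps\<^sup>2 * V)"
    by (simp add: distrib_right mult.assoc mult.left_commute)
  then show ?thesis unfolding a0_def a1_def g1_def V_def by (simp add: mult.assoc)
qed

text \<open>The growth factor multiplies the old value, as the explicit term of the scheme leaves
  it. The dissipated amounts g are carried along in the induction: being nonnegative, their sum may
  be enlarged by the factor 1 + k at each step.\<close>

lemma discrete_gronwall:
  fixes a g :: "nat \<Rightarrow> real"
  assumes step: "\<And>m. m < n \<Longrightarrow> a (Suc m) + g (Suc m) \<le> (1 + k) * a m + q"
    and nonneg: "\<And>m. 0 \<le> g m" "0 \<le> k" "0 \<le> q" "0 \<le> a 0"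
  shows "a n + (\<Sum>m\<in>{1..n}. g m) \<le> exp (real n * k) * (a 0 + real n * q)"
proof -
  have "a m + (\<Sum>m\<in>{1..m}. g m) \<le> (1 + k) ^ m * (a 0 + real m * q)" if "m \<le> n" for m
    using that
  proof (induction m)
    case (Suc m)
    define S where "S = (\<Sum>m\<in>{1..m}. g m)"
    have S: "0 \<le> S" unfolding S_def by (intro sum_nonneg nonneg)
    have "a (Suc m) + (\<Sum>m\<in>{1..Suc m}. g m) \<le> (1 + k) * a m + q + S"
      using step[of m] Suc.prems by (simp add: S_def)
    also have "\<dots> \<le> (1 + k) * (a m + S) + q"
      using mult_right_mono[of 1 "1 + k" S] nonneg(2) S by (simp add: algebra_simps)
    also have "\<dots> \<le> (1 + k) * ((1 + k) ^ m * (a 0 + real m * q)) + (1 + k) ^ Suc m * q"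
      using Suc nonneg(2,3) mult_right_mono[OF one_le_power[of "1 + k" "Suc m"], of q]
      by (intro add_mono mult_left_mono) (auto simp: S_def)
    also have "\<dots> = (1 + k) ^ Suc m * (a 0 + real (Suc m) * q)"
      by (simp add: algebra_simps)
    finally show ?case .
  qed simp
  from this[of n] have "a n + (\<Sum>m\<in>{1..n}. g m) \<le> (1 + k) ^ n * (a 0 + real n * q)" by simp
  also have "(1 + k) ^ n \<le> exp (real n * k)"
    using power_mono[OF exp_ge_add_one_self[of k], of n] nonneg(2) by (simp add: exp_of_nat_mult[symmetric])
  finally show ?thesis using nonneg by (simp add: mult_right_mono)
qed

section \<open>Spatial derivatives and finite differences\<close>

text \<open>One constant for the function and all its partials up to order k. The recursive form
  lets sums, products and compositions be bounded by induction, without handling the suprema of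
  \<open>Ck_norm\<close>.\<close>

fun CkB :: "nat \<Rightarrow> real \<Rightarrow> field3 \<Rightarrow> bool" where
  "CkB 0 B f = (continuous_on UNIV f \<and> (\<forall>x. \<bar>f x\<bar> \<le> B))"
| "CkB (Suc k) B f = (continuous_on UNIV f \<and> (\<forall>x. \<bar>f x\<bar> \<le> B) \<and>
      (\<forall>i x. (\<lambda>s. f (x + s *\<^sub>R axis i 1)) differentiable (at 0)) \<and>
      (\<forall>i. CkB k B (pd i f)))"

lemma CkB_cont: "CkB k B f \<Longrightarrow> continuous_on UNIV f"
  and CkB_bound: "CkB k B f \<Longrightarrow> \<bar>f x\<bar> \<le> B"
  by (cases k; simp)+

lemma CkB_bound_nonneg: "CkB k B f \<Longrightarrow> 0 \<le> B"
  using CkB_bound[of k B f 0] by linarith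

lemma CkB_pd: "CkB (Suc k) B f \<Longrightarrow> CkB k B (pd i f)"
  by simp

lemma CkB_mono: "CkB k B f \<Longrightarrow> B \<le> B' \<Longrightarrow> CkB k B' f"
proof (induction k arbitrary: f)
  case 0
  then show ?case by (auto intro: order.trans)
next
  case (Suc k)
  then show ?case by simp (meson order.trans)
qed

lemma CkB_Suc_lower: "CkB (Suc k) B f \<Longrightarrow> CkB k B f"
  by (induction k arbitrary: f) auto

lemma CkB_lower: "CkB k B f \<Longrightarrow> j \<le> k \<Longrightarrow> CkB j B f"
  by (induction k) (auto simp: le_Suc_eq dest: CkB_Suc_lower simp del: CkB.simps)

lemma pd_deriv:
  assumes "(\<lambda>s. f (x + s *\<^sub>R axis i 1)) differentiable (at 0)"
  shows "((\<lambda>s. f (x + s *\<^sub>R axis i 1)) has_real_derivative pd i f x) (at 0)"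
  using assms unfolding pd_def
  by (simp add: DERIV_deriv_iff_real_differentiable)

lemma CkB_deriv:
  assumes "CkB (Suc k) B f"
  shows "((\<lambda>s. f (x + s *\<^sub>R axis i 1)) has_real_derivative pd i f x) (at 0)"
  using assms by (intro pd_deriv) simp

lemma CkB_deriv_line:
  assumes "CkB (Suc k) B f"
  shows "((\<lambda>s. f (x + s *\<^sub>R axis i 1)) has_real_derivative pd i f (x + s *\<^sub>R axis i 1)) (at s)"
proof -
  have "((\<lambda>t. f ((x + s *\<^sub>R axis i 1) + (t - s) *\<^sub>R axis i 1)) has_real_derivative pd i f (x + s *\<^sub>R axis i 1)) (at s)"
    using DERIV_shift[of "\<lambda>t. f ((x + s *\<^sub>R axis i 1) + t *\<^sub>R axis i 1)" "pd i f (x + s *\<^sub>R axis i 1)" s "-s"]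
      CkB_deriv[OF assms, of "x + s *\<^sub>R axis i 1" i] by simp
  then show ?thesis by (simp add: algebra_simps)
qed

text \<open>Introduction by exhibiting the partials: a proved derivative along each axis identifies
  \<open>pd\<close>, so the closure rules below only name the expected formula.\<close>

lemma CkB_SucI:
  assumes "continuous_on UNIV f" "\<And>x. \<bar>f x\<bar> \<le> B"
    and "\<And>i x. ((\<lambda>s. f (x + s *\<^sub>R axis i 1)) has_real_derivative g i x) (at 0)"
    and "\<And>i. CkB k B (g i)"
  shows "CkB (Suc k) B f"
proof -
  have "pd i f = g i" for i
    unfolding pd_def using assms(3) by (intro ext DERIV_imp_deriv)
  moreover have "(\<lambda>s. f (x + s *\<^sub>R axis i 1)) differentiable (at 0)" for i x
    using assms(3) real_differentiable_def by blast
  ultimately show ?thesis using assms by simp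
qed

lemma CkB_add:
  assumes "CkB k A f" "CkB k B g" shows "CkB k (A + B) (\<lambda>x. f x + g x)"
  using assms
proof (induction k arbitrary: f g)
  case 0
  then show ?case by (auto intro!: continuous_intros order.trans[OF abs_triangle_ineq] add_mono)
next
  case (Suc k)
  show ?case
  proof (rule CkB_SucI)
    show "continuous_on UNIV (\<lambda>x. f x + g x)" by (intro continuous_intros CkB_cont[OF Suc.prems(1)] CkB_cont[OF Suc.prems(2)])
    show "\<bar>f x + g x\<bar> \<le> A + B" for x
      using CkB_bound[OF Suc.prems(1), of x] CkB_bound[OF Suc.prems(2), of x] by linarith
    show "((\<lambda>s. f (x + s *\<^sub>R axis i 1) + g (x + s *\<^sub>R axis i 1)) has_real_derivative pd i f x + pd i g x) (at 0)" for i x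
      by (intro DERIV_add CkB_deriv[OF Suc.prems(1)] CkB_deriv[OF Suc.prems(2)])
    show "CkB k (A + B) (\<lambda>x. pd i f x + pd i g x)" for i
      by (intro Suc.IH CkB_pd Suc.prems)
  qed
qed

lemma CkB_cmult:
  assumes "CkB k A f" shows "CkB k (\<bar>c\<bar> * A) (\<lambda>x. c * f x)"
  using assms
proof (induction k arbitrary: f)
  case 0
  then show ?case by (auto intro!: continuous_intros simp: abs_mult mult_left_mono)
next
  case (Suc k)
  show ?case
  proof (rule CkB_SucI)
    show "continuous_on UNIV (\<lambda>x. c * f x)" by (intro continuous_intros CkB_cont[OF Suc.prems])
    show "\<bar>c * f x\<bar> \<le> \<bar>c\<bar> * A" for x
      using CkB_bound[OF Suc.prems(1), of x] by (simp add: abs_mult mult_left_mono)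
    show "((\<lambda>s. c * f (x + s *\<^sub>R axis i 1)) has_real_derivative c * pd i f x) (at 0)" for i x
      by (intro DERIV_cmult CkB_deriv[OF Suc.prems])
    show "CkB k (\<bar>c\<bar> * A) (\<lambda>x. c * pd i f x)" for i
      by (intro Suc.IH CkB_pd Suc.prems)
  qed
qed

lemma CkB_minus: "CkB k A f \<Longrightarrow> CkB k A (\<lambda>x. - f x)"
  using CkB_cmult[of k A f "-1"] by simp

lemma CkB_diff:
  assumes "CkB k A f" "CkB k B g" shows "CkB k (A + B) (\<lambda>x. f x - g x)"
  using CkB_add[OF assms(1) CkB_minus[OF assms(2)]] by simp

text \<open>Each order of differentiation replaces a product by two products, whence 2^k.\<close>

lemma CkB_mult:
  assumes "CkB k A f" "CkB k B g" shows "CkB k (2 ^ k * A * B) (\<lambda>x. f x * g x)"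
  using assms
proof (induction k arbitrary: f g)
  case 0
  then show ?case using CkB_bound_nonneg[of 0 A f]
    by (auto intro!: continuous_intros mult_mono simp: abs_mult)
next
  case (Suc k)
  have nonneg: "0 \<le> A" "0 \<le> B" using CkB_bound_nonneg Suc.prems by blast+
  show ?case
  proof (rule CkB_SucI)
    show "continuous_on UNIV (\<lambda>x. f x * g x)" by (intro continuous_intros CkB_cont[OF Suc.prems(1)] CkB_cont[OF Suc.prems(2)])
    show "\<bar>f x * g x\<bar> \<le> 2 ^ Suc k * A * B" for x
    proof -
      have "\<bar>f x * g x\<bar> \<le> 1 * (A * B)" unfolding abs_mult
        using CkB_bound[OF Suc.prems(1), of x] CkB_bound[OF Suc.prems(2), of x] nonneg
        by (simp add: mult_mono)
      also have "\<dots> \<le> 2 ^ Suc k * (A * B)"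
        using nonneg by (intro mult_right_mono) (auto simp: one_le_power simp del: power_Suc)
      finally show ?thesis by (simp add: mult.assoc)
    qed
    show "((\<lambda>s. f (x + s *\<^sub>R axis i 1) * g (x + s *\<^sub>R axis i 1)) has_real_derivative pd i f x * g x + f x * pd i g x) (at 0)" for i x
      using DERIV_mult[OF CkB_deriv[OF Suc.prems(1), of x i] CkB_deriv[OF Suc.prems(2), of x i]]
      by (simp add: algebra_simps)
    show "CkB k (2 ^ Suc k * A * B) (\<lambda>x. pd i f x * g x + f x * pd i g x)" for i
      using CkB_add[OF Suc.IH[OF CkB_pd[OF Suc.prems(1)] CkB_Suc_lower[OF Suc.prems(2)]]
          Suc.IH[OF CkB_Suc_lower[OF Suc.prems(1)] CkB_pd[OF Suc.prems(2)]]]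
      by (simp add: algebra_simps)
  qed
qed

section \<open>Uniform bounds for the chemical potential\<close>

text \<open>The partial of 1/(1+f) is minus the partial of f times two copies of 1/(1+f), all
  controlled one order lower, so the induction closes. The constant is quantified before f because f
  will be \<Phi> at all admissible times at once.\<close>

lemma CkB_inverse:
  assumes "\<delta> > 0"
  shows "\<exists>C. \<forall>f. CkB k A f \<longrightarrow> (\<forall>x. \<delta> \<le> 1 + f x) \<longrightarrow> CkB k C (\<lambda>x. inverse (1 + f x))"
proof (induction k)
  case 0
  have inv: "\<bar>inverse (1 + y)\<bar> \<le> 1 / \<delta>" "1 + y \<noteq> 0" if "\<delta> \<le> 1 + y" for y :: real
    using that assms le_imp_inverse_le[of \<delta> "1 + y"] by (simp_all add: inverse_eq_divide)
  show ?case
  proof (intro exI[of _ "1 / \<delta>"] allI impI)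
    fix f assume f: "CkB 0 A f" "\<forall>x. \<delta> \<le> 1 + f x"
    have "continuous_on UNIV (\<lambda>x. inverse (1 + f x))"
      using inv(2) f by (intro continuous_intros) auto
    then show "CkB 0 (1 / \<delta>) (\<lambda>x. inverse (1 + f x))"
      unfolding CkB.simps using inv(1) f(2) by blast
  qed
next
  case (Suc k)
  obtain C where C: "\<And>f. CkB k A f \<Longrightarrow> (\<forall>x. \<delta> \<le> 1 + f x) \<Longrightarrow> CkB k C (\<lambda>x. inverse (1 + f x))"
    using Suc by blast
  define D where "D = max (1 / \<delta>) (2 ^ k * (2 ^ k * A * C) * C)"
  show ?case
  proof (intro exI[of _ D] allI impI)
    fix f assume f: "CkB (Suc k) A f" "\<forall>x. \<delta> \<le> 1 + f x"
    let ?g = "\<lambda>x. inverse (1 + f x)"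
    have g: "CkB k C ?g" using C[OF CkB_Suc_lower[OF f(1)] f(2)] .
    have pos: "0 < 1 + f x" for x using f(2) assms by (meson less_le_trans)
    show "CkB (Suc k) D ?g"
    proof (rule CkB_SucI)
      show "continuous_on UNIV ?g" by (rule CkB_cont[OF g])
      show "\<bar>inverse (1 + f x)\<bar> \<le> D" for x
      proof -
        have "\<bar>inverse (1 + f x)\<bar> \<le> 1 / \<delta>"
          using f(2) assms pos[of x] le_imp_inverse_le[of \<delta> "1 + f x"] by (simp add: inverse_eq_divide)
        then show ?thesis by (simp add: D_def)
      qed
      show "((\<lambda>s. inverse (1 + f (x + s *\<^sub>R axis i 1))) has_real_derivative - pd i f x * ?g x * ?g x) (at 0)" for i x
        using pos[of x] by (auto intro!: derivative_eq_intros CkB_deriv[OF f(1)] simp: power2_eq_square field_simps)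
      show "CkB k D (\<lambda>x. - pd i f x * ?g x * ?g x)" for i
        using CkB_mult[OF CkB_mult[OF CkB_minus[OF CkB_pd[OF f(1), of i]] g] g]
        by (rule CkB_mono) (simp add: D_def)
    qed
  qed
qed

text \<open>Order zero is bounded by ln \<delta> from below and ln(1+y) \<le> y from above; from the
  first derivative on, the logarithm is replaced by the reciprocal. Since only j = k - 1 orders of
  the reciprocal are required, k is split rather than inducted on.\<close>

lemma CkB_ln:
  assumes "\<delta> > 0"
  shows "\<exists>C. \<forall>f. CkB k A f \<longrightarrow> (\<forall>x. \<delta> \<le> 1 + f x) \<longrightarrow> CkB k C (\<lambda>x. ln (1 + f x))"
proof -
  have bound: "\<bar>ln (1 + y)\<bar> \<le> \<bar>ln \<delta>\<bar> + A" if "\<delta> \<le> 1 + y" "\<bar>y\<bar> \<le> A" for y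
  proof -
    have "ln \<delta> \<le> ln (1 + y)" using that assms by simp
    moreover have "ln (1 + y) \<le> y" using ln_le_minus_one[of "1 + y"] that assms by simp
    ultimately show ?thesis using that by linarith
  qed
  show ?thesis
  proof (cases k)
    case 0
    show ?thesis unfolding 0
    proof (intro exI[of _ "\<bar>ln \<delta>\<bar> + A"] allI impI)
      fix f assume f: "CkB 0 A f" "\<forall>x. \<delta> \<le> 1 + f x"
      have "1 + f x \<noteq> 0" for x using f(2) assms by (metis not_less)
      then show "CkB 0 (\<bar>ln \<delta>\<bar> + A) (\<lambda>x. ln (1 + f x))"
        using f bound by (auto intro!: continuous_intros)
    qed
  next
    case (Suc j)
    obtain C where C: "\<And>f. CkB j A f \<Longrightarrow> (\<forall>x. \<delta> \<le> 1 + f x) \<Longrightarrow> CkB j C (\<lambda>x. inverse (1 + f x))"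
      using CkB_inverse[OF assms] by blast
    define D where "D = max (\<bar>ln \<delta>\<bar> + A) (2 ^ j * A * C)"
    show ?thesis unfolding Suc
    proof (intro exI[of _ D] allI impI)
      fix f assume f: "CkB (Suc j) A f" "\<forall>x. \<delta> \<le> 1 + f x"
      have pos: "0 < 1 + f x" for x using f(2) assms by (meson less_le_trans)
      show "CkB (Suc j) D (\<lambda>x. ln (1 + f x))"
      proof (rule CkB_SucI)
        show "continuous_on UNIV (\<lambda>x. ln (1 + f x))"
          using pos by (intro continuous_intros CkB_cont[OF f(1)]) (metis less_irrefl)
        show "\<bar>ln (1 + f x)\<bar> \<le> D" for x
          using bound[of "f x"] f CkB_bound[OF f(1), of x] by (simp add: D_def)
        show "((\<lambda>s. ln (1 + f (x + s *\<^sub>R axis i 1))) has_real_derivative pd i f x * inverse (1 + f x)) (at 0)" for i x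
          using pos[of x] by (auto intro!: derivative_eq_intros CkB_deriv[OF f(1)] simp: field_simps)
        show "CkB j D (\<lambda>x. pd i f x * inverse (1 + f x))" for i
          using CkB_mult[OF CkB_pd[OF f(1), of i] C[OF CkB_Suc_lower[OF f(1)] f(2)]]
          by (rule CkB_mono) (simp add: D_def)
      qed
    qed
  qed
qed

lemma CkB_lapl:
  assumes "CkB (Suc (Suc k)) B f" shows "CkB k (3 * B) (lapl f)"
proof -
  have "CkB k B (pd i (pd i f))" for i using assms by (intro CkB_pd)
  then have "CkB k (B + B + B) (\<lambda>x. pd 1 (pd 1 f) x + pd 2 (pd 2 f) x + pd 3 (pd 3 f) x)"
    by (intro CkB_add)
  moreover have "lapl f = (\<lambda>x. pd 1 (pd 1 f) x + pd 2 (pd 2 f) x + pd 3 (pd 3 f) x)"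
    by (simp add: lapl_def sum_3)
  ultimately show ?thesis by simp
qed

lemma CkB_CH_mu:
  assumes "\<delta> > 0"
  shows "\<exists>C. \<forall>f. CkB 6 A f \<longrightarrow> (\<forall>x. \<bar>f x\<bar> \<le> 1 - \<delta>) \<longrightarrow> CkB 4 C (CH_mu eps theta0 f)"
proof -
  obtain C where C: "\<And>f. CkB 4 A f \<Longrightarrow> (\<forall>x. \<delta> \<le> 1 + f x) \<Longrightarrow> CkB 4 C (\<lambda>x. ln (1 + f x))"
    using CkB_ln[OF assms] by blast
  show ?thesis
  proof (intro exI[of _ "C + C + \<bar>theta0\<bar> * A + \<bar>eps\<^sup>2\<bar> * (3 * A)"] allI impI)
    fix f assume f: "CkB 6 A f" "\<forall>x. \<bar>f x\<bar> \<le> 1 - \<delta>"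
    have f4: "CkB 4 A f" using CkB_lower[OF f(1), of 4] by simp
    have d: "\<delta> \<le> 1 + f x" "\<delta> \<le> 1 + - f x" for x using f(2)[rule_format, of x] by linarith+
    have "CkB 4 C (\<lambda>x. ln (1 + f x))" "CkB 4 C (\<lambda>x. ln (1 + - f x))"
      using C[OF f4] C[OF CkB_minus[OF f4]] d by auto
    moreover have "CkB 4 (3 * A) (lapl f)" using CkB_lapl[of 4 A f] f(1) by simp
    ultimately show "CkB 4 (C + C + \<bar>theta0\<bar> * A + \<bar>eps\<^sup>2\<bar> * (3 * A)) (CH_mu eps theta0 f)"
      unfolding CH_mu_def using f4 by (intro CkB_diff CkB_cmult) auto
  qed
qed

section \<open>From the norm of periodic functions to explicit bounds\<close>

text \<open>\<open>foldr\<close> applies the last list entry first; a bound for the partial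
  \<open>pd i f\<close> is therefore read off from lists with i appended at the end.\<close>

lemma CkB_I:
  assumes "Ck k f" "\<And>ds x. length ds \<le> k \<Longrightarrow> \<bar>dpd ds f x\<bar> \<le> B"
  shows "CkB k B f"
  using assms
proof (induction k arbitrary: f)
  case 0
  then show ?case using "0.prems"(2)[of "[]"] by (simp add: dpd_def)
next
  case (Suc k)
  have "\<bar>f x\<bar> \<le> B" for x using Suc.prems(2)[of "[]"] by (simp add: dpd_def)
  moreover have "CkB k B (pd i f)" for i
  proof (rule Suc.IH)
    show "Ck k (pd i f)" using Suc.prems(1) by simp
    show "\<bar>dpd ds (pd i f) x\<bar> \<le> B" if "length ds \<le> k" for ds x
      using Suc.prems(2)[of "ds @ [i]" x] that by (simp add: dpd_def)
  qed
  ultimately show ?case using Suc.prems(1) by simp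
qed

lemma periodic3_pd: "periodic3 L f \<Longrightarrow> periodic3 L (pd i f)"
  unfolding periodic3_def pd_def
proof (intro allI)
  fix j x assume p: "\<forall>i x. f (x + L *\<^sub>R axis i 1) = f x"
  have "f (x + L *\<^sub>R axis j 1 + s *\<^sub>R axis i 1) = f (x + s *\<^sub>R axis i 1)" for s
    using p[rule_format, of "x + s *\<^sub>R axis i 1" j] by (simp add: algebra_simps)
  then show "deriv (\<lambda>s. f (x + L *\<^sub>R axis j 1 + s *\<^sub>R axis i 1)) 0 = deriv (\<lambda>s. f (x + s *\<^sub>R axis i 1)) 0" by simp
qed

lemma periodic3_dpd: "periodic3 L f \<Longrightarrow> periodic3 L (dpd ds f)"
  by (induction ds) (auto simp: dpd_def periodic3_pd)

lemma Ck_dpd_cont: "Ck k f \<Longrightarrow> length ds \<le> k \<Longrightarrow> continuous_on UNIV (dpd ds f)"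
proof (induction k arbitrary: f ds)
  case 0
  then show ?case by (simp add: dpd_def)
next
  case (Suc k)
  show ?case
  proof (cases ds rule: rev_cases)
    case Nil
    then show ?thesis using Suc.prems by (simp add: dpd_def)
  next
    case (snoc ds' i)
    then show ?thesis using Suc.IH[of "pd i f" ds'] Suc.prems by (simp add: dpd_def)
  qed
qed

lemma periodic3_cell:
  assumes "periodic3 L f" "L > 0"
  shows "\<exists>y\<in>cbox 0 (\<chi> _. L). f y = f x"
proof -
  have p: "f (x + (of_int n * L) *\<^sub>R axis i 1) = f x" for n i x
  proof (induction n rule: int_induct[where k=0])
    case (step1 m)
    then show ?case using assms(1)[unfolded periodic3_def, rule_format, of "x + (of_int m * L) *\<^sub>R axis i 1" i]
      by (simp add: algebra_simps)
  next
    case (step2 m)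
    then show ?case using assms(1)[unfolded periodic3_def, rule_format, of "x + (of_int (m - 1) * L) *\<^sub>R axis i 1" i]
      by (simp add: algebra_simps)
  qed simp
  define n where "n = (\<lambda>i. - \<lfloor>x $ i / L\<rfloor>)"
  define y where "y = x + (of_int (n 1) * L) *\<^sub>R axis 1 1 + (of_int (n 2) * L) *\<^sub>R axis 2 1 + (of_int (n 3) * L) *\<^sub>R axis 3 1"
  have "f y = f x" unfolding y_def by (simp only: p)
  moreover have "y $ i = x $ i + of_int (n i) * L" for i
    using exhaust_3[of i] by (auto simp: y_def axis_def)
  moreover have "0 \<le> x $ i + of_int (n i) * L \<and> x $ i + of_int (n i) * L \<le> L" for i
  proof -
    have "of_int \<lfloor>x $ i / L\<rfloor> \<le> x $ i / L" "x $ i / L \<le> of_int \<lfloor>x $ i / L\<rfloor> + 1" by linarith+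
    then have "of_int \<lfloor>x $ i / L\<rfloor> * L \<le> x $ i" "x $ i \<le> (of_int \<lfloor>x $ i / L\<rfloor> + 1) * L"
      using assms(2) by (simp_all only: pos_le_divide_eq pos_divide_le_eq)
    then show ?thesis by (simp add: n_def algebra_simps)
  qed
  ultimately show ?thesis by (intro bexI[of _ y]) (auto simp: mem_box_cart)
qed

lemma periodic3_bounded:
  assumes "periodic3 L f" "L > 0" "continuous_on UNIV f"
  shows "bdd_above (range (\<lambda>x. \<bar>f x\<bar>))"
proof -
  have "compact ((\<lambda>x. \<bar>f x\<bar>) ` cbox 0 (\<chi> _. L))"
    using assms(3) by (intro compact_continuous_image compact_cbox continuous_intros) (auto intro: continuous_on_subset)
  then have "bdd_above ((\<lambda>x. \<bar>f x\<bar>) ` cbox 0 (\<chi> _. L))"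
    by (intro bounded_imp_bdd_above compact_imp_bounded)
  then obtain B where "\<And>y. y \<in> cbox 0 (\<chi> _. L) \<Longrightarrow> \<bar>f y\<bar> \<le> B"
    by (auto simp: bdd_above_def)
  then have "\<bar>f x\<bar> \<le> B" for x using periodic3_cell[OF assms(1,2), of x] by metis
  then show ?thesis by (auto simp: bdd_above_def)
qed

text \<open>A real supremum dominates its members only for bounded sets. The inner one is bounded by
  compactness of a period cell, the outer one because there are finitely many lists of directions of
  length at most k.\<close>

lemma Ck_norm_bound:
  assumes "Cper k L f" "L > 0" "length ds \<le> k"
  shows "\<bar>dpd ds f x\<bar> \<le> Ck_norm k f"
proof -
  have "bdd_above (range (\<lambda>x. \<bar>dpd ds f x\<bar>))"
    using assms by (intro periodic3_bounded[of L] periodic3_dpd Ck_dpd_cont[of k]) (auto simp: Cper_def)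
  then have "\<bar>dpd ds f x\<bar> \<le> (SUP x. \<bar>dpd ds f x\<bar>)" by (intro cSUP_upper) auto
  also have "\<dots> \<le> Ck_norm k f"
    unfolding Ck_norm_def
  proof (rule cSUP_upper)
    have "finite {ds :: 3 list. length ds \<le> k}"
      using finite_lists_length_le[of "UNIV :: 3 set" k] by simp
    then show "bdd_above ((\<lambda>ds. SUP x. \<bar>dpd ds f x\<bar>) ` {ds. length ds \<le> k})" by (intro bdd_above_finite) simp
  qed (use assms in simp)
  finally show ?thesis .
qed

lemma Cper_CkB:
  assumes "Cper k L f" "L > 0" "Ck_norm k f \<le> B"
  shows "CkB k B f"
  using assms Ck_norm_bound[OF assms(1,2)] by (intro CkB_I) (auto simp: Cper_def intro: order.trans)

section \<open>Taylor expansion and the seven-point Laplacian\<close>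

lemma CkB_pd_funpow: "CkB (n + k) B f \<Longrightarrow> CkB k B ((pd i ^^ n) f)"
proof (induction n arbitrary: k)
  case (Suc n)
  then have "CkB (Suc k) B ((pd i ^^ n) f)" by (simp del: CkB.simps)
  then show ?case using CkB_pd by simp
qed simp

lemma CkB_taylor:
  assumes "CkB (Suc n) B f" "h > 0"
  shows "\<bar>f (x + h *\<^sub>R axis i 1) - (\<Sum>m\<le>n. (pd i ^^ m) f x / fact m * h ^ m)\<bar> \<le> B / fact (Suc n) * h ^ Suc n"
    and "\<bar>f (x - h *\<^sub>R axis i 1) - (\<Sum>m\<le>n. (pd i ^^ m) f x / fact m * (- h) ^ m)\<bar> \<le> B / fact (Suc n) * h ^ Suc n"
proof -
  define d where "d = (\<lambda>m s. (pd i ^^ m) f (x + s *\<^sub>R axis i 1))"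
  have der: "DERIV (d m) s :> d (Suc m) s" if "m < Suc n" for m s
  proof -
    have "CkB (Suc (n - m)) B ((pd i ^^ m) f)" using CkB_pd_funpow[of m "Suc n - m" B f] assms(1) that by (simp add: Suc_diff_le)
    from CkB_deriv_line[OF this] show ?thesis by (simp add: d_def)
  qed
  have bnd: "\<bar>d (Suc n) s\<bar> \<le> B" for s
    using CkB_bound[OF CkB_pd_funpow[of "Suc n" 0 B f i]] assms(1) by (simp add: d_def del: CkB.simps)
  have fin: "\<bar>d (Suc n) t / fact (Suc n) * r ^ Suc n\<bar> \<le> B / fact (Suc n) * h ^ Suc n" if "\<bar>r\<bar> = h" for t r
    unfolding abs_mult abs_divide power_abs[symmetric] that
    using bnd[of t] assms(2) by (simp add: divide_right_mono mult_right_mono power_abs that del: power_Suc fact_Suc)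
  obtain t where "d 0 h = (\<Sum>m<Suc n. d m 0 / fact m * h ^ m) + d (Suc n) t / fact (Suc n) * h ^ Suc n"
    using Maclaurin[of h "Suc n" d "d 0"] assms(2) der by auto
  then show "\<bar>f (x + h *\<^sub>R axis i 1) - (\<Sum>m\<le>n. (pd i ^^ m) f x / fact m * h ^ m)\<bar> \<le> B / fact (Suc n) * h ^ Suc n"
    using fin[of h t] assms(2) by (simp add: d_def lessThan_Suc_atMost del: sum.lessThan_Suc power_Suc fact_Suc)
  obtain t where "d 0 (- h) = (\<Sum>m<Suc n. d m 0 / fact m * (- h) ^ m) + d (Suc n) t / fact (Suc n) * (- h) ^ Suc n"
    using Maclaurin_minus[of "- h" "Suc n" d "d 0"] assms(2) der by auto
  then show "\<bar>f (x - h *\<^sub>R axis i 1) - (\<Sum>m\<le>n. (pd i ^^ m) f x / fact m * (- h) ^ m)\<bar> \<le> B / fact (Suc n) * h ^ Suc n"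
    using fin[of "-h" t] assms(2) by (simp add: d_def lessThan_Suc_atMost del: sum.lessThan_Suc power_Suc fact_Suc)
qed

lemma CkB_second_difference_bound:
  assumes "CkB 2 B f" "h > 0"
  shows "\<bar>f (x + h *\<^sub>R axis i 1) + f (x - h *\<^sub>R axis i 1) - 2 * f x\<bar> \<le> B * h\<^sup>2"
proof -
  have "\<bar>f (x + h *\<^sub>R axis i 1) - (f x + pd i f x * h)\<bar> \<le> B / 2 * h\<^sup>2"
    "\<bar>f (x - h *\<^sub>R axis i 1) - (f x - pd i f x * h)\<bar> \<le> B / 2 * h\<^sup>2"
    using CkB_taylor[of 1 B f h x i] assms by (simp_all add: numeral_2_eq_2 del: CkB.simps)
  then show ?thesis by linarith
qed

text \<open>The odd powers cancel between the two expansions; each remainder B h^4 / 24 is rounded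
  up to B h^4 / 2.\<close>

lemma CkB_second_difference:
  assumes "CkB 4 B f" "h > 0"
  shows "\<bar>f (x + h *\<^sub>R axis i 1) + f (x - h *\<^sub>R axis i 1) - 2 * f x - h\<^sup>2 * pd i (pd i f) x\<bar> \<le> B * h ^ 4"
proof -
  have "(\<Sum>m\<le>3. (pd i ^^ m) f x / fact m * h ^ m) + (\<Sum>m\<le>3. (pd i ^^ m) f x / fact m * (- h) ^ m)
     = 2 * f x + h\<^sup>2 * pd i (pd i f) x"
    by (simp add: eval_nat_numeral)
  moreover have "B / fact 4 * h ^ 4 \<le> B / 2 * h ^ 4"
    using CkB_bound_nonneg[OF assms(1)] by (intro mult_right_mono divide_left_mono) (auto simp: fact_numeral)
  moreover have "\<bar>f (x + h *\<^sub>R axis i 1) - (\<Sum>m\<le>3. (pd i ^^ m) f x / fact m * h ^ m)\<bar> \<le> B / fact 4 * h ^ 4"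
    "\<bar>f (x - h *\<^sub>R axis i 1) - (\<Sum>m\<le>3. (pd i ^^ m) f x / fact m * (- h) ^ m)\<bar> \<le> B / fact 4 * h ^ 4"
    using CkB_taylor[of 3 B f h x i] assms by simp_all
  ultimately show ?thesis by linarith
qed

abbreviation cell_center :: "real \<Rightarrow> int \<Rightarrow> int \<Rightarrow> int \<Rightarrow> real^3" where
  "cell_center h i j k \<equiv> vector [(of_int i - 1/2) * h, (of_int j - 1/2) * h, (of_int k - 1/2) * h]"

lemma cell_center_shift:
  "cell_center h (i + 1) j k = cell_center h i j k + h *\<^sub>R axis 1 1"
  "cell_center h (i - 1) j k = cell_center h i j k - h *\<^sub>R axis 1 1"
  "cell_center h i (j + 1) k = cell_center h i j k + h *\<^sub>R axis 2 1"
  "cell_center h i (j - 1) k = cell_center h i j k - h *\<^sub>R axis 2 1"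
  "cell_center h i j (k + 1) = cell_center h i j k + h *\<^sub>R axis 3 1"
  "cell_center h i j (k - 1) = cell_center h i j k - h *\<^sub>R axis 3 1"
  by (auto simp: vec_eq_iff forall_3 axis_def algebra_simps)

lemma glap_grid_eval:
  "glap h (grid_eval h N f) i j k = (let x = cell_center h i j k in
     \<Sum>d\<in>UNIV. (f (x + h *\<^sub>R axis d 1) + f (x - h *\<^sub>R axis d 1) - 2 * f x) / h\<^sup>2)"
  unfolding glap_def grid_eval_def cell_center_shift Let_def sum_3
  by (simp add: add_divide_distrib[symmetric])

lemma glap_grid_eval_bound:
  assumes "CkB 2 B f" "h > 0"
  shows "\<bar>glap h (grid_eval h N f) i j k\<bar> \<le> 3 * B"
proof -
  define x where "x = cell_center h i j k"
  have "\<bar>(f (x + h *\<^sub>R axis d 1) + f (x - h *\<^sub>R axis d 1) - 2 * f x) / h\<^sup>2\<bar> \<le> B" for d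
    using CkB_second_difference_bound[OF assms, of x d] assms(2) by (simp add: abs_divide divide_le_eq)
  then have "\<bar>\<Sum>d\<in>UNIV. (f (x + h *\<^sub>R axis d 1) + f (x - h *\<^sub>R axis d 1) - 2 * f x) / h\<^sup>2\<bar> \<le> (\<Sum>d\<in>(UNIV :: 3 set). B)"
    by (intro order.trans[OF sum_abs] sum_mono)
  then show ?thesis unfolding glap_grid_eval Let_def x_def by simp
qed

lemma glap_grid_eval_consistent:
  assumes "CkB 4 B f" "h > 0"
  shows "\<bar>glap h (grid_eval h N f) i j k - grid_eval h N (lapl f) i j k\<bar> \<le> 3 * B * h\<^sup>2"
proof -
  define x where "x = cell_center h i j k"
  define a where "a = (\<lambda>d. (f (x + h *\<^sub>R axis d 1) + f (x - h *\<^sub>R axis d 1) - 2 * f x) / h\<^sup>2 - pd d (pd d f) x)"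
  have "\<bar>a d\<bar> \<le> B * h\<^sup>2" for d
  proof -
    have "a d = (f (x + h *\<^sub>R axis d 1) + f (x - h *\<^sub>R axis d 1) - 2 * f x - h\<^sup>2 * pd d (pd d f) x) / h\<^sup>2"
      using assms(2) by (simp add: a_def diff_divide_distrib)
    then have "\<bar>a d\<bar> \<le> B * h ^ 4 / h\<^sup>2"
      using CkB_second_difference[OF assms, of x d] by (simp add: abs_divide divide_right_mono)
    then show ?thesis using assms(2) by (simp add: power_numeral_reduce field_simps)
  qed
  then have "\<bar>\<Sum>d\<in>UNIV. a d\<bar> \<le> (\<Sum>d\<in>(UNIV :: 3 set). B * h\<^sup>2)"
    by (intro order.trans[OF sum_abs] sum_mono)
  moreover have "glap h (grid_eval h N f) i j k - grid_eval h N (lapl f) i j k = (\<Sum>d\<in>UNIV. a d)"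
    unfolding glap_grid_eval Let_def a_def sum_subtractf by (simp add: grid_eval_def lapl_def x_def)
  ultimately show ?thesis by simp
qed

section \<open>Fourier series in one variable\<close>

definition fexp :: "real \<Rightarrow> int \<Rightarrow> real \<Rightarrow> complex" where
  "fexp L k s = cis (2 * pi / L * of_int k * s)"

text \<open>Complex-valued arguments are allowed because the coefficient in one variable is a
  complex function of the others, to be expanded again.\<close>

definition fcoeff :: "real \<Rightarrow> (real \<Rightarrow> complex) \<Rightarrow> int \<Rightarrow> complex" where
  "fcoeff L u k = integral {0..L} (\<lambda>s. u s * fexp L (-k) s) / of_real L"

definition fsum :: "nat \<Rightarrow> real \<Rightarrow> (real \<Rightarrow> complex) \<Rightarrow> real \<Rightarrow> complex" where
  "fsum K L u x = (\<Sum>k\<in>{-int K..int K}. fcoeff L u k * fexp L k x)"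

lemma norm_fexp [simp]: "norm (fexp L k s) = 1"
  by (simp add: fexp_def)

lemma fexp_add: "fexp L (j + k) s = fexp L j s * fexp L k s"
  by (simp add: fexp_def cis_mult algebra_simps add_divide_distrib)

lemma fexp_add_right: "fexp L k (s + t) = fexp L k s * fexp L k t"
  by (simp add: fexp_def cis_mult algebra_simps add_divide_distrib)

lemma fexp_0 [simp]: "fexp L 0 s = 1" "fexp L k 0 = 1"
  by (simp_all add: fexp_def)

lemma fexp_uminus: "fexp L (-k) s = cnj (fexp L k s)"
  by (simp add: fexp_def cis_cnj)

lemma fexp_period:
  assumes "L \<noteq> 0" shows "fexp L k L = 1"
proof -
  have "2 * pi / L * of_int k * L = 2 * pi * of_int k" using assms by simp
  then show ?thesis by (simp add: fexp_def cis_multiple_2pi)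
qed

lemma fexp_has_vector_derivative:
  "(fexp L k has_vector_derivative (\<i> * of_real (2 * pi / L * of_int k) * fexp L k s)) (at s within S)"
proof -
  have "((\<lambda>s. exp (c * of_real s)) has_vector_derivative (c * exp (c * of_real s))) (at s within S)" for c :: complex
    by (rule has_vector_derivative_real_field) (auto intro!: derivative_eq_intros)
  note this[of "\<i> * of_real (2 * pi / L * of_int k)"]
  moreover have "fexp L k = (\<lambda>s. exp (\<i> * of_real (2 * pi / L * of_int k) * of_real s))"
    by (auto simp: fexp_def cis_conv_exp mult.assoc)
  ultimately show ?thesis by simp
qed

lemma continuous_on_fexp [continuous_intros]: "continuous_on S (fexp L k)"
  by (rule continuous_on_vector_derivative[OF fexp_has_vector_derivative])

lemma integral_fexp:
  assumes "L > 0"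
  shows "integral {0..L} (fexp L k) = (if k = 0 then of_real L else 0)"
proof (cases "k = 0")
  case True
  have "fexp L k = (\<lambda>s. 1)" using True by (intro ext) simp
  then show ?thesis using assms True by (simp add: scaleR_conv_of_real)
next
  case False
  define c where "c = \<i> * of_real (2 * pi / L * of_int k)"
  have c: "c \<noteq> 0" using False assms by (simp add: c_def)
  have "((\<lambda>s. c * fexp L k s) has_integral (fexp L k L - fexp L k 0)) {0..L}"
    using assms fexp_has_vector_derivative[of L k] unfolding c_def
    by (intro fundamental_theorem_of_calculus) auto
  then have "((\<lambda>s. c * fexp L k s) has_integral 0) {0..L}"
    using assms by (simp add: fexp_period)
  then have "integral {0..L} (\<lambda>s. c * fexp L k s) = 0" by (rule integral_unique)
  then show ?thesis using c False by simp
qed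

lemma norm_fcoeff_le:
  assumes "L > 0" "continuous_on {0..L} u" "\<And>s. s \<in> {0..L} \<Longrightarrow> norm (u s) \<le> B"
  shows "norm (fcoeff L u k) \<le> B"
proof -
  have "norm (integral {0..L} (\<lambda>s. u s * fexp L (-k) s)) \<le> B * (L - 0)"
    using assms by (intro integral_bound continuous_intros) (auto simp: norm_mult)
  then show ?thesis using assms(1) by (simp add: fcoeff_def norm_divide field_simps)
qed

lemma fcoeff_diff:
  assumes "continuous_on {0..L} u" "continuous_on {0..L} v"
  shows "fcoeff L (\<lambda>s. u s - v s) k = fcoeff L u k - fcoeff L v k"
  unfolding fcoeff_def left_diff_distrib
  by (subst integral_diff) (auto intro!: integrable_continuous_real continuous_intros assms simp: diff_divide_distrib)

lemma fsum_diff: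
  assumes "continuous_on {0..L} u" "continuous_on {0..L} v"
  shows "fsum K L (\<lambda>s. u s - v s) x = fsum K L u x - fsum K L v x"
  unfolding fsum_def by (simp add: fcoeff_diff[OF assms] left_diff_distrib sum_subtractf)

lemma norm_fsum_le:
  assumes "L > 0" "continuous_on {0..L} u" "\<And>s. s \<in> {0..L} \<Longrightarrow> norm (u s) \<le> B"
  shows "norm (fsum K L u x) \<le> real (2 * K + 1) * B"
proof -
  have "norm (fsum K L u x) \<le> (\<Sum>k\<in>{-int K..int K}. B)"
    unfolding fsum_def using norm_fcoeff_le[OF assms]
    by (intro order.trans[OF norm_sum] sum_mono) (simp add: norm_mult)
  then show ?thesis by (simp add: algebra_simps)
qed

section \<open>Bessel inequality and pointwise convergence\<close>

lemma bessel_inequality: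
  assumes "L > 0" "continuous_on {0..L} g" "finite A"
  shows "(\<Sum>k\<in>A. (norm (fcoeff L g k))\<^sup>2) \<le> integral {0..L} (\<lambda>s. (norm (g s))\<^sup>2) / L"
proof -
  define c where "c = fcoeff L g"
  define p where "p = (\<lambda>s. \<Sum>k\<in>A. c k * fexp L k s)"
  define S where "S = (\<Sum>k\<in>A. (norm (c k))\<^sup>2)"
  have cont_p: "continuous_on {0..L} p" unfolding p_def by (intro continuous_intros)
  note ci = integrable_continuous_real continuous_intros assms(2) cont_p
  have int_g: "integral {0..L} (\<lambda>s. g s * cnj (fexp L k s)) = of_real L * c k" for k
    using assms(1) unfolding c_def fcoeff_def fexp_uminus by simp
  have int_p: "integral {0..L} (\<lambda>s. p s * cnj (fexp L k s)) = of_real L * c k" if "k \<in> A" for k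
  proof -
    have "p s * cnj (fexp L k s) = (\<Sum>j\<in>A. c j * fexp L (j - k) s)" for s
      using fexp_add[of L _ "-k" s] by (simp add: p_def sum_distrib_right fexp_uminus mult.assoc)
    then have "integral {0..L} (\<lambda>s. p s * cnj (fexp L k s)) = (\<Sum>j\<in>A. c j * integral {0..L} (fexp L (j - k)))"
      using assms(3) by (simp add: integral_sum integrable_continuous_real continuous_intros)
    also have "\<dots> = (\<Sum>j\<in>A. if j = k then c j * of_real L else 0)"
      using assms(1) by (intro sum.cong) (auto simp: integral_fexp)
    finally show ?thesis using that assms(3) by (simp add: mult.commute)
  qed
  \<comment> \<open>The pairing with p depends on f only through its coefficients on A, which g and
    p share; one computation therefore gives both the mixed and the diagonal term of the expanded
    square.\<close>
  have gp: "integral {0..L} (\<lambda>s. f s * cnj (p s)) = of_real L * of_real S"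
    if f: "continuous_on {0..L} f" "\<And>k. k \<in> A \<Longrightarrow> integral {0..L} (\<lambda>s. f s * cnj (fexp L k s)) = of_real L * c k" for f
  proof -
    have "f s * cnj (p s) = (\<Sum>k\<in>A. cnj (c k) * (f s * cnj (fexp L k s)))" for s
      by (simp add: p_def sum_distrib_left algebra_simps)
    then have "integral {0..L} (\<lambda>s. f s * cnj (p s)) =
       (\<Sum>k\<in>A. cnj (c k) * integral {0..L} (\<lambda>s. f s * cnj (fexp L k s)))"
      using assms(3) by (simp add: integral_sum integrable_continuous_real continuous_intros f(1))
    also have "\<dots> = (\<Sum>k\<in>A. of_real L * of_real ((norm (c k))\<^sup>2))"
      using f(2) by (intro sum.cong) (auto simp: complex_norm_square simp del: of_real_power)
    finally show ?thesis by (simp add: S_def sum_distrib_left)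
  qed
  have key: "complex_of_real ((norm (g s - p s))\<^sup>2) = of_real ((norm (g s))\<^sup>2) - g s * cnj (p s)
      - cnj (g s * cnj (p s)) + p s * cnj (p s)" for s
    unfolding complex_norm_square by (simp add: algebra_simps)
  have "complex_of_real (integral {0..L} (\<lambda>s. (norm (g s - p s))\<^sup>2)) =
      integral {0..L} (\<lambda>s. complex_of_real ((norm (g s - p s))\<^sup>2))"
    by (subst integral_linear[OF _ bounded_linear_of_real, symmetric, unfolded o_def]) (auto intro!: ci)
  also have "\<dots> = integral {0..L} (\<lambda>s. complex_of_real ((norm (g s))\<^sup>2)) - integral {0..L} (\<lambda>s. g s * cnj (p s))
      - integral {0..L} (\<lambda>s. cnj (g s * cnj (p s))) + integral {0..L} (\<lambda>s. p s * cnj (p s))"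
    unfolding key
    by (subst integral_add integral_diff; (intro ci)?)+ simp
  also have "integral {0..L} (\<lambda>s. cnj (g s * cnj (p s))) = cnj (integral {0..L} (\<lambda>s. g s * cnj (p s)))"
    by (subst integral_linear[OF _ bounded_linear_cnj, symmetric, unfolded o_def]) (auto intro!: ci)
  also have "integral {0..L} (\<lambda>s. complex_of_real ((norm (g s))\<^sup>2)) = of_real (integral {0..L} (\<lambda>s. (norm (g s))\<^sup>2))"
    by (subst integral_linear[OF _ bounded_linear_of_real, symmetric, unfolded o_def]) (auto intro!: ci)
  also have "integral {0..L} (\<lambda>s. g s * cnj (p s)) = of_real L * of_real S"
    using gp[OF assms(2)] int_g by simp
  also have "integral {0..L} (\<lambda>s. p s * cnj (p s)) = of_real L * of_real S"
    using gp[OF cont_p] int_p by simp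
  finally have "complex_of_real (integral {0..L} (\<lambda>s. (norm (g s - p s))\<^sup>2)) =
     of_real (integral {0..L} (\<lambda>s. (norm (g s))\<^sup>2) - L * S)" by simp
  then have "integral {0..L} (\<lambda>s. (norm (g s - p s))\<^sup>2) = integral {0..L} (\<lambda>s. (norm (g s))\<^sup>2) - L * S"
    by (simp only: of_real_eq_iff)
  moreover have "0 \<le> integral {0..L} (\<lambda>s. (norm (g s - p s))\<^sup>2)"
    by (intro integral_nonneg ci) auto
  ultimately show ?thesis using assms(1) by (simp add: S_def c_def field_simps)
qed

text \<open>Along an injective enumeration of frequencies, Bessel bounds every partial sum of
  squared coefficients, so the coefficients tend to zero. It is applied to the two ends K and -K - 1
  of the telescoped sum in \<open>fsum_tendsto\<close>.\<close>

lemma riemann_lebesgue_fcoeff: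
  assumes "L > 0" "continuous_on {0..L} g" "inj (\<sigma> :: nat \<Rightarrow> int)"
  shows "(\<lambda>n. fcoeff L g (\<sigma> n)) \<longlonglongrightarrow> 0"
proof -
  have "summable (\<lambda>n. (norm (fcoeff L g (\<sigma> n)))\<^sup>2)"
  proof (rule summableI_nonneg_bounded)
    fix n
    show "(\<Sum>i<n. (norm (fcoeff L g (\<sigma> i)))\<^sup>2) \<le> integral {0..L} (\<lambda>s. (norm (g s))\<^sup>2) / L"
      using bessel_inequality[OF assms(1,2), of "\<sigma> ` {..<n}"] assms(3)
      by (simp add: sum.reindex inj_on_subset)
  qed simp
  then have "(\<lambda>n. sqrt ((norm (fcoeff L g (\<sigma> n)))\<^sup>2)) \<longlonglongrightarrow> sqrt 0"
    by (intro tendsto_real_sqrt summable_LIMSEQ_zero)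
  then show ?thesis by (simp add: tendsto_norm_zero_iff)
qed

lemma periodic_int_multiple:
  fixes u :: "real \<Rightarrow> 'a"
  assumes "\<And>s. u (s + L) = u s"
  shows "u (s + of_int n * L) = u s"
proof (induction n rule: int_induct[where k=0])
  case (step1 m)
  then show ?case using assms[of "s + of_int m * L"] by (simp add: algebra_simps)
next
  case (step2 m)
  then show ?case using assms[of "s + of_int (m - 1) * L"] by (simp add: algebra_simps)
qed simp

text \<open>Chernoff's argument: dividing \<open>u s - u x\<close> by \<open>fexp L 1 (s - x) - 1\<close> leaves a continuous function \<open>g\<close>,
  and in terms of the coefficients of \<open>g\<close> the partial sums of the series of \<open>u\<close> at \<open>x\<close> telescope.\<close>
lemma fsum_tendsto:
  assumes L: "L > 0" and per: "\<And>s. u (s + L) = u s"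
    and der: "\<And>s. (u has_vector_derivative u' s) (at s)"
  shows "(\<lambda>K. fsum K L u x) \<longlonglongrightarrow> u x"
proof -
  define \<omega> where "\<omega> = \<i> * of_real (2 * pi / L)"
  have \<omega>: "\<omega> \<noteq> 0" using L by (simp add: \<omega>_def)
  define E where "E = (\<lambda>s. fexp L 1 (s - x))"
  \<comment> \<open>Where the denominator vanishes, periodicity makes the numerator vanish too;
    u'/\<omega> is the limit of the quotient there, since the derivative of E equals \<omega> at
    such points.\<close>
  define g where "g = (\<lambda>s. if E s = 1 then u' s / \<omega> else (u s - u x) / (E s - 1))"
  have E_der: "(E has_vector_derivative \<omega> * E s) (at s)" for s
  proof -
    have "((fexp L 1 \<circ> (\<lambda>s. s - x)) has_vector_derivative (1 *\<^sub>R (\<i> * of_real (2 * pi / L * of_int 1) * fexp L 1 (s - x)))) (at s)"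
      by (intro vector_diff_chain_at fexp_has_vector_derivative) (auto intro!: derivative_eq_intros)
    then show ?thesis by (simp add: E_def \<omega>_def o_def)
  qed
  have cont_u: "isCont u s" and cont_E: "isCont E s" for s
    using der E_der has_vector_derivative_continuous by blast+
  have u_eq: "u s = u x" if "E s = 1" for s
  proof -
    have "cos (2 * pi / L * (s - x)) = 1"
      using that by (auto simp: E_def fexp_def complex_eq_iff)
    then obtain n where "2 * pi / L * (s - x) = of_int n * 2 * pi"
      using cos_one_2pi_int by (auto simp: mult.assoc)
    then have "pi * (s - x) = pi * (of_int n * L)" using L by (simp add: field_simps)
    then have "s = x + of_int n * L" by simp
    then show ?thesis using periodic_int_multiple[of u, OF per] by simp
  qed
  have quot: "((\<lambda>s. (f s - f s0) / of_real (s - s0)) \<longlongrightarrow> f') (at s0)"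
    if "(f has_vector_derivative f') (at s0)" for f :: "real \<Rightarrow> complex" and f' s0
  proof -
    have "((\<lambda>s. (1 / norm (s - s0)) *\<^sub>R (f s - (f s0 + (s - s0) *\<^sub>R f'))) \<longlongrightarrow> 0) (at s0)"
      using that unfolding has_vector_derivative_def has_derivative_within by simp
    then have "((\<lambda>s. norm ((1 / norm (s - s0)) *\<^sub>R (f s - (f s0 + (s - s0) *\<^sub>R f')))) \<longlongrightarrow> 0) (at s0)"
      by (rule tendsto_norm_zero)
    moreover have "eventually (\<lambda>s. norm ((1 / norm (s - s0)) *\<^sub>R (f s - (f s0 + (s - s0) *\<^sub>R f'))) =
        norm ((f s - f s0) / of_real (s - s0) - f')) (at s0)"
      unfolding eventually_at_filter
    proof (intro always_eventually allI impI)
      fix s assume "s \<noteq> s0"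
      then have "(f s - f s0) / of_real (s - s0) - f' = (f s - (f s0 + (s - s0) *\<^sub>R f')) / of_real (s - s0)"
        by (simp add: scaleR_conv_of_real field_simps)
      then show "norm ((1 / norm (s - s0)) *\<^sub>R (f s - (f s0 + (s - s0) *\<^sub>R f'))) =
        norm ((f s - f s0) / of_real (s - s0) - f')"
        by (simp only: norm_divide norm_scaleR norm_of_real) simp
    qed
    ultimately have "((\<lambda>s. norm ((f s - f s0) / of_real (s - s0) - f')) \<longlongrightarrow> 0) (at s0)"
      by (rule Lim_transform_eventually)
    then show ?thesis using LIM_zero_cancel tendsto_norm_zero_iff by blast
  qed
  have cont_g: "isCont g s0" for s0
  proof (cases "E s0 = 1")
    case True
    have qE: "((\<lambda>s. (E s - 1) / of_real (s - s0)) \<longlongrightarrow> \<omega>) (at s0)"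
      using quot[OF E_der[of s0]] True by simp
    have qu: "((\<lambda>s. (u s - u x) / of_real (s - s0)) \<longlongrightarrow> u' s0) (at s0)"
      using quot[OF der[of s0]] u_eq[OF True] by simp
    have "eventually (\<lambda>s. (E s - 1) / of_real (s - s0) \<noteq> 0) (at s0)"
      using tendsto_imp_eventually_ne[OF qE \<omega>] .
    moreover have "eventually (\<lambda>s. s \<noteq> s0) (at s0)" by (simp add: eventually_at_filter)
    ultimately have "eventually (\<lambda>s. ((u s - u x) / of_real (s - s0)) / ((E s - 1) / of_real (s - s0)) = g s) (at s0)"
      by eventually_elim (auto simp: g_def)
    then have "(g \<longlongrightarrow> u' s0 / \<omega>) (at s0)"
      using tendsto_divide[OF qu qE \<omega>] by (simp cong: tendsto_cong)
    then show ?thesis using True by (simp add: isCont_def g_def)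
  next
    case False
    have "eventually (\<lambda>s. E s \<noteq> 1) (at s0)"
      using tendsto_imp_eventually_ne[OF cont_E[of s0, unfolded isCont_def] False] .
    then have "eventually (\<lambda>s. (u s - u x) / (E s - 1) = g s) (at s0)"
      by eventually_elim (simp add: g_def)
    moreover have "((\<lambda>s. (u s - u x) / (E s - 1)) \<longlongrightarrow> (u s0 - u x) / (E s0 - 1)) (at s0)"
      using cont_u[of s0] cont_E[of s0] False unfolding isCont_def by (intro tendsto_intros) auto
    ultimately show ?thesis using False by (simp add: isCont_def g_def cong: tendsto_cong)
  qed
  have g_cont: "continuous_on {0..L} g" using cont_g by (simp add: continuous_at_imp_continuous_on)
  have u_g: "u s = u x + g s * (E s - 1)" for s using u_eq by (simp add: g_def)
  define b where "b = fcoeff L g"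
  \<comment> \<open>From u = u(x) + g (E - 1): multiplication by E shifts the frequency by one and
    contributes the phase \<open>fexp L 1 (-x)\<close>, which is what makes the partial sums
    telescope.\<close>
  have coeff: "fcoeff L u k = (if k = 0 then u x else 0) + fexp L 1 (-x) * b (k - 1) - b k" for k
  proof -
    have "u s * fexp L (-k) s = u x * fexp L (-k) s + fexp L 1 (-x) * (g s * fexp L (-(k - 1)) s) - g s * fexp L (-k) s" for s
    proof -
      have "E s * fexp L (-k) s = fexp L 1 (-x) * fexp L (-(k - 1)) s"
        using fexp_add_right[of L 1 s "-x"] fexp_add[of L 1 "-k" s] by (simp add: E_def)
      then show ?thesis by (subst u_g) (simp add: algebra_simps)
    qed
    then have "integral {0..L} (\<lambda>s. u s * fexp L (-k) s) = u x * integral {0..L} (fexp L (-k))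
       + fexp L 1 (-x) * integral {0..L} (\<lambda>s. g s * fexp L (-(k - 1)) s) - integral {0..L} (\<lambda>s. g s * fexp L (-k) s)"
      by (simp add: integral_add integral_diff integrable_continuous_real continuous_intros g_cont)
    then have "fcoeff L u k = (u x * integral {0..L} (fexp L (-k))
       + fexp L 1 (-x) * integral {0..L} (\<lambda>s. g s * fexp L (-(k - 1)) s) - integral {0..L} (\<lambda>s. g s * fexp L (-k) s)) / of_real L"
      unfolding fcoeff_def by simp
    then show ?thesis using L unfolding integral_fexp[OF L] b_def fcoeff_def
      by (simp add: add_divide_distrib diff_divide_distrib)
  qed
  have "fsum K L u x = u x + fexp L (- int K - 1) x * b (- int K - 1) - fexp L (int K) x * b (int K)" for K
  proof -
    have shift: "fexp L 1 (-x) * fexp L k x = fexp L (k - 1) x" for k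
      using fexp_add[of L "-1" k x] by (simp add: fexp_def)
    have "fsum K L u x = (\<Sum>k\<in>{-int K..int K}. (if k = 0 then u x else 0) + (fexp L (k - 1) x * b (k - 1) - fexp L k x * b k))"
      unfolding fsum_def coeff by (intro sum.cong refl) (simp add: shift[symmetric] algebra_simps)
    also have "\<dots> = u x + (\<Sum>k\<in>{-int K..int K}. fexp L (k - 1) x * b (k - 1) - fexp L k x * b k)"
      by (simp add: sum.distrib)
    also have "(\<Sum>k\<in>{-int K..int K}. F (k - 1) - F k) = F (- int K - 1) - F (int K)" for F :: "int \<Rightarrow> complex"
    proof (induction K)
      case (Suc K)
      have "{-int (Suc K)..int (Suc K)} = insert (-int (Suc K)) (insert (int (Suc K)) {-int K..int K})" by auto
      moreover have "F (- int K - 1) = F (- 1 - int K)" by (rule arg_cong[where f=F]) simp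
      ultimately show ?case using Suc by (simp add: algebra_simps)
    qed simp
    finally show ?thesis by simp
  qed
  moreover have "(\<lambda>K. u x + fexp L (- int K - 1) x * b (- int K - 1) - fexp L (int K) x * b (int K)) \<longlonglongrightarrow> u x + 0 - 0"
  proof (intro tendsto_add tendsto_diff tendsto_const)
    show "(\<lambda>K. fexp L (- int K - 1) x * b (- int K - 1)) \<longlonglongrightarrow> 0"
      using riemann_lebesgue_fcoeff[OF L g_cont, of "\<lambda>K. - int K - 1"]
      by (subst tendsto_norm_zero_iff[symmetric]) (simp add: norm_mult b_def inj_def tendsto_norm_zero)
    show "(\<lambda>K. fexp L (int K) x * b (int K)) \<longlonglongrightarrow> 0"
      using riemann_lebesgue_fcoeff[OF L g_cont, of "\<lambda>K. int K"]
      by (subst tendsto_norm_zero_iff[symmetric]) (simp add: norm_mult b_def inj_def tendsto_norm_zero)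
  qed
  ultimately show ?thesis by simp
qed

section \<open>Decay of coefficients and the truncation error\<close>

lemma fcoeff_derivative:
  assumes L: "L > 0" and per: "u L = u 0"
    and der: "\<And>s. (u has_vector_derivative u' s) (at s)" and cont: "continuous_on {0..L} u'"
  shows "fcoeff L u' k = \<i> * of_real (2 * pi / L * of_int k) * fcoeff L u k"
proof -
  define c where "c = \<i> * of_real (2 * pi / L * of_int k)"
  have cu: "continuous_on {0..L} u"
    using der has_vector_derivative_continuous by (blast intro: continuous_at_imp_continuous_on)
  have "((\<lambda>s. u s * fexp L (-k) s) has_vector_derivative (u' s * fexp L (-k) s - c * (u s * fexp L (-k) s))) (at s within {0..L})" for s
    using has_vector_derivative_mult[OF has_vector_derivative_at_within[OF der[of s]] fexp_has_vector_derivative[of L "-k" s "{0..L}"]]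
    by (simp add: c_def algebra_simps)
  then have "((\<lambda>s. u' s * fexp L (-k) s - c * (u s * fexp L (-k) s)) has_integral (u L * fexp L (-k) L - u 0 * fexp L (-k) 0)) {0..L}"
    using L by (intro fundamental_theorem_of_calculus) auto
  then have "integral {0..L} (\<lambda>s. u' s * fexp L (-k) s - c * (u s * fexp L (-k) s)) = 0"
    using L per by (simp add: fexp_period integral_unique)
  then have "integral {0..L} (\<lambda>s. u' s * fexp L (-k) s) = c * integral {0..L} (\<lambda>s. u s * fexp L (-k) s)"
    by (simp add: integral_diff integrable_continuous_real continuous_intros cu cont)
  then show ?thesis by (simp add: fcoeff_def c_def)
qed

text \<open>Each derivative multiplies the k-th coefficient by 2 pi i k / L. The successive
  derivatives are supplied as a chain d, so none has to be computed from u.\<close>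

lemma norm_fcoeff_smooth_le:
  fixes d :: "nat \<Rightarrow> real \<Rightarrow> complex"
  assumes L: "L > 0" and per: "\<And>j. j < n \<Longrightarrow> d j L = d j 0"
    and der: "\<And>j s. j < n \<Longrightarrow> (d j has_vector_derivative d (Suc j) s) (at s)"
    and cont: "continuous_on {0..L} (d n)" and bnd: "\<And>s. s \<in> {0..L} \<Longrightarrow> norm (d n s) \<le> M"
    and k: "k \<noteq> 0"
  shows "norm (fcoeff L (d 0) k) \<le> M / (2 * pi / L * \<bar>of_int k\<bar>) ^ n"
proof -
  have "fcoeff L (d j) k = (\<i> * of_real (2 * pi / L * of_int k)) ^ j * fcoeff L (d 0) k" if "j \<le> n" for j
    using that
  proof (induction j)
    case (Suc j)
    have "continuous_on {0..L} (d (Suc j))"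
    proof (cases "Suc j = n")
      case False
      then have "Suc j < n" using Suc.prems by simp
      then show ?thesis using has_vector_derivative_continuous[OF der[of "Suc j"]]
        by (intro continuous_at_imp_continuous_on ballI) auto
    qed (use cont in simp)
    then show ?case using fcoeff_derivative[OF L per der, of j k] Suc by simp
  qed simp
  from this[of n] have "norm (fcoeff L (d n) k) = norm (\<i> * of_real (2 * pi / L * of_int k)) ^ n * norm (fcoeff L (d 0) k)"
    by (simp only: norm_mult norm_power order.refl)
  also have "norm (\<i> * of_real (2 * pi / L * of_int k)) = 2 * pi / L * \<bar>of_int k\<bar>"
    unfolding norm_mult norm_of_real using L by (simp add: abs_mult)
  finally have "norm (fcoeff L (d n) k) = (2 * pi / L * \<bar>of_int k\<bar>) ^ n * norm (fcoeff L (d 0) k)" .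
  then have "(2 * pi / L * \<bar>of_int k\<bar>) ^ n * norm (fcoeff L (d 0) k) \<le> M"
    using norm_fcoeff_le[OF L cont bnd, of k] by simp
  then show ?thesis using k L by (simp add: field_simps)
qed

text \<open>A discrete integral test: it sums the tail of 1/k^6 to at most 1/K^5 by
  telescoping.\<close>

lemma inverse_power_telescope:
  assumes "n \<ge> 1"
  shows "1 / real (Suc n) ^ 6 \<le> 1 / real n ^ 5 - 1 / real (Suc n) ^ 5"
proof -
  have "real n ^ 5 + real n ^ 4 \<le> real (Suc n) ^ 5"
  proof -
    have "real n ^ 5 + real n ^ 4 = real (Suc n) * real n ^ 4" by (simp add: algebra_simps power_numeral_reduce)
    also have "\<dots> \<le> real (Suc n) * real (Suc n) ^ 4" by (intro mult_left_mono power_mono) auto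
    finally show ?thesis by (simp add: power_numeral_reduce)
  qed
  then have "real n ^ 5 * (1 + real (Suc n)) \<le> real (Suc n) * real (Suc n) ^ 5"
    using mult_left_mono[of "real n ^ 5 + real n ^ 4" "real (Suc n) ^ 5" "real (Suc n)"]
    by (simp add: algebra_simps power_numeral_reduce)
  then have "(1 + real (Suc n)) * real n ^ 5 \<le> real (Suc n) ^ 6" by (simp add: mult.commute power_numeral_reduce)
  then have "(1 + real (Suc n)) / real (Suc n) ^ 6 \<le> 1 / real n ^ 5"
    using assms by (simp add: divide_le_eq le_divide_eq del: of_nat_Suc)
  moreover have "(1 + real (Suc n)) / real (Suc n) ^ 6 = 1 / real (Suc n) ^ 6 + 1 / real (Suc n) ^ 5"
    by (simp add: add_divide_distrib power_numeral_reduce del: of_nat_Suc)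
  ultimately show ?thesis by linarith
qed

text \<open>Passing from n to n + 1 adds the two modes with |k| = n + 1, which explains the factor
  2. The telescoped bound between partial sums is uniform in the upper index and survives the limit,
  identified by \<open>fsum_tendsto\<close>.\<close>

lemma fsum_error:
  fixes d :: "nat \<Rightarrow> real \<Rightarrow> complex"
  assumes L: "L > 0" and per: "\<And>j s. j < 6 \<Longrightarrow> d j (s + L) = d j s"
    and der: "\<And>j s. j < 6 \<Longrightarrow> (d j has_vector_derivative d (Suc j) s) (at s)"
    and cont: "continuous_on {0..L} (d 6)" and bnd: "\<And>s. s \<in> {0..L} \<Longrightarrow> norm (d 6 s) \<le> M"
    and K: "K \<ge> 1"
  shows "norm (d 0 x - fsum K L (d 0) x) \<le> 2 * M / (2 * pi / L) ^ 6 / real K ^ 5"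
proof -
  have M: "M \<ge> 0" using bnd[of 0] L norm_ge_zero[of "d 6 0"] by (simp del: norm_ge_zero)
  define C where "C = 2 * M / (2 * pi / L) ^ 6"
  have C: "C \<ge> 0" using M L by (simp add: C_def)
  have fc: "norm (fcoeff L (d 0) k) \<le> C / 2 / \<bar>of_int k\<bar> ^ 6" if "k \<noteq> 0" for k
    using norm_fcoeff_smooth_le[OF L _ der cont bnd that] per[of _ 0]
    by (simp add: C_def power_mult_distrib power_divide)
  have step: "norm (fsum (Suc n) L (d 0) x - fsum n L (d 0) x) \<le> C / real (Suc n) ^ 6" for n
  proof -
    have "{-int (Suc n)..int (Suc n)} = insert (-int (Suc n)) (insert (int (Suc n)) {-int n..int n})" by auto
    then have "fsum (Suc n) L (d 0) x - fsum n L (d 0) x =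
        fcoeff L (d 0) (-int (Suc n)) * fexp L (-int (Suc n)) x + fcoeff L (d 0) (int (Suc n)) * fexp L (int (Suc n)) x"
      unfolding fsum_def by simp
    also have "norm \<dots> \<le> norm (fcoeff L (d 0) (-int (Suc n))) + norm (fcoeff L (d 0) (int (Suc n)))"
      by (rule order.trans[OF norm_triangle_ineq]) (simp add: norm_mult)
    also have "\<dots> \<le> C / 2 / real (Suc n) ^ 6 + C / 2 / real (Suc n) ^ 6"
      using fc[of "-int (Suc n)"] fc[of "int (Suc n)"] by (intro add_mono) (auto simp: add.commute)
    finally show ?thesis by simp
  qed
  have "norm (fsum (K + n) L (d 0) x - fsum K L (d 0) x) \<le> C * (1 / real K ^ 5 - 1 / real (K + n) ^ 5)" for n
  proof (induction n)
    case (Suc n)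
    have "norm (fsum (K + Suc n) L (d 0) x - fsum K L (d 0) x) \<le>
       norm (fsum (Suc (K + n)) L (d 0) x - fsum (K + n) L (d 0) x) + norm (fsum (K + n) L (d 0) x - fsum K L (d 0) x)"
      using norm_triangle_ineq[of "fsum (Suc (K + n)) L (d 0) x - fsum (K + n) L (d 0) x" "fsum (K + n) L (d 0) x - fsum K L (d 0) x"]
      by simp
    also have "\<dots> \<le> C * (1 / real (Suc (K + n)) ^ 6) + C * (1 / real K ^ 5 - 1 / real (K + n) ^ 5)"
      using step[of "K + n"] Suc by simp
    also have "\<dots> \<le> C * (1 / real (K + n) ^ 5 - 1 / real (Suc (K + n)) ^ 5) + C * (1 / real K ^ 5 - 1 / real (K + n) ^ 5)"
      using inverse_power_telescope[of "K + n"] K C by (intro add_mono mult_left_mono) auto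
    finally show ?case by (simp add: algebra_simps)
  qed simp
  then have bound: "norm (fsum (K + n) L (d 0) x - fsum K L (d 0) x) \<le> C / real K ^ 5" for n
    using C mult_left_mono[of "1 / real K ^ 5 - 1 / real (K + n) ^ 5" "1 / real K ^ 5" C]
    by (force intro: order.trans)
  have "(\<lambda>n. fsum (K + n) L (d 0) x) \<longlonglongrightarrow> d 0 x"
    using LIMSEQ_ignore_initial_segment[OF fsum_tendsto[OF L per der, of 0], of K x] by (simp add: add.commute)
  then have "(\<lambda>n. norm (fsum (K + n) L (d 0) x - fsum K L (d 0) x)) \<longlonglongrightarrow> norm (d 0 x - fsum K L (d 0) x)"
    by (intro tendsto_intros)
  then show ?thesis using bound LIMSEQ_le_const2 unfolding C_def by blast
qed

section \<open>The Fourier projection in three variables\<close>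

lemma vector3_eq_iff: "vector [a, b, c] = (x :: real^3) \<longleftrightarrow> x $ 1 = a \<and> x $ 2 = b \<and> x $ 3 = c"
  by (auto simp: vec_eq_iff forall_3)

text \<open>Fubini is available on product types, not directly on vectors of length three. The
  coordinate bijection maps boxes to boxes of equal content, so it transports the integral with
  factor 1; the product rule is then applied twice.\<close>

lemma integral_real3_iterated:
  fixes F :: "real^3 \<Rightarrow> complex"
  assumes "continuous_on UNIV F" "L > 0"
  shows "integral (cbox 0 (\<chi> _. L)) F =
    integral {0..L} (\<lambda>a. integral {0..L} (\<lambda>b. integral {0..L} (\<lambda>c. F (vector [a, b, c]))))"
proof -
  define g :: "real \<times> real \<times> real \<Rightarrow> real^3" where "g = (\<lambda>(a, b, c). vector [a, b, c])"
  define h :: "real^3 \<Rightarrow> real \<times> real \<times> real" where "h = (\<lambda>x. (x $ 1, x $ 2, x $ 3))"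
  have gh: "g (h x) = x" for x by (simp add: g_def h_def vector3_eq_iff)
  have hg: "h (g x) = x" for x by (cases x) (simp add: g_def h_def)
  have g_lin: "g = (\<lambda>x. fst x *\<^sub>R axis 1 1 + fst (snd x) *\<^sub>R axis 2 1 + snd (snd x) *\<^sub>R axis 3 1)"
    by (auto simp: fun_eq_iff g_def vec_eq_iff forall_3 axis_def)
  have cont_g: "continuous_on S g" for S unfolding g_lin by (intro continuous_intros)
  have g_box: "g ` cbox u v = cbox (g u) (g v)" for u v
  proof -
    have "x \<in> cbox u v \<longleftrightarrow> g x \<in> cbox (g u) (g v)" for x
      by (cases x; cases u; cases v) (auto simp: g_def mem_box_cart forall_3 cbox_Pair_eq)
    then have iff: "x \<in> cbox (g u) (g v) \<longleftrightarrow> h x \<in> cbox u v" for x using gh[of x] by metis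
    show ?thesis
    proof (intro set_eqI iffI)
      fix x assume "x \<in> g ` cbox u v"
      then show "x \<in> cbox (g u) (g v)" using iff hg by auto
    next
      fix x assume "x \<in> cbox (g u) (g v)"
      then have "h x \<in> cbox u v" using iff by simp
      then show "x \<in> g ` cbox u v" using gh[of x] by (metis imageI)
    qed
  qed
  have h_box: "h ` cbox u v = cbox (h u) (h v)" for u v
  proof -
    have "h ` cbox u v = h ` g ` cbox (h u) (h v)" unfolding g_box gh ..
    then show ?thesis by (simp add: image_image hg)
  qed
  have content: "measure lborel (g ` cbox u v) = 1 * measure lborel (cbox u v)" for u v
  proof (cases "cbox u v = {}")
    case False
    then have ne: "cbox (g u) (g v) \<noteq> {}" using g_box[of u v] by auto
    obtain u1 u2 u3 v1 v2 v3 where uv: "u = (u1, u2, u3)" "v = (v1, v2, v3)" by (metis prod_cases3)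
    have le: "u1 \<le> v1" "u2 \<le> v2" "u3 \<le> v3" using False unfolding uv by (auto simp: cbox_Pair_eq)
    have prod3: "prod f (UNIV :: 3 set) = f 1 * f 2 * f 3" for f :: "3 \<Rightarrow> real"
      unfolding UNIV_3 by (simp add: ac_simps)
    have "measure lborel (cbox u v) = (v1 - u1) * ((v2 - u2) * (v3 - u3))"
      unfolding uv content_Pair using le by simp
    then show ?thesis unfolding g_box content_cbox_cart[OF ne] prod3 by (simp add: uv g_def)
  qed simp
  have Fg: "continuous_on UNIV (\<lambda>x. F (g x))"
    using continuous_on_compose2[OF assms(1) cont_g] by simp
  have g_ex: "\<exists>w z. g ` cbox u v = cbox w z" and h_ex: "\<exists>w z. h ` cbox a b = cbox w z" for u v a b
    using g_box h_box by blast+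
  have cg: "isCont g x" for x using cont_g[of UNIV] unfolding continuous_on_eq_continuous_at[OF open_UNIV] by blast
  have F_int: "(F has_integral integral (cbox 0 (\<chi> _. L)) F) (cbox 0 (\<chi> _. L))"
    by (intro integrable_integral integrable_continuous continuous_on_subset[OF assms(1)]) simp
  have "((\<lambda>x. F (g x)) has_integral (1 / 1) *\<^sub>R integral (cbox 0 (\<chi> _. L)) F) (h ` cbox 0 (\<chi> _. L))"
    by (rule has_integral_twiddle[OF _ hg gh cg g_ex h_ex content F_int]) simp
  then have "integral (cbox 0 (\<chi> _. L)) F = integral (cbox (0, 0, 0) (L, L, L)) (\<lambda>x. F (g x))"
    unfolding h_box by (simp add: h_def integral_unique)
  also have "\<dots> = integral (cbox 0 L) (\<lambda>a. integral (cbox (0, 0) (L, L)) (\<lambda>y. F (g (a, y))))"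
    by (rule integral_prod_continuous) (rule continuous_on_subset[OF Fg], simp)
  also have "\<dots> = integral (cbox 0 L) (\<lambda>a. integral (cbox 0 L) (\<lambda>b. integral (cbox 0 L) (\<lambda>c. F (g (a, b, c)))))"
    by (intro integral_cong integral_prod_continuous continuous_on_compose2[OF Fg]) (auto intro!: continuous_intros)
  finally show ?thesis by (simp add: g_def)
qed

lemma continuous_on_vector3:
  assumes "continuous_on UNIV (f :: real^3 \<Rightarrow> 'b::topological_space)"
    "continuous_on S a" "continuous_on S b" "continuous_on S c"
  shows "continuous_on S (\<lambda>x. f (vector [a x, b x, c x]))"
proof -
  have eq: "vector [a x, b x, c x] = a x *\<^sub>R axis 1 1 + b x *\<^sub>R axis 2 1 + c x *\<^sub>R (axis 3 1 :: real^3)" for x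
    by (auto simp: vec_eq_iff forall_3 axis_def)
  have "continuous_on S (\<lambda>x. a x *\<^sub>R axis 1 1 + b x *\<^sub>R axis 2 1 + c x *\<^sub>R (axis 3 1 :: real^3))"
    by (intro continuous_intros assms)
  then show ?thesis unfolding eq by (rule continuous_on_compose2[OF assms(1)]) simp
qed

lemma continuous_on_fcoeff:
  fixes G :: "'x::topological_space \<Rightarrow> real \<Rightarrow> complex"
  assumes "continuous_on UNIV (\<lambda>(x, t). G x t)"
  shows "continuous_on UNIV (\<lambda>x. fcoeff L (G x) k)"
proof -
  have "continuous_on (UNIV \<times> UNIV) (\<lambda>p. (\<lambda>(x, t). G x t) p * fexp L (-k) (snd p))"
    using assms by (intro continuous_intros continuous_on_compose2[OF continuous_on_fexp[of UNIV L "-k"]]) auto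
  then have "continuous_on (UNIV \<times> cbox 0 L) (\<lambda>(x, t). G x t * fexp L (-k) t)"
    by (simp add: case_prod_unfold) (rule continuous_on_subset, auto)
  from integral_continuous_on_param[OF this] show ?thesis
    unfolding fcoeff_def divide_inverse by (intro continuous_intros) simp
qed

lemma continuous_on_fsum:
  fixes G :: "'x::topological_space \<Rightarrow> real \<Rightarrow> complex"
  assumes "continuous_on UNIV (\<lambda>(x, t). G x t)"
  shows "continuous_on UNIV (\<lambda>x. fsum K L (G x) t)"
  unfolding fsum_def by (intro continuous_intros continuous_on_fcoeff assms)

lemma fcoeff_sum:
  assumes "finite I" "\<And>q. q \<in> I \<Longrightarrow> continuous_on UNIV (G q)"
  shows "fcoeff L (\<lambda>s. \<Sum>q\<in>I. G q s * w q) k = (\<Sum>q\<in>I. fcoeff L (G q) k * w q)"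
proof -
  have "integral {0..L} (\<lambda>s. (\<Sum>q\<in>I. G q s * w q) * fexp L (-k) s) =
      integral {0..L} (\<lambda>s. \<Sum>q\<in>I. w q * (G q s * fexp L (-k) s))"
    unfolding sum_distrib_right by (intro integral_cong sum.cong refl) (simp add: mult_ac)
  also have "\<dots> = (\<Sum>q\<in>I. w q * integral {0..L} (\<lambda>s. G q s * fexp L (-k) s))"
    using assms by (subst integral_sum)
      (auto intro!: integrable_continuous_real continuous_intros continuous_on_subset[OF assms(2)])
  finally show ?thesis by (simp add: fcoeff_def sum_divide_distrib mult.commute)
qed

definition slice3 :: "field3 \<Rightarrow> real \<Rightarrow> real \<Rightarrow> real \<Rightarrow> complex" where
  "slice3 f a b c = of_real (f (vector [a, b, c]))"

text \<open>The frequencies kept by \<open>fourier_proj\<close> form a cube, so the projection is a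
  composition of one-dimensional partial sums, the innermost acting on the third variable.\<close>

definition fsum3 :: "nat \<Rightarrow> real \<Rightarrow> (real \<Rightarrow> real \<Rightarrow> real \<Rightarrow> complex) \<Rightarrow> real \<Rightarrow> real \<Rightarrow> real \<Rightarrow> complex" where
  "fsum3 K L F a b c = fsum K L (\<lambda>a. fsum K L (\<lambda>b. fsum K L (F a b) c) b) a"

lemma slice3_cont:
  assumes "continuous_on UNIV f"
  shows "continuous_on UNIV (\<lambda>((a, b), c). slice3 f a b c)"
  unfolding slice3_def case_prod_unfold
  by (intro continuous_intros continuous_on_vector3[OF assms])

lemma cis_fexp3:
  "cis (2 * pi / L * (of_int k1 * a + of_int k2 * b + of_int k3 * c)) = fexp L k1 a * fexp L k2 b * fexp L k3 c"
  "cis (- (2 * pi / L) * (of_int k1 * a + of_int k2 * b + of_int k3 * c)) = fexp L (-k1) a * fexp L (-k2) b * fexp L (-k3) c"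
  by (simp_all add: fexp_def cis_mult distrib_left add_divide_distrib mult.assoc)

lemma fourier_coeff_iterated:
  assumes "continuous_on UNIV f" "L > 0"
  shows "fourier_coeff L f k1 k2 k3 =
    fcoeff L (\<lambda>a. fcoeff L (\<lambda>b. fcoeff L (slice3 f a b) k3) k2) k1"
proof -
  let ?F = "\<lambda>x::real^3. complex_of_real (f x) * cis (- (2 * pi / L) * (of_int k1 * x $ 1 + of_int k2 * x $ 2 + of_int k3 * x $ 3))"
  have "continuous_on UNIV ?F"
    using assms(1) unfolding cis_fexp3
    by (intro continuous_intros continuous_on_compose2[OF continuous_on_fexp[of UNIV]]) auto
  from integral_real3_iterated[OF this assms(2)]
  have "integral (cbox 0 (\<chi> _. L)) ?F = integral {0..L} (\<lambda>a. integral {0..L} (\<lambda>b. integral {0..L} (\<lambda>c.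
      fexp L (-k1) a * (fexp L (-k2) b * (slice3 f a b c * fexp L (-k3) c)))))"
    unfolding cis_fexp3 by (simp add: slice3_def mult.commute mult.left_commute)
  also have "\<dots> = integral {0..L} (\<lambda>a. fexp L (-k1) a * integral {0..L} (\<lambda>b. fexp L (-k2) b * integral {0..L} (\<lambda>c. slice3 f a b c * fexp L (-k3) c)))"
    by simp
  finally show ?thesis using assms(2)
    unfolding fourier_coeff_def fcoeff_def by (simp add: power3_eq_cube mult.commute[of "fexp _ _ _"])
qed

text \<open>Each finite sum is pulled out of the next coefficient by linearity; this is where
  continuity of the inner coefficients in the remaining variables enters.\<close>

lemma fourier_proj_fsum3:
  assumes "continuous_on UNIV f" "L > 0"
  shows "fourier_proj K L f (vector [a, b, c]) = Re (fsum3 K L (slice3 f) a b c)"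
proof -
  have c3: "continuous_on UNIV (\<lambda>(a, b). fcoeff L (slice3 f a b) k)" for k
    using continuous_on_fcoeff[of "\<lambda>p. slice3 f (fst p) (snd p)" L k] slice3_cont[OF assms(1)]
    by (simp add: case_prod_unfold)
  have c3': "continuous_on UNIV (\<lambda>b. fcoeff L (slice3 f a b) k)" for a k
    using continuous_on_compose2[OF c3[of k], of UNIV "\<lambda>b. (a, b)"] by (simp add: continuous_intros)
  have c2: "continuous_on UNIV (\<lambda>a. fcoeff L (\<lambda>b. fcoeff L (slice3 f a b) k3) k2)" for k2 k3
    using c3[of k3] by (intro continuous_on_fcoeff)
  have s3: "fcoeff L (\<lambda>b. fsum K L (slice3 f a b) c) k2 =
      (\<Sum>k3\<in>{-int K..int K}. fcoeff L (\<lambda>b. fcoeff L (slice3 f a b) k3) k2 * fexp L k3 c)" for a k2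
    unfolding fsum_def by (rule fcoeff_sum) (use c3' in auto)
  have s2: "fsum K L (\<lambda>b. fsum K L (slice3 f a b) c) b =
      (\<Sum>(k2, k3)\<in>{-int K..int K} \<times> {-int K..int K}. fcoeff L (\<lambda>b. fcoeff L (slice3 f a b) k3) k2 * (fexp L k3 c * fexp L k2 b))" for a
    unfolding fsum_def[of K L "\<lambda>b. fsum K L (slice3 f a b) c"] s3 sum_distrib_right
    by (simp add: sum.cartesian_product mult.assoc)
  have "fsum3 K L (slice3 f) a b c = (\<Sum>k1\<in>{-int K..int K}.
      fcoeff L (\<lambda>a. \<Sum>q\<in>{-int K..int K} \<times> {-int K..int K}. fcoeff L (\<lambda>b. fcoeff L (slice3 f a b) (snd q)) (fst q)
        * (fexp L (snd q) c * fexp L (fst q) b)) k1 * fexp L k1 a)"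
    unfolding fsum3_def s2 unfolding fsum_def by (simp add: case_prod_unfold)
  also have "\<dots> = (\<Sum>k1\<in>{-int K..int K}. (\<Sum>q\<in>{-int K..int K} \<times> {-int K..int K}.
      fourier_coeff L f k1 (fst q) (snd q) * (fexp L (snd q) c * fexp L (fst q) b)) * fexp L k1 a)"
    by (subst fcoeff_sum) (use c2 in \<open>auto simp: fourier_coeff_iterated[OF assms]\<close>)
  also have "\<dots> = (\<Sum>k1\<in>{-int K..int K}. \<Sum>k2\<in>{-int K..int K}. \<Sum>k3\<in>{-int K..int K}.
      fourier_coeff L f k1 k2 k3 * (fexp L k1 a * fexp L k2 b * fexp L k3 c))"
    unfolding sum_distrib_right sum.cartesian_product[of _ "{-int K..int K}" "{-int K..int K}"]
    by (intro sum.cong refl) (auto simp: mult_ac)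
  finally show ?thesis unfolding fourier_proj_def cis_fexp3 by simp
qed

section \<open>Error and stability of the projection\<close>

lemma CkB_fsum_error:
  assumes f: "CkB 6 M f" "periodic3 L f" and "L > 0" "K \<ge> 1"
    and G: "G = (\<lambda>s. complex_of_real (f (p + s *\<^sub>R axis i 1)))"
  shows "norm (G x - fsum K L G x) \<le> 2 * M / (2 * pi / L) ^ 6 / real K ^ 5"
proof -
  define d where "d = (\<lambda>j s. complex_of_real ((pd i ^^ j) f (p + s *\<^sub>R axis i 1)))"
  have der: "(d j has_vector_derivative d (Suc j) s) (at s)" if "j < 6" for j s
  proof -
    have "CkB (Suc (5 - j)) M ((pd i ^^ j) f)"
    proof -
      have "j + Suc (5 - j) = 6" using that by simp
      then show ?thesis using CkB_pd_funpow[of j "Suc (5 - j)" M f i] f(1) by (simp only:)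
    qed
    from CkB_deriv_line[OF this, of p i s]
    have "((\<lambda>s. (pd i ^^ j) f (p + s *\<^sub>R axis i 1)) has_vector_derivative (pd i ^^ Suc j) f (p + s *\<^sub>R axis i 1)) (at s)"
      by (simp add: has_real_derivative_iff_has_vector_derivative)
    from bounded_linear.has_vector_derivative[OF bounded_linear_of_real this]
    show ?thesis by (simp add: d_def)
  qed
  have d6: "CkB 0 M ((pd i ^^ 6) f)" using CkB_pd_funpow[of 6 0 M f i] f(1) by simp
  have per: "d j (s + L) = d j s" for j s
  proof -
    have "periodic3 L ((pd i ^^ j) f)" using f(2) by (induction j) (auto simp: periodic3_pd)
    then have "(pd i ^^ j) f (p + s *\<^sub>R axis i 1 + L *\<^sub>R axis i 1) = (pd i ^^ j) f (p + s *\<^sub>R axis i 1)"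
      by (simp add: periodic3_def)
    then show ?thesis by (simp add: d_def algebra_simps)
  qed
  have "norm (d 0 x - fsum K L (d 0) x) \<le> 2 * M / (2 * pi / L) ^ 6 / real K ^ 5"
  proof (rule fsum_error[where d=d and L=L])
    show "continuous_on {0..L} (d 6)"
      unfolding d_def by (intro continuous_intros continuous_on_compose2[OF CkB_cont[OF d6]]) auto
    show "norm (d 6 s) \<le> M" for s using CkB_bound[OF d6] by (simp add: d_def)
  qed (use assms(3,4) per der in auto)
  then show ?thesis by (simp add: d_def G)
qed

text \<open>With P1, P2, P3 the partial sums in the three variables, I - P1 P2 P3 = (I - P1) + P1
  ((I - P2) + P2 (I - P3)). Each difference is at most Q and each operator has norm at most n = 2K +
  1 \<le> 3K, so the total is (1 + n + n^2) Q \<le> 13 K^2 Q; with the factor 2 in Q this is the 26,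
  and K^-5 becomes K^-3.\<close>

lemma fourier_proj_error_vector:
  assumes f: "CkB 6 M f" "periodic3 L f" and L: "L > 0" and K: "K \<ge> 1"
  shows "\<bar>f (vector [a, b, c]) - fourier_proj K L f (vector [a, b, c])\<bar> \<le> 26 * M / (2 * pi / L) ^ 6 / real K ^ 3"
proof -
  define Q where "Q = 2 * M / (2 * pi / L) ^ 6 / real K ^ 5"
  define F where "F = slice3 f"
  have cont: "continuous_on UNIV f" by (rule CkB_cont[OF f(1)])
  have Q: "0 \<le> Q" using CkB_bound_nonneg[OF f(1)] L by (simp add: Q_def)
  have F1: "norm (F a b c - fsum K L (\<lambda>a. F a b c) a) \<le> Q" for a b c
    unfolding Q_def by (rule CkB_fsum_error[OF f L K, where p="vector [0, b, c]" and i=1])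
      (auto simp: F_def slice3_def fun_eq_iff vec_eq_iff forall_3 axis_def intro!: arg_cong[where f=f])
  have F2: "norm (F a b c - fsum K L (\<lambda>b. F a b c) b) \<le> Q" for a b c
    unfolding Q_def by (rule CkB_fsum_error[OF f L K, where p="vector [a, 0, c]" and i=2])
      (auto simp: F_def slice3_def fun_eq_iff vec_eq_iff forall_3 axis_def intro!: arg_cong[where f=f])
  have F3: "norm (F a b c - fsum K L (F a b) c) \<le> Q" for a b c
    unfolding Q_def by (rule CkB_fsum_error[OF f L K, where p="vector [a, b, 0]" and i=3])
      (auto simp: F_def slice3_def fun_eq_iff vec_eq_iff forall_3 axis_def intro!: arg_cong[where f=f])
  have cF: "continuous_on UNIV (\<lambda>b. F a b c)" "continuous_on UNIV (\<lambda>a. F a b c)" for a b c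
    unfolding F_def slice3_def by (intro continuous_intros continuous_on_vector3[OF cont])+
  have cS3: "continuous_on UNIV (\<lambda>(a, b). fsum K L (F a b) c)" for c
    using continuous_on_fsum[of "\<lambda>p. F (fst p) (snd p)" K L c] slice3_cont[OF cont]
    by (simp add: case_prod_unfold F_def)
  have cS3': "continuous_on UNIV (\<lambda>b. fsum K L (F a b) c)" for a c
    using continuous_on_compose2[OF cS3[of c], of UNIV "\<lambda>b. (a, b)"] by (simp add: continuous_intros)
  have cS2: "continuous_on UNIV (\<lambda>a. fsum K L (\<lambda>b. fsum K L (F a b) c) b)" for b c
    using cS3[of c] by (intro continuous_on_fsum)
  define n where "n = real (2 * K + 1)"
  have S2: "norm (F a b c - fsum K L (\<lambda>b. fsum K L (F a b) c) b) \<le> Q + n * Q" for a b c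
  proof -
    have "fsum K L (\<lambda>b. F a b c) b - fsum K L (\<lambda>b. fsum K L (F a b) c) b = fsum K L (\<lambda>b. F a b c - fsum K L (F a b) c) b"
      by (rule fsum_diff[symmetric]) (rule continuous_on_subset[OF cF(1)] continuous_on_subset[OF cS3'], simp)+
    also have "norm \<dots> \<le> n * Q" unfolding n_def
      by (rule norm_fsum_le[OF L]) (auto intro!: continuous_intros continuous_on_subset[OF cF(1)] continuous_on_subset[OF cS3'] F3)
    finally show ?thesis using F2[of a b c]
        norm_triangle_ineq[of "F a b c - fsum K L (\<lambda>b. F a b c) b" "fsum K L (\<lambda>b. F a b c) b - fsum K L (\<lambda>b. fsum K L (F a b) c) b"]
      by simp
  qed
  have S1: "norm (F a b c - fsum3 K L F a b c) \<le> Q + n * (Q + n * Q)"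
  proof -
    have "fsum K L (\<lambda>a. F a b c) a - fsum3 K L F a b c = fsum K L (\<lambda>a. F a b c - fsum K L (\<lambda>b. fsum K L (F a b) c) b) a"
      unfolding fsum3_def
      by (rule fsum_diff[symmetric]) (rule continuous_on_subset[OF cF(2)] continuous_on_subset[OF cS2], simp)+
    also have "norm \<dots> \<le> real (2 * K + 1) * (Q + n * Q)"
      by (rule norm_fsum_le[OF L]) (auto intro!: continuous_intros continuous_on_subset[OF cF(2)] continuous_on_subset[OF cS2] S2)
    finally have "norm (fsum K L (\<lambda>a. F a b c) a - fsum3 K L F a b c) \<le> n * (Q + n * Q)" by (simp only: n_def)
    then show ?thesis using F1[of a b c]
        norm_triangle_ineq[of "F a b c - fsum K L (\<lambda>a. F a b c) a" "fsum K L (\<lambda>a. F a b c) a - fsum3 K L F a b c"]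
      by simp
  qed
  have "f (vector [a, b, c]) - fourier_proj K L f (vector [a, b, c]) = Re (F a b c - fsum3 K L F a b c)"
    unfolding fourier_proj_fsum3[OF cont L] by (simp add: F_def slice3_def)
  then have "\<bar>f (vector [a, b, c]) - fourier_proj K L f (vector [a, b, c])\<bar> \<le> Q + n * (Q + n * Q)"
    using abs_Re_le_cmod[of "F a b c - fsum3 K L F a b c"] S1 by linarith
  also have "\<dots> = (1 + n + n * n) * Q" by (simp add: algebra_simps)
  also have "\<dots> \<le> 13 * (real K)\<^sup>2 * Q"
  proof (rule mult_right_mono[OF _ Q])
    have "1 \<le> real K" "n \<le> 3 * real K" "0 \<le> n" using K by (simp_all add: n_def)
    then have "n * n \<le> 3 * real K * (3 * real K)" "1 * 1 \<le> real K * real K" "1 * real K \<le> real K * real K"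
      by (intro mult_mono; simp)+
    then show "1 + n + n * n \<le> 13 * (real K)\<^sup>2" using \<open>n \<le> 3 * real K\<close>
      by (simp add: power2_eq_square)
  qed
  also have "\<dots> = 26 * M / (2 * pi / L) ^ 6 / real K ^ 3"
    using K by (simp add: Q_def power_numeral_reduce field_simps)
  finally show ?thesis .
qed

lemma vector3_components: "(x :: real^3) = vector [x $ 1, x $ 2, x $ 3]"
  by (simp add: vec_eq_iff forall_3)

lemma fourier_proj_error:
  assumes "CkB 6 M f" "periodic3 L f" "L > 0" "K \<ge> 1"
  shows "\<bar>f x - fourier_proj K L f x\<bar> \<le> 26 * M / (2 * pi / L) ^ 6 / real K ^ 3"
  using fourier_proj_error_vector[OF assms, of "x $ 1" "x $ 2" "x $ 3"] vector3_components[of x] by simp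

text \<open>The operator bound grows like K^3. It serves only to compare projections at two nearby
  times for fixed K, where the difference of the functions can be made arbitrarily small.\<close>

lemma fourier_proj_stable:
  assumes "continuous_on UNIV f" "continuous_on UNIV g" "L > 0" "\<And>x. \<bar>f x - g x\<bar> \<le> B"
  shows "\<bar>fourier_proj K L f x - fourier_proj K L g x\<bar> \<le> real (2 * K + 1) ^ 3 * B"
proof -
  define a b c where abc: "a = x $ 1" "b = x $ 2" "c = x $ 3"
  define n where "n = real (2 * K + 1)"
  have cF: "continuous_on UNIV (\<lambda>c. slice3 u a b c)" if "continuous_on UNIV u" for u a b
    unfolding slice3_def by (intro continuous_intros continuous_on_vector3[OF that])
  have cS3: "continuous_on UNIV (\<lambda>(a, b). fsum K L (slice3 u a b) c)" if "continuous_on UNIV u" for u c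
    using continuous_on_fsum[of "\<lambda>p. slice3 u (fst p) (snd p)" K L c] slice3_cont[OF that]
    by (simp add: case_prod_unfold)
  have cS3': "continuous_on UNIV (\<lambda>b. fsum K L (slice3 u a b) c)" if "continuous_on UNIV u" for u a c
    using continuous_on_compose2[OF cS3[OF that, of c], of UNIV "\<lambda>b. (a, b)"] by (simp add: continuous_intros)
  have cS2: "continuous_on UNIV (\<lambda>a. fsum K L (\<lambda>b. fsum K L (slice3 u a b) c) b)" if "continuous_on UNIV u" for u b c
    using cS3[OF that, of c] by (intro continuous_on_fsum)
  have d: "norm (fsum K L u t - fsum K L v t) \<le> n * D"
    if "continuous_on UNIV u" "continuous_on UNIV v" "\<And>s. norm (u s - v s) \<le> D" for u v t D
  proof -
    have c: "continuous_on {0..L} u" "continuous_on {0..L} v"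
      using that continuous_on_subset by blast+
    show ?thesis unfolding fsum_diff[OF c, symmetric] n_def
      by (rule norm_fsum_le[OF assms(3)]) (auto intro!: continuous_intros c that(3))
  qed
  have "norm (fsum3 K L (slice3 f) a b c - fsum3 K L (slice3 g) a b c) \<le> n * (n * (n * B))"
    unfolding fsum3_def
    by (intro d cS2 cS3' cF assms) (simp add: slice3_def assms(4) flip: of_real_diff)
  then have "\<bar>Re (fsum3 K L (slice3 f) a b c - fsum3 K L (slice3 g) a b c)\<bar> \<le> n * (n * (n * B))"
    using abs_Re_le_cmod order.trans by blast
  then show ?thesis
    using fourier_proj_fsum3[OF assms(1,3), of K a b c] fourier_proj_fsum3[OF assms(2,3), of K a b c]
    by (simp add: abc vector3_components[symmetric] n_def power3_eq_cube mult.assoc)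
qed

lemma periodic3_fourier_proj:
  assumes "L > 0" shows "periodic3 L (fourier_proj K L f)"
proof -
  have per: "fexp L k (s + L) = fexp L k s" for k s
    using assms by (simp add: fexp_add_right fexp_period)
  show ?thesis unfolding periodic3_def
  proof (intro allI)
    fix i :: 3 and x
    consider "i = 1" | "i = 2" | "i = 3" using exhaust_3 by blast
    then show "fourier_proj K L f (x + L *\<^sub>R axis i 1) = fourier_proj K L f x"
      unfolding fourier_proj_def cis_fexp3 by cases (simp_all add: axis_def per)
  qed
qed

section \<open>Grid sums of trigonometric polynomials\<close>

lemma gper_grid_eval:
  assumes "periodic3 L f" "h * real N = L"
  shows "gper N (grid_eval h N f)"
proof -
  have p: "f (x + L *\<^sub>R axis i 1) = f x" for i x using assms(1) by (simp add: periodic3_def)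
  have e: "(vector [x + L, y, z] :: real^3) = vector [x, y, z] + L *\<^sub>R axis 1 1"
    "(vector [x, y + L, z] :: real^3) = vector [x, y, z] + L *\<^sub>R axis 2 1"
    "(vector [x, y, z + L] :: real^3) = vector [x, y, z] + L *\<^sub>R axis 3 1" for x y z :: real
    by (auto simp: vec_eq_iff forall_3 axis_def)
  have s: "(of_int (i + int N) - 1/2) * h = (of_int i - 1/2) * h + L" for i
    using assms(2) by (simp add: algebra_simps)
  show ?thesis unfolding gper_def grid_eval_def s e p by simp
qed

text \<open>Shifting all nodes by one multiplies the sum by z = \<open>fexp L k h\<close> but leaves
  it unchanged by periodicity. As 0 < |k| \<le> K < N, the frequency is no multiple of N, so z
  differs from 1 and the sum is zero.\<close>

lemma sum_fexp_grid:
  assumes "L > 0" "\<bar>k\<bar> \<le> int K" "N = 2 * K + 1" "h = L / real N"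
  shows "(\<Sum>i\<in>{1..int N}. fexp L k ((of_int i - 1/2) * h)) = (if k = 0 then of_nat N else 0)"
proof (cases "k = 0")
  case False
  define a where "a = (\<lambda>i. fexp L k ((of_int i - 1/2) * h))"
  define z where "z = fexp L k h"
  have Nh: "real N * h = L" using assms by simp
  have step: "a (i + 1) = z * a i" for i
    unfolding a_def z_def fexp_add_right[symmetric] by (simp add: algebra_simps)
  have "a (i + int N) = a i" for i
  proof -
    have "(of_int (i + int N) - 1/2) * h = (of_int i - 1/2) * h + L"
      using Nh by (simp add: algebra_simps)
    then show ?thesis using assms(1) by (simp add: a_def fexp_add_right fexp_period)
  qed
  then have "(\<Sum>i\<in>{1..int N}. a (i + 1)) = (\<Sum>i\<in>{1..int N}. a i)" by (rule sum_periodic_shift)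
  then have "(z - 1) * (\<Sum>i\<in>{1..int N}. a i) = 0"
    unfolding step sum_distrib_left[symmetric] by (simp add: algebra_simps)
  moreover have "z \<noteq> 1"
  proof
    assume "z = 1"
    then have "cos (2 * pi / L * of_int k * h) = 1" by (simp add: z_def fexp_def complex_eq_iff)
    then obtain n where "2 * pi / L * of_int k * h = of_int n * 2 * pi"
      using cos_one_2pi_int by (auto simp: mult.assoc)
    moreover have "2 * pi / L * of_int k * h = 2 * pi * of_int k / real N" using assms(1,4) by simp
    ultimately have "2 * (pi * of_int k / real N) = 2 * (pi * of_int n)" by (simp add: mult_ac)
    then have "pi * of_int k / real N = pi * of_int n" by simp
    then have "pi * of_int k = pi * of_int n * real N" using assms(3) by (subst (asm) divide_eq_eq) simp
    then have "real_of_int k = of_int (n * int N)" by simp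
    then have kn: "k = n * int N" by (simp only: of_int_eq_iff)
    then have "n \<noteq> 0" using False by auto
    then have "1 * int N \<le> \<bar>n\<bar> * int N" by (intro mult_right_mono) auto
    then have "int N \<le> \<bar>k\<bar>" unfolding kn abs_mult by simp
    then show False using assms(2,3) by linarith
  qed
  ultimately show ?thesis using False by (simp add: a_def)
qed simp

lemma sum_triple_product:
  fixes a b c :: "'i \<Rightarrow> 'a::comm_semiring_1"
  shows "(\<Sum>i\<in>J. a i) * (\<Sum>j\<in>J. b j) * (\<Sum>k\<in>J. c k) = (\<Sum>(i,j,k)\<in>J \<times> J \<times> J. a i * b j * c k)"
proof -
  have p: "sum u A * sum v B = (\<Sum>q\<in>A \<times> B. u (fst q) * v (snd q))" for u :: "'p \<Rightarrow> 'a" and v :: "'q \<Rightarrow> 'a" and A B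
    by (simp add: sum_product sum.cartesian_product case_prod_unfold)
  show ?thesis unfolding mult.assoc unfolding p by (simp add: case_prod_unfold)
qed

text \<open>Midpoint quadrature is exact here: after exchanging the sums only the zero frequency
  survives. It fixes the discrete mass of the initial data and later that of the projected solution,
  with no error term.\<close>

lemma gsum_fourier_proj:
  assumes "L > 0" "N = 2 * K + 1" "h = L / real N"
  shows "gsum N (grid_eval h N (fourier_proj K L f)) = real N ^ 3 * Re (fourier_coeff L f 0 0 0)"
proof -
  define I where "I = {-int K..int K}"
  define J where "J = {1..int N}"
  define e where "e = (\<lambda>k i. fexp L k ((of_int i - 1/2) * h))"
  define t where "t = (\<lambda>i j k. \<Sum>(k1,k2,k3)\<in>I \<times> I \<times> I. fourier_coeff L f k1 k2 k3 * (e k1 i * e k2 j * e k3 k))"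
  have "grid_eval h N (fourier_proj K L f) = (\<lambda>i j k. Re (t i j k))"
    unfolding grid_eval_def fourier_proj_def cis_fexp3 I_def e_def t_def
    by (intro ext arg_cong[where f=Re]) (simp add: sum.cartesian_product case_prod_unfold)
  then have "gsum N (grid_eval h N (fourier_proj K L f)) = Re (\<Sum>(i,j,k)\<in>J \<times> J \<times> J. t i j k)"
    unfolding gsum_def J_def by (simp add: sum.cartesian_product case_prod_unfold)
  then have "gsum N (grid_eval h N (fourier_proj K L f)) = Re (\<Sum>(i,j,k)\<in>J \<times> J \<times> J. \<Sum>(k1,k2,k3)\<in>I \<times> I \<times> I.
      fourier_coeff L f k1 k2 k3 * (e k1 i * e k2 j * e k3 k))"
    unfolding t_def .
  also have "(\<Sum>(i,j,k)\<in>J \<times> J \<times> J. \<Sum>(k1,k2,k3)\<in>I \<times> I \<times> I. fourier_coeff L f k1 k2 k3 * (e k1 i * e k2 j * e k3 k))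
     = (\<Sum>(k1,k2,k3)\<in>I \<times> I \<times> I. \<Sum>(i,j,k)\<in>J \<times> J \<times> J. fourier_coeff L f k1 k2 k3 * (e k1 i * e k2 j * e k3 k))"
    unfolding case_prod_unfold by (rule sum.swap)
  also have "\<dots> = (\<Sum>(k1,k2,k3)\<in>I \<times> I \<times> I. fourier_coeff L f k1 k2 k3 * ((\<Sum>i\<in>J. e k1 i) * (\<Sum>j\<in>J. e k2 j) * (\<Sum>k\<in>J. e k3 k)))"
  proof (intro sum.cong refl, clarify)
    fix k1 k2 k3
    show "(\<Sum>(i,j,k)\<in>J \<times> J \<times> J. fourier_coeff L f k1 k2 k3 * (e k1 i * e k2 j * e k3 k)) =
      fourier_coeff L f k1 k2 k3 * ((\<Sum>i\<in>J. e k1 i) * (\<Sum>j\<in>J. e k2 j) * (\<Sum>k\<in>J. e k3 k))"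
      unfolding sum_triple_product by (simp only: sum_distrib_left case_prod_unfold)
  qed
  also have "\<dots> = (\<Sum>q\<in>I \<times> I \<times> I. if q = (0, 0, 0) then fourier_coeff L f 0 0 0 * of_nat N ^ 3 else 0)"
  proof (intro sum.cong refl)
    fix q assume "q \<in> I \<times> I \<times> I"
    then obtain k1 k2 k3 where q: "q = (k1, k2, k3)" "\<bar>k1\<bar> \<le> int K" "\<bar>k2\<bar> \<le> int K" "\<bar>k3\<bar> \<le> int K"
      by (auto simp: I_def)
    then show "(case q of (k1, k2, k3) \<Rightarrow> fourier_coeff L f k1 k2 k3 * ((\<Sum>i\<in>J. e k1 i) * (\<Sum>j\<in>J. e k2 j) * (\<Sum>k\<in>J. e k3 k)))
      = (if q = (0, 0, 0) then fourier_coeff L f 0 0 0 * of_nat N ^ 3 else 0)"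
      unfolding e_def J_def using sum_fexp_grid[OF assms(1) _ assms(2,3)] by (simp add: power3_eq_cube)
  qed
  also have "\<dots> = fourier_coeff L f 0 0 0 * of_nat N ^ 3"
    by (simp add: I_def)
  also have "Re \<dots> = real N ^ 3 * Re (fourier_coeff L f 0 0 0)"
    by (simp add: power3_eq_cube)
  finally show ?thesis .
qed

section \<open>Consistency for regular solutions\<close>

text \<open>If the whole interval lies in Z, no point constrains B, which might be negative; but
  then the interval is degenerate and both sides are zero. Otherwise a good point shows B \<ge> 0
  and the integrand is changed to 0 on Z.\<close>

lemma integral_bound_off_negligible:
  fixes f :: "real \<Rightarrow> real"
  assumes "f integrable_on {a..b}" "negligible Z" "a \<le> b" "\<And>s. s \<in> {a..b} - Z \<Longrightarrow> \<bar>f s\<bar> \<le> B"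
  shows "\<bar>integral {a..b} f\<bar> \<le> B * (b - a)"
proof -
  define g where "g = (\<lambda>s. if s \<in> Z then 0 else f s)"
  have eq: "integral {a..b} g = integral {a..b} f"
    by (rule integral_spike[OF assms(2)]) (auto simp: g_def)
  have g_int: "g integrable_on {a..b}"
    by (rule integrable_spike[OF assms(1,2)]) (auto simp: g_def)
  show ?thesis
  proof (cases "{a..b} \<subseteq> Z")
    case True
    then have "integral {a..b} g = integral {a..b} (\<lambda>_. 0)"
      by (intro Henstock_Kurzweil_Integration.integral_cong) (auto simp: g_def)
    moreover have "b - a = 0"
    proof (rule ccontr)
      assume "b - a \<noteq> 0"
      then have "\<not> negligible {a..b}" using assms(3) negligible_interval(1)[of a b] by (simp add: box_real)
      then show False using negligible_subset[OF assms(2) True] by simp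
    qed
    ultimately show ?thesis using eq by simp
  next
    case False
    then obtain s where "s \<in> {a..b} - Z" by blast
    then have "0 \<le> B" using assms(4)[of s] by linarith
    then have "norm (integral {a..b} g) \<le> integral {a..b} (\<lambda>_. B)"
      using assms(4) g_int by (intro Henstock_Kurzweil_Integration.integral_norm_bound_integral) (auto simp: g_def)
    then show ?thesis using eq assms(3) by (simp add: mult.commute)
  qed
qed

lemma glap_grid_eval_has_integral:
  assumes "\<And>x. (\<lambda>s. F s x) integrable_on {a..b}"
  shows "((\<lambda>s. glap h (grid_eval h N (F s)) i j k) has_integral
     glap h (grid_eval h N (\<lambda>x. integral {a..b} (\<lambda>s. F s x))) i j k) {a..b}"
  unfolding glap_def grid_eval_def using assms
  by (intro has_integral_divide has_integral_add has_integral_diff has_integral_mult_right integrable_integral)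

lemma log_difference_lipschitz:
  fixes a b d :: real
  assumes "d > 0" "\<bar>a\<bar> \<le> 1 - d" "\<bar>b\<bar> \<le> 1 - d"
  shows "\<bar>(ln (1 + a) - ln (1 - a)) - (ln (1 + b) - ln (1 - b))\<bar> \<le> 2 / d * \<bar>a - b\<bar>"
proof -
  have "\<bar>ln x - ln y\<bar> \<le> 1 / d * \<bar>x - y\<bar>" if "x \<ge> d" "y \<ge> d" for x y :: real
  proof -
    have "norm (ln x - ln y) \<le> 1 / d * norm (x - y)"
    proof (rule field_differentiable_bound[of "{d..}" ln "\<lambda>z. 1 / z"])
      show "(ln has_field_derivative 1 / z) (at z within {d..})" if "z \<in> {d..}" for z
        using that assms(1) by (auto intro!: derivative_eq_intros)
      show "norm (1 / z) \<le> 1 / d" if "z \<in> {d..}" for z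
        using that assms(1) by (auto intro!: divide_left_mono simp: abs_div_pos)
    qed (use that in auto)
    then show ?thesis by simp
  qed
  from this[of "1 + a" "1 + b"] this[of "1 - b" "1 - a"] assms show ?thesis by (simp add: abs_le_iff)
qed

text \<open>The interface between the weak formulation and the numerical analysis. Derivative bounds
  are claimed only at times off the null set Z, whereas continuity, periodicity and the distance
  \<delta> from the singular values hold at every time. The equation itself enters only in
  integrated form, as \<open>increment\<close>.\<close>

locale CH_regular =
  fixes eps theta0 L T C \<delta> :: real and \<Phi> :: "real \<Rightarrow> field3" and Z :: "real set"
  assumes pos: "eps > 0" "theta0 > 0" "L > 0" "T > 0" "\<delta> > 0"
    and negl: "negligible Z"
    and Phi_CkB: "\<And>s. s \<in> {0..T} - Z \<Longrightarrow> CkB 6 C (\<Phi> s)"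
    and mu_CkB: "\<And>s. s \<in> {0..T} - Z \<Longrightarrow> CkB 4 C (CH_mu eps theta0 (\<Phi> s))"
    and Phi_bound: "\<And>t x. t \<in> {0..T} \<Longrightarrow> \<bar>\<Phi> t x\<bar> \<le> 1 - \<delta>"
    and Phi_per: "\<And>t. t \<in> {0..T} \<Longrightarrow> periodic3 L (\<Phi> t)"
    and Phi_cont: "\<And>t. t \<in> {0..T} \<Longrightarrow> continuous_on UNIV (\<Phi> t)"
    and mu_int: "\<And>a b x. 0 \<le> a \<Longrightarrow> a \<le> b \<Longrightarrow> b \<le> T \<Longrightarrow> (\<lambda>s. CH_mu eps theta0 (\<Phi> s) x) integrable_on {a..b}"
    and lapl_int: "\<And>a b x. 0 \<le> a \<Longrightarrow> a \<le> b \<Longrightarrow> b \<le> T \<Longrightarrow> (\<lambda>s. lapl (CH_mu eps theta0 (\<Phi> s)) x) integrable_on {a..b}"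
    and increment: "\<And>a b x. 0 \<le> a \<Longrightarrow> a \<le> b \<Longrightarrow> b \<le> T \<Longrightarrow>
        \<Phi> b x - \<Phi> a x = integral {a..b} (\<lambda>s. lapl (CH_mu eps theta0 (\<Phi> s)) x)"
begin

abbreviation "mu s \<equiv> CH_mu eps theta0 (\<Phi> s)"

lemma good_dense:
  assumes "t \<in> {0..T}" "e > 0"
  shows "\<exists>s\<in>{0..T} - Z. \<bar>t - s\<bar> < e"
proof (rule ccontr)
  assume "\<not> ?thesis"
  then have far: "x \<in> Z" if "x \<in> {0..T}" "\<bar>t - x\<bar> < e" for x using that by blast
  have sub: "{max 0 (t - e)<..<min T (t + e)} \<subseteq> Z"
    by (intro subsetI far) (auto simp: abs_less_iff)
  have "max 0 (t - e) < min T (t + e)" using assms pos by (auto simp: max_def min_def)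
  then have "\<not> negligible {max 0 (t - e)<..<min T (t + e)}"
    by (intro open_not_negligible) auto
  then show False using negligible_subset[OF negl sub] by simp
qed

lemma C_nonneg: "0 \<le> C"
  using good_dense[of 0 1] pos Phi_CkB CkB_bound_nonneg by fastforce

lemma lapl_mu_CkB: "s \<in> {0..T} - Z \<Longrightarrow> CkB 2 (3 * C) (lapl (mu s))"
  using CkB_lapl[of 2 C "mu s"] mu_CkB[of s] by simp

lemma Phi_lipschitz:
  assumes "s \<in> {0..T}" "t \<in> {0..T}"
  shows "\<bar>\<Phi> t x - \<Phi> s x\<bar> \<le> 3 * C * \<bar>t - s\<bar>"
proof -
  have "\<bar>\<Phi> b x - \<Phi> a x\<bar> \<le> 3 * C * (b - a)" if "0 \<le> a" "a \<le> b" "b \<le> T" for a b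
    unfolding increment[OF that]
    by (rule integral_bound_off_negligible[OF lapl_int[OF that] negl that(2)])
      (use that CkB_bound[OF lapl_mu_CkB] in auto)
  from this[of s t] this[of t s] assms show ?thesis by (cases "s \<le> t") auto
qed

text \<open>The discrete Laplacian commutes with the time integral, and applied to \<Delta>\<mu> it
  is bounded uniformly in h by second derivatives. Two derivatives in \<mu>, two in \<Delta>\<mu>
  and two here account for the six derivatives of \<Phi>; the 9 is 3 directions times the bound
  3C.\<close>

lemma glap_Phi_lipschitz:
  assumes "s \<in> {0..T}" "t \<in> {0..T}" "h > 0"
  shows "\<bar>glap h (grid_eval h N (\<Phi> t)) i j k - glap h (grid_eval h N (\<Phi> s)) i j k\<bar> \<le> 9 * C * \<bar>t - s\<bar>"
proof -
  have "\<bar>glap h (grid_eval h N (\<Phi> b)) i j k - glap h (grid_eval h N (\<Phi> a)) i j k\<bar> \<le> 9 * C * (b - a)"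
    if ab: "0 \<le> a" "a \<le> b" "b \<le> T" for a b
  proof -
    let ?I = "\<lambda>x. integral {a..b} (\<lambda>s. lapl (mu s) x)"
    have hi: "((\<lambda>s. glap h (grid_eval h N (lapl (mu s))) i j k) has_integral glap h (grid_eval h N ?I) i j k) {a..b}"
      by (intro glap_grid_eval_has_integral lapl_int ab)
    have "grid_eval h N ?I = (\<lambda>i j k. grid_eval h N (\<Phi> b) i j k - grid_eval h N (\<Phi> a) i j k)"
      unfolding grid_eval_def by (simp only: increment[OF ab])
    then have "glap h (grid_eval h N (\<Phi> b)) i j k - glap h (grid_eval h N (\<Phi> a)) i j k = glap h (grid_eval h N ?I) i j k"
      by (simp add: glap_diff)
    also have "\<dots> = integral {a..b} (\<lambda>s. glap h (grid_eval h N (lapl (mu s))) i j k)"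
      using hi by (rule integral_unique[symmetric])
    also have "\<bar>\<dots>\<bar> \<le> 9 * C * (b - a)"
    proof (rule integral_bound_off_negligible[OF has_integral_integrable[OF hi] negl ab(2)])
      fix s assume "s \<in> {a..b} - Z"
      then show "\<bar>glap h (grid_eval h N (lapl (mu s))) i j k\<bar> \<le> 9 * C"
        using glap_grid_eval_bound[OF lapl_mu_CkB[of s] assms(3)] ab by auto
    qed
    finally show ?thesis .
  qed
  from this[of s t] this[of t s] assms show ?thesis by (cases "s \<le> t") auto
qed

text \<open>The increment of \<Phi> is exactly the Laplacian of this field, so replacing that
  Laplacian by the discrete one costs h^2 and no error in time. All of the time discretisation error
  is left to the comparison of its average with \<open>disc_mu\<close>.\<close>

definition mu_integral :: "real \<Rightarrow> real \<Rightarrow> field3" where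
  "mu_integral a b x = integral {a..b} (\<lambda>s. mu s x)"

lemma mu_per: "t \<in> {0..T} \<Longrightarrow> periodic3 L (mu t)"
  using Phi_per[of t] periodic3_pd[OF periodic3_pd[OF Phi_per]]
  unfolding CH_mu_def lapl_def periodic3_def by simp

lemma mu_integral_per:
  assumes "0 \<le> a" "b \<le> T" shows "periodic3 L (mu_integral a b)"
  unfolding periodic3_def mu_integral_def
proof (intro allI Henstock_Kurzweil_Integration.integral_cong)
  fix i x s assume "s \<in> {a..b}"
  then show "mu s (x + L *\<^sub>R axis i 1) = mu s x" using mu_per[of s] assms by (simp add: periodic3_def)
qed

lemma increment_consistent:
  assumes "0 \<le> a" "a \<le> b" "b \<le> T" "h > 0"
  shows "\<bar>(grid_eval h N (\<Phi> b) i j k - grid_eval h N (\<Phi> a) i j k) - glap h (grid_eval h N (mu_integral a b)) i j k\<bar>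
    \<le> 3 * C * h\<^sup>2 * (b - a)"
proof -
  note ab = assms(1-3)
  have hi: "((\<lambda>s. glap h (grid_eval h N (mu s)) i j k) has_integral glap h (grid_eval h N (mu_integral a b)) i j k) {a..b}"
    unfolding mu_integral_def by (intro glap_grid_eval_has_integral mu_int ab)
  have hl: "((\<lambda>s. grid_eval h N (lapl (mu s)) i j k) has_integral (grid_eval h N (\<Phi> b) i j k - grid_eval h N (\<Phi> a) i j k)) {a..b}"
    unfolding grid_eval_def increment[OF ab] by (intro integrable_integral lapl_int ab)
  have "\<bar>integral {a..b} (\<lambda>s. grid_eval h N (lapl (mu s)) i j k - glap h (grid_eval h N (mu s)) i j k)\<bar> \<le> 3 * C * h\<^sup>2 * (b - a)"
  proof (rule integral_bound_off_negligible[OF has_integral_integrable[OF has_integral_diff[OF hl hi]] negl ab(2)])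
    fix s assume "s \<in> {a..b} - Z"
    then show "\<bar>grid_eval h N (lapl (mu s)) i j k - glap h (grid_eval h N (mu s)) i j k\<bar> \<le> 3 * C * h\<^sup>2"
      using glap_grid_eval_consistent[OF mu_CkB[of s] assms(4), of N i j k] ab by (auto simp: abs_minus_commute)
  qed
  then show ?thesis unfolding integral_unique[OF has_integral_diff[OF hl hi]] .
qed

text \<open>\<mu>(s) is compared with the discrete potential at each s in the step and the
  difference is averaged: the logarithms are frozen at the new time, the theta0 term at the old one.
  The shift is at most \<delta>/2, so half the margin remains and the Lipschitz constant is
  2/(\<delta>/2) = 4/\<delta>; constants do not affect the discrete Laplacian.\<close>

lemma disc_mu_consistent:
  assumes ab: "0 \<le> a" "a < b" "b \<le> T" and h: "h > 0"
    and c: "\<bar>c0\<bar> \<le> \<gamma>" "\<bar>c1\<bar> \<le> \<gamma>" "\<gamma> \<le> \<delta> / 2"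
    and W: "W0 = (\<lambda>i j k. grid_eval h N (\<Phi> a) i j k - c0)" "W1 = (\<lambda>i j k. grid_eval h N (\<Phi> b) i j k - c1)"
  shows "\<bar>grid_eval h N (mu_integral a b) i j k / (b - a) - disc_mu eps theta0 h W0 W1 i j k\<bar>
    \<le> (4 / \<delta> + theta0) * (3 * C * (b - a) + \<gamma>) + eps\<^sup>2 * (3 * C * h\<^sup>2 + 9 * C * (b - a))"
proof -
  define B where "B = (4 / \<delta> + theta0) * (3 * C * (b - a) + \<gamma>) + eps\<^sup>2 * (3 * C * h\<^sup>2 + 9 * C * (b - a))"
  define D where "D = disc_mu eps theta0 h W0 W1 i j k"
  define x where "x = cell_center h i j k"
  have C: "0 \<le> C" by (rule C_nonneg)
  have \<gamma>: "0 \<le> \<gamma>" using c(1) by linarith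
  have int: "(\<lambda>s. mu s x - D) integrable_on {a..b}"
    using mu_int[of a b x] ab by (intro integrable_diff) auto
  have "\<bar>integral {a..b} (\<lambda>s. mu s x - D)\<bar> \<le> B * (b - a)"
  proof (rule integral_bound_off_negligible[OF int negl])
    fix s assume s: "s \<in> {a..b} - Z"
    then have sT: "s \<in> {0..T}" "a \<in> {0..T}" "b \<in> {0..T}" "s \<in> {0..T} - Z" using ab by auto
    have l1: "\<bar>\<Phi> s x - \<Phi> b x\<bar> \<le> 3 * C * (b - a)"
      using Phi_lipschitz[OF sT(3,1), of x] s C mult_left_mono[of "\<bar>s - b\<bar>" "b - a" "3 * C"] by auto
    have l0: "\<bar>\<Phi> s x - \<Phi> a x\<bar> \<le> 3 * C * (b - a)"
      using Phi_lipschitz[OF sT(2,1), of x] s C mult_left_mono[of "\<bar>s - a\<bar>" "b - a" "3 * C"] by auto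
    have log: "\<bar>(ln (1 + \<Phi> s x) - ln (1 - \<Phi> s x)) - (ln (1 + (\<Phi> b x - c1)) - ln (1 - (\<Phi> b x - c1)))\<bar>
        \<le> 4 / \<delta> * (3 * C * (b - a) + \<gamma>)"
    proof -
      have "\<bar>\<Phi> s x\<bar> \<le> 1 - \<delta> / 2" "\<bar>\<Phi> b x - c1\<bar> \<le> 1 - \<delta> / 2"
        using Phi_bound[OF sT(1), of x] Phi_bound[OF sT(3), of x] c pos(5) by linarith+
      then have "\<bar>(ln (1 + \<Phi> s x) - ln (1 - \<Phi> s x)) - (ln (1 + (\<Phi> b x - c1)) - ln (1 - (\<Phi> b x - c1)))\<bar>
        \<le> 2 / (\<delta> / 2) * \<bar>\<Phi> s x - (\<Phi> b x - c1)\<bar>"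
        using pos(5) by (intro log_difference_lipschitz) auto
      also have "\<dots> = 4 / \<delta> * \<bar>\<Phi> s x - (\<Phi> b x - c1)\<bar>" by simp
      also have "\<dots> \<le> 4 / \<delta> * (3 * C * (b - a) + \<gamma>)"
        using l1 c pos(5) by (intro mult_left_mono) auto
      finally show ?thesis .
    qed
    have th: "\<bar>theta0 * \<Phi> s x - theta0 * (\<Phi> a x - c0)\<bar> \<le> theta0 * (3 * C * (b - a) + \<gamma>)"
    proof -
      have "\<bar>theta0 * \<Phi> s x - theta0 * (\<Phi> a x - c0)\<bar> = theta0 * \<bar>\<Phi> s x - (\<Phi> a x - c0)\<bar>"
        using pos(2) by (simp add: right_diff_distrib[symmetric] abs_mult)
      also have "\<dots> \<le> theta0 * (3 * C * (b - a) + \<gamma>)"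
        using l0 c pos(2) by (intro mult_left_mono) auto
      finally show ?thesis .
    qed
    have lap: "\<bar>eps\<^sup>2 * lapl (\<Phi> s) x - eps\<^sup>2 * glap h W1 i j k\<bar> \<le> eps\<^sup>2 * (3 * C * h\<^sup>2 + 9 * C * (b - a))"
    proof -
      have "CkB 4 C (\<Phi> s)" using CkB_lower[OF Phi_CkB[OF sT(4)], of 4] by simp
      then have "\<bar>glap h (grid_eval h N (\<Phi> s)) i j k - lapl (\<Phi> s) x\<bar> \<le> 3 * C * h\<^sup>2"
        using glap_grid_eval_consistent[of C "\<Phi> s" h N i j k] h by (simp add: grid_eval_def x_def)
      moreover have "\<bar>glap h (grid_eval h N (\<Phi> s)) i j k - glap h (grid_eval h N (\<Phi> b)) i j k\<bar> \<le> 9 * C * (b - a)"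
        using glap_Phi_lipschitz[OF sT(3,1) h, of N i j k] s C mult_left_mono[of "\<bar>s - b\<bar>" "b - a" "9 * C"] by auto
      moreover have "glap h W1 i j k = glap h (grid_eval h N (\<Phi> b)) i j k"
        unfolding W glap_diff glap_const by simp
      ultimately have "\<bar>lapl (\<Phi> s) x - glap h W1 i j k\<bar> \<le> 3 * C * h\<^sup>2 + 9 * C * (b - a)" by linarith
      then show ?thesis
        unfolding right_diff_distrib[symmetric] abs_mult by (simp add: mult_left_mono)
    qed
    have "W0 i j k = \<Phi> a x - c0" "W1 i j k = \<Phi> b x - c1" unfolding W grid_eval_def x_def by simp_all
    then have "mu s x - D = ((ln (1 + \<Phi> s x) - ln (1 - \<Phi> s x)) - (ln (1 + (\<Phi> b x - c1)) - ln (1 - (\<Phi> b x - c1))))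
        - (theta0 * \<Phi> s x - theta0 * (\<Phi> a x - c0)) - (eps\<^sup>2 * lapl (\<Phi> s) x - eps\<^sup>2 * glap h W1 i j k)"
      unfolding D_def disc_mu_def CH_mu_def by simp
    moreover have "B = 4 / \<delta> * (3 * C * (b - a) + \<gamma>) + theta0 * (3 * C * (b - a) + \<gamma>) + eps\<^sup>2 * (3 * C * h\<^sup>2 + 9 * C * (b - a))"
      unfolding B_def by (simp only: distrib_right)
    ultimately show "\<bar>mu s x - D\<bar> \<le> B" using log th lap by linarith
  qed (use ab in simp)
  moreover have "integral {a..b} (\<lambda>s. mu s x - D) = mu_integral a b x - D * (b - a)"
    unfolding mu_integral_def using mu_int[of a b x] ab by (subst integral_diff) auto
  ultimately have "\<bar>mu_integral a b x - D * (b - a)\<bar> / (b - a) \<le> B" using ab by (simp add: divide_le_eq)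
  moreover have "mu_integral a b x / (b - a) - D = (mu_integral a b x - D * (b - a)) / (b - a)"
    using ab by (simp add: field_simps)
  moreover have "grid_eval h N (mu_integral a b) i j k = mu_integral a b x" by (simp add: grid_eval_def x_def)
  ultimately show ?thesis using ab unfolding B_def[symmetric] D_def[symmetric] by (simp add: abs_divide)
qed

section \<open>Projection error at all times and conservation of the mean\<close>

text \<open>At an exceptional time no derivative bound is available. The estimate is taken at a
  nearby good time and transferred by Lipschitz continuity in time and stability of the projection
  for this fixed K.\<close>

lemma proj_error:
  assumes t: "t \<in> {0..T}" and K: "K \<ge> 1"
  shows "\<bar>fourier_proj K L (\<Phi> t) x - \<Phi> t x\<bar> \<le> 26 * C / (2 * pi / L) ^ 6 / real K ^ 3"
proof (rule field_le_epsilon)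
  fix e :: real assume e: "e > 0"
  define n where "n = real (2 * K + 1) ^ 3"
  have n: "0 \<le> n" by (simp add: n_def)
  \<comment> \<open>Makes the transfer error (n + 1) 3 C d at most e; using 3C + 1 avoids a zero
    denominator when C = 0.\<close>
  define d where "d = e / ((n + 1) * (3 * C + 1))"
  have d: "d > 0" using e n C_nonneg by (simp add: d_def)
  obtain s where s: "s \<in> {0..T} - Z" "\<bar>t - s\<bar> < d" using good_dense[OF t d] by blast
  have sT: "s \<in> {0..T}" using s by simp
  have close: "\<bar>\<Phi> t y - \<Phi> s y\<bar> \<le> 3 * C * d" for y
    using Phi_lipschitz[OF sT t, of y] s C_nonneg mult_left_mono[of "\<bar>t - s\<bar>" d "3 * C"] by simp
  have "\<bar>fourier_proj K L (\<Phi> t) x - fourier_proj K L (\<Phi> s) x\<bar> \<le> n * (3 * C * d)"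
    unfolding n_def by (intro fourier_proj_stable Phi_cont t sT pos close)
  moreover have "\<bar>\<Phi> s x - fourier_proj K L (\<Phi> s) x\<bar> \<le> 26 * C / (2 * pi / L) ^ 6 / real K ^ 3"
    by (intro fourier_proj_error Phi_CkB Phi_per s sT pos K)
  ultimately have "\<bar>fourier_proj K L (\<Phi> t) x - \<Phi> t x\<bar> \<le> 26 * C / (2 * pi / L) ^ 6 / real K ^ 3 + (n * (3 * C * d) + 3 * C * d)"
    using close[of x] by linarith
  also have "n * (3 * C * d) + 3 * C * d = (n + 1) * (3 * C) * d" by (simp add: algebra_simps)
  also have "\<dots> \<le> (n + 1) * (3 * C + 1) * d" using n d C_nonneg by (intro mult_right_mono mult_left_mono) auto
  also have "\<dots> = e" using n C_nonneg by (simp add: d_def)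
  finally show "\<bar>fourier_proj K L (\<Phi> t) x - \<Phi> t x\<bar> \<le> 26 * C / (2 * pi / L) ^ 6 / real K ^ 3 + e" by simp
qed

text \<open>The factor 27 / L^3 converts powers of 1/K into powers of h, by 1/K \<le> 3/(2K + 1) =
  3h/L for K \<ge> 1.\<close>

definition proj_const where "proj_const = 27 / L ^ 3 * (26 * C / (2 * pi / L) ^ 6)"

lemma proj_const_nonneg: "0 \<le> proj_const"
  using C_nonneg pos by (simp add: proj_const_def)

lemma proj_error_h:
  assumes t: "t \<in> {0..T}" and K: "K \<ge> 1" and h: "h = L / real (2 * K + 1)"
  shows "\<bar>fourier_proj K L (\<Phi> t) x - \<Phi> t x\<bar> \<le> proj_const * h ^ 3"
proof -
  have "1 / real K \<le> 3 / real (2 * K + 1)" using K by (simp add: field_simps)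
  also have "\<dots> = 3 * h / L" using pos(3) unfolding h by simp
  finally have "1 / real K \<le> 3 * h / L" .
  then have "(1 / real K) ^ 3 \<le> (3 * h / L) ^ 3" by (intro power_mono) auto
  then have "26 * C / (2 * pi / L) ^ 6 * (1 / real K) ^ 3 \<le> 26 * C / (2 * pi / L) ^ 6 * (3 * h / L) ^ 3"
    using C_nonneg pos by (intro mult_left_mono) auto
  also have "\<dots> = proj_const * h ^ 3" by (simp add: proj_const_def power_mult_distrib power_divide mult_ac)
  finally show ?thesis using proj_error[OF t K, of x] by (simp add: power_divide)
qed

definition mean where "mean t = Re (fourier_coeff L (\<Phi> t) 0 0 0)"

lemma grid_mean:
  assumes t: "t \<in> {0..T}" and K: "K \<ge> 1" and N: "N = 2 * K + 1" and h: "h = L / real N"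
  shows "\<bar>gsum N (grid_eval h N (\<Phi> t)) / real N ^ 3 - mean t\<bar> \<le> proj_const * h ^ 3"
proof -
  have "\<bar>gsum N (grid_eval h N (\<Phi> t)) - gsum N (grid_eval h N (fourier_proj K L (\<Phi> t)))\<bar> \<le> real N ^ 3 * (proj_const * h ^ 3)"
  proof -
    define r where "r = (\<lambda>i j k. grid_eval h N (\<Phi> t) i j k - grid_eval h N (fourier_proj K L (\<Phi> t)) i j k)"
    have "\<bar>r i j k\<bar> \<le> proj_const * h ^ 3" for i j k
      using proj_error_h[OF t K, of h] N h by (simp add: r_def grid_eval_def abs_minus_commute)
    then have "- (proj_const * h ^ 3) \<le> r i j k" "r i j k \<le> proj_const * h ^ 3" for i j k by (simp_all add: abs_le_iff minus_le_iff)
    then have "gsum N (\<lambda>i j k. - (proj_const * h ^ 3)) \<le> gsum N r" "gsum N r \<le> gsum N (\<lambda>i j k. proj_const * h ^ 3)"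
      by (intro gsum_mono; blast)+
    then show ?thesis unfolding r_def gsum_diff gsum_const by (simp add: abs_le_iff)
  qed
  then have "\<bar>gsum N (grid_eval h N (\<Phi> t)) - real N ^ 3 * mean t\<bar> \<le> real N ^ 3 * (proj_const * h ^ 3)"
    unfolding gsum_fourier_proj[OF pos(3) N h] mean_def .
  moreover have N3: "real N ^ 3 > 0" using N by simp
  moreover have "gsum N (grid_eval h N (\<Phi> t)) / real N ^ 3 - mean t = (gsum N (grid_eval h N (\<Phi> t)) - real N ^ 3 * mean t) / real N ^ 3"
    using N3 by (simp add: diff_divide_distrib)
  ultimately show ?thesis by (simp add: abs_divide divide_le_eq mult.commute)
qed

text \<open>The grid sum of a discrete Laplacian vanishes, so the discrete means at different times differ by the
  consistency error only; refining the grid gives exact conservation of the continuous mean.\<close>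
lemma mean_conserved:
  assumes "t \<in> {0..T}" shows "mean t = mean 0"
proof -
  have "\<bar>mean t - mean 0\<bar> \<le> 0"
  proof (rule LIMSEQ_le_const)
    define h where "h = (\<lambda>K. L / real (2 * K + 1))"
    have h_lim: "h \<longlonglongrightarrow> 0"
    proof (rule tendsto_sandwich[OF _ _ tendsto_const tendsto_mult_right_zero[OF LIMSEQ_inverse_real_of_nat, of L]])
      show "eventually (\<lambda>K. 0 \<le> h K) sequentially" using pos by (simp add: h_def)
      show "eventually (\<lambda>K. h K \<le> L * inverse (real (Suc K))) sequentially"
        using pos by (intro always_eventually allI) (simp add: h_def divide_inverse le_imp_inverse_le)
    qed
    have "(\<lambda>K. 2 * (proj_const * h K ^ 3) + 3 * C * (h K)\<^sup>2 * t) \<longlonglongrightarrow> 2 * (proj_const * 0 ^ 3) + 3 * C * 0\<^sup>2 * t"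
      by (intro tendsto_intros h_lim)
    then show "(\<lambda>K. 2 * (proj_const * h K ^ 3) + 3 * C * (h K)\<^sup>2 * t) \<longlonglongrightarrow> 0" by simp
    show "\<exists>K0. \<forall>K\<ge>K0. \<bar>mean t - mean 0\<bar> \<le> 2 * (proj_const * h K ^ 3) + 3 * C * (h K)\<^sup>2 * t"
    proof (intro exI[of _ 1] allI impI)
      fix K :: nat assume K: "K \<ge> 1"
      define N where "N = 2 * K + 1"
      have hK: "h K = L / real N" "h K > 0" "h K * real N = L" using pos by (simp_all add: h_def N_def)
      define d where "d = (\<lambda>i j k. (grid_eval (h K) N (\<Phi> t) i j k - grid_eval (h K) N (\<Phi> 0) i j k)
          - glap (h K) (grid_eval (h K) N (mu_integral 0 t)) i j k)"
      have t: "0 \<le> t" "t \<le> T" using assms by auto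
      have bd: "\<bar>d i j k\<bar> \<le> 3 * C * (h K)\<^sup>2 * t" for i j k
        unfolding d_def using increment_consistent[of 0 t "h K" N i j k] t hK by simp
      then have "- (3 * C * (h K)\<^sup>2 * t) \<le> d i j k" "d i j k \<le> 3 * C * (h K)\<^sup>2 * t" for i j k
        using bd[of i j k] by linarith+
      then have "gsum N (\<lambda>i j k. - (3 * C * (h K)\<^sup>2 * t)) \<le> gsum N d" "gsum N d \<le> gsum N (\<lambda>i j k. 3 * C * (h K)\<^sup>2 * t)"
        by (intro gsum_mono; blast)+
      then have gd: "\<bar>gsum N d\<bar> \<le> real N ^ 3 * (3 * C * (h K)\<^sup>2 * t)" unfolding gsum_const by (simp add: abs_le_iff)
      have "gper N (grid_eval (h K) N (mu_integral 0 t))"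
        using t hK by (intro gper_grid_eval[OF mu_integral_per]) auto
      then have "gsum N d = gsum N (grid_eval (h K) N (\<Phi> t)) - gsum N (grid_eval (h K) N (\<Phi> 0))"
        unfolding d_def gsum_diff using gsum_glap hK(2) by simp
      moreover have N3: "real N ^ 3 > 0" by (simp add: N_def)
      ultimately have "\<bar>gsum N (grid_eval (h K) N (\<Phi> t)) / real N ^ 3 - gsum N (grid_eval (h K) N (\<Phi> 0)) / real N ^ 3\<bar> \<le> 3 * C * (h K)\<^sup>2 * t"
        using gd by (simp add: diff_divide_distrib[symmetric] abs_divide divide_le_eq mult.commute)
      then show "\<bar>mean t - mean 0\<bar> \<le> 2 * (proj_const * h K ^ 3) + 3 * C * (h K)\<^sup>2 * t"
        using grid_mean[OF assms K N_def hK(1)] grid_mean[OF _ K N_def hK(1), of 0] pos by auto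
    qed
  qed
  then show ?thesis by simp
qed

end

section \<open>Weak time derivatives\<close>

text \<open>A class of functions containing a derivative of each of its members consists of smooth
  functions; no formula for the iterated \<open>deriv\<close> in \<open>test_fun\<close> is
  required.\<close>

lemma smooth_coinduct:
  assumes "\<psi> \<in> P" "\<And>f. f \<in> P \<Longrightarrow> \<exists>g\<in>P. \<forall>t. (f has_real_derivative g t) (at t)"
  shows "((deriv ^^ n) \<psi>) differentiable (at t)"
proof -
  have "(deriv ^^ n) \<psi> \<in> P"
  proof (induction n)
    case (Suc n)
    then obtain g where g: "g \<in> P" "\<And>t. ((deriv ^^ n) \<psi> has_real_derivative g t) (at t)" using assms(2) by blast
    then have "deriv ((deriv ^^ n) \<psi>) = g" by (intro ext DERIV_imp_deriv)
    then show ?case using g(1) by simp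
  qed (use assms in simp)
  then show ?thesis using assms(2) real_differentiable_def by blast
qed

text \<open>The functions t^-n exp(-1/t), extended by zero: the shapes that arise on differentiating
  the standard flat function n = 0.\<close>

definition flat_exp :: "nat \<Rightarrow> real \<Rightarrow> real" where
  "flat_exp n t = (if t > 0 then (1 / t) ^ n * exp (- (1 / t)) else 0)"

lemma power_le_exp:
  assumes "0 \<le> x" shows "x ^ n \<le> fact n * exp (x :: real)"
proof -
  have "x ^ n /\<^sub>R fact n \<le> exp x"
    unfolding exp_def using sum_le_suminf[OF summable_exp_generic[of x], of "{n}"] assms by simp
  then show ?thesis by (simp add: field_simps)
qed

text \<open>From x^(n+2) \<le> (n+2)! exp x at x = 1/t. A quadratic bound is what makes the
  difference quotient at 0 tend to zero.\<close>

lemma flat_exp_le: "\<bar>flat_exp n t\<bar> \<le> fact (n + 2) * t\<^sup>2"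
proof (cases "t > 0")
  case True
  have "(1 / t) ^ (n + 2) \<le> fact (n + 2) * exp (1 / t)" using True by (intro power_le_exp) simp
  then have "(1 / t) ^ n * exp (- (1 / t)) \<le> fact (n + 2) * t\<^sup>2"
    using True by (simp add: exp_minus power_add field_simps power2_eq_square del: fact_Suc)
  then show ?thesis using True by (simp add: flat_exp_def del: fact_Suc)
qed (simp add: flat_exp_def)

lemma flat_exp_deriv:
  "(flat_exp n has_real_derivative (flat_exp (n + 2) t - real n * flat_exp (n + 1) t)) (at t)"
proof -
  consider "t > 0" | "t < 0" | "t = 0" by linarith
  then show ?thesis
  proof cases
    case 1
    have inv: "((\<lambda>t. 1 / t) has_real_derivative - ((1 / t)\<^sup>2)) (at t)"
      using 1 by (auto intro!: derivative_eq_intros simp: power2_eq_square)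
    have "real n * (- (x\<^sup>2) * x ^ (n - Suc 0)) = - real n * x ^ (n + 1)" for x :: real
      by (cases n) (simp_all add: power2_eq_square algebra_simps)
    from this[of "1 / t"]
    have pow: "((\<lambda>t. (1 / t) ^ n) has_real_derivative - real n * (1 / t) ^ (n + 1)) (at t)"
      using DERIV_power[OF inv, of n] by simp
    have "((\<lambda>t. exp (- (1 / t))) has_real_derivative exp (- (1 / t)) * (1 / t)\<^sup>2) (at t)"
      using DERIV_chain2[OF DERIV_exp DERIV_minus[OF inv]] by simp
    from DERIV_mult[OF pow this]
    have "((\<lambda>t. (1 / t) ^ n * exp (- (1 / t))) has_real_derivative (flat_exp (n + 2) t - real n * flat_exp (n + 1) t)) (at t)"
      by (rule DERIV_cong) (use 1 in \<open>simp add: flat_exp_def power_add power2_eq_square algebra_simps\<close>)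
    then show ?thesis
      by (rule has_field_derivative_transform_within_open[where S="{0<..}"]) (use 1 in \<open>auto simp: flat_exp_def\<close>)
  next
    case 2
    have "((\<lambda>t. 0) has_real_derivative (flat_exp (n + 2) t - real n * flat_exp (n + 1) t)) (at t)"
      using 2 by (simp add: flat_exp_def)
    then show ?thesis
      by (rule has_field_derivative_transform_within_open[where S="{..<0}"]) (use 2 in \<open>auto simp: flat_exp_def\<close>)
  next
    case 3
    have "((\<lambda>h. flat_exp n h / h) \<longlongrightarrow> 0) (at 0)"
    proof (rule Lim_null_comparison)
      show "eventually (\<lambda>h. norm (flat_exp n h / h) \<le> fact (n + 2) * \<bar>h\<bar>) (at 0)"
        unfolding eventually_at_filter
      proof (intro always_eventually allI impI)
        fix h :: real assume "h \<noteq> 0"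
        then show "norm (flat_exp n h / h) \<le> fact (n + 2) * \<bar>h\<bar>"
          using flat_exp_le[of n h] by (simp add: abs_divide divide_le_eq power2_eq_square abs_mult_self_eq mult.assoc del: fact_Suc)
      qed
      show "((\<lambda>h::real. fact (n + 2) * \<bar>h\<bar>) \<longlongrightarrow> 0) (at 0)"
        by (intro tendsto_mult_right_zero tendsto_rabs_zero tendsto_ident_at)
    qed
    then show ?thesis unfolding 3 DERIV_def by (simp add: flat_exp_def)
  qed
qed

definition bump :: "real \<Rightarrow> real" where
  "bump t = flat_exp 0 t * flat_exp 0 (1 - t)"

text \<open>The class fed to \<open>smooth_coinduct\<close>: at a fixed scale d, the derivative of a
  generator is a combination of four generators with raised exponents.\<close>

inductive_set bumps :: "real \<Rightarrow> (real \<Rightarrow> real) set" for d where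
  base: "(\<lambda>t. flat_exp n ((t - a) / d) * flat_exp m (1 - (t - a) / d)) \<in> bumps d"
| add: "u \<in> bumps d \<Longrightarrow> v \<in> bumps d \<Longrightarrow> (\<lambda>t. u t + v t) \<in> bumps d"
| cmult: "u \<in> bumps d \<Longrightarrow> (\<lambda>t. c * u t) \<in> bumps d"

lemma bumps_deriv:
  assumes "f \<in> bumps d" "d \<noteq> 0"
  shows "\<exists>g\<in>bumps d. \<forall>t. (f has_real_derivative g t) (at t)"
  using assms(1)
proof induction
  case (base n a m)
  define F where "F = (\<lambda>n m t. flat_exp n ((t - a) / d) * flat_exp m (1 - (t - a) / d))"
  define g where "g = (\<lambda>t. (1 / d) * ((F (n + 2) m t + (- real n) * F (n + 1) m t) + (- 1) * (F n (m + 2) t + (- real m) * F n (m + 1) t)))"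
  have "g \<in> bumps d" unfolding g_def F_def by (intro bumps.intros)
  moreover have "((\<lambda>t. flat_exp n ((t - a) / d) * flat_exp m (1 - (t - a) / d)) has_real_derivative g t) (at t)" for t
  proof -
    have "((\<lambda>t. flat_exp n ((t - a) / d)) has_real_derivative
        (flat_exp (n + 2) ((t - a) / d) - real n * flat_exp (n + 1) ((t - a) / d)) * (1 / d)) (at t)"
      by (rule DERIV_chain2[OF flat_exp_deriv]) (use assms(2) in \<open>auto intro!: derivative_eq_intros\<close>)
    moreover have "((\<lambda>t. flat_exp m (1 - (t - a) / d)) has_real_derivative
        (flat_exp (m + 2) (1 - (t - a) / d) - real m * flat_exp (m + 1) (1 - (t - a) / d)) * (- (1 / d))) (at t)"
      by (rule DERIV_chain2[OF flat_exp_deriv]) (use assms(2) in \<open>auto intro!: derivative_eq_intros\<close>)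
    ultimately show ?thesis
      by (rule DERIV_cong[OF DERIV_mult]) (simp add: g_def F_def algebra_simps add_divide_distrib diff_divide_distrib)
  qed
  ultimately show ?case by blast
next
  case (add u v)
  then obtain u' v' where "u' \<in> bumps d" "v' \<in> bumps d"
    "\<And>t. (u has_real_derivative u' t) (at t)" "\<And>t. (v has_real_derivative v' t) (at t)" by blast
  then show ?case by (intro bexI[of _ "\<lambda>t. u' t + v' t"] bumps.add) (auto intro: DERIV_add)
next
  case (cmult u c)
  then obtain u' where "u' \<in> bumps d" "\<And>t. (u has_real_derivative u' t) (at t)" by blast
  then show ?case by (intro bexI[of _ "\<lambda>t. c * u' t"] bumps.cmult) (auto intro: DERIV_cmult)
qed

lemma bump_scaled: "(\<lambda>t. bump ((t - a) / d)) \<in> bumps d"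
  using bumps.base[of 0 a d 0] by (simp add: bump_def)

lemma bump_nonneg: "0 \<le> bump t" and bump_zero: "t \<le> 0 \<or> 1 \<le> t \<Longrightarrow> bump t = 0"
  and bump_pos: "0 < t \<Longrightarrow> t < 1 \<Longrightarrow> 0 < bump t"
  by (auto simp: bump_def flat_exp_def)

lemma continuous_on_bump: "continuous_on S bump"
proof -
  have "isCont (flat_exp 0) t" for t using flat_exp_deriv[of 0 t] DERIV_isCont by blast
  then have "continuous_on UNIV (flat_exp 0)" by (simp add: continuous_at_imp_continuous_on)
  then show ?thesis unfolding bump_def
    by (intro continuous_intros; (rule continuous_on_compose2[of UNIV "flat_exp 0"])?) (auto intro!: continuous_intros)
qed

text \<open>A smooth step, the normalised primitive of \<open>bump\<close>. The lower limit lies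
  below both t and the support of \<open>bump\<close>, so one formula covers negative t as well; by
  \<open>integral_bump_from\<close> any such base point gives the same value.\<close>

definition ramp :: "real \<Rightarrow> real" where
  "ramp t = integral {min t 0 - 1..t} bump / integral {0..1} bump"

lemma bump_integrable: "bump integrable_on {a..b}"
  by (intro integrable_continuous_real continuous_on_bump)

lemma integral_bump_zero:
  assumes "d \<le> 0 \<or> 1 \<le> c" shows "integral {c..d} bump = 0"
proof -
  have "integral {c..d} bump = integral {c..d} (\<lambda>_. 0)"
    using assms by (intro Henstock_Kurzweil_Integration.integral_cong) (auto intro!: bump_zero)
  then show ?thesis by simp
qed

lemma integral_bump_from:
  assumes "a \<le> 0" "a \<le> t"
  shows "integral {a..t} bump = integral {min t 0 - 1..t} bump"
proof -
  have z: "integral {c..d} bump = 0" if "d \<le> 0" for c d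
    using that by (intro integral_bump_zero) simp
  define c where "c = min a (min t 0 - 1)"
  have "integral {c..a} bump + integral {a..t} bump = integral {c..t} bump"
    using assms by (intro Henstock_Kurzweil_Integration.integral_combine bump_integrable) (auto simp: c_def)
  moreover have "integral {c..min t 0 - 1} bump + integral {min t 0 - 1..t} bump = integral {c..t} bump"
    by (intro Henstock_Kurzweil_Integration.integral_combine bump_integrable) (auto simp: c_def)
  ultimately show ?thesis using z[of a c] z[of "min t 0 - 1" c] assms by simp
qed

lemma integral_bump_pos: "0 < integral {0..1} bump"
proof -
  have "integral {0..1} bump \<noteq> 0"
  proof
    assume "integral {0..1} bump = 0"
    then have "bump (1/2) = 0"
      using integral_eq_0_iff[OF continuous_on_bump, of 0 1] bump_nonneg by simp
    then show False using bump_pos[of "1/2"] by simp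
  qed
  moreover have "0 \<le> integral {0..1} bump" by (intro integral_nonneg bump_integrable bump_nonneg)
  ultimately show ?thesis by simp
qed

lemma ramp_deriv: "(ramp has_real_derivative bump t / integral {0..1} bump) (at t)"
proof -
  define a where "a = min t 0 - 2"
  have "((\<lambda>s. integral {a..s} bump) has_real_derivative bump t) (at t within {a..t + 1})"
    by (rule integral_has_real_derivative[OF continuous_on_bump]) (auto simp: a_def)
  moreover have "at t within {a..t + 1} = at t" by (rule at_within_interior) (auto simp: a_def)
  ultimately have "((\<lambda>s. integral {a..s} bump / integral {0..1} bump) has_real_derivative bump t / integral {0..1} bump) (at t)"
    using DERIV_cdivide by fastforce
  then show ?thesis
    by (rule has_field_derivative_transform_within_open[where S="{a<..}"])
       (use integral_bump_from[of a] in \<open>auto simp: a_def ramp_def\<close>)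
qed

lemma ramp_zero: "t \<le> 0 \<Longrightarrow> ramp t = 0"
  unfolding ramp_def by (subst integral_bump_zero) auto

lemma ramp_one: "1 \<le> t \<Longrightarrow> ramp t = 1"
proof -
  assume t: "1 \<le> t"
  have "integral {0..t} bump = integral {min t 0 - 1..t} bump" using t by (intro integral_bump_from) auto
  moreover have "integral {0..1} bump + integral {1..t} bump = integral {0..t} bump"
    using t by (intro Henstock_Kurzweil_Integration.integral_combine bump_integrable) auto
  moreover have "integral {1..t} bump = 0" by (intro integral_bump_zero) simp
  ultimately show ?thesis using integral_bump_pos by (simp add: ramp_def)
qed

lemma ramp_mono: "s \<le> t \<Longrightarrow> ramp s \<le> ramp t"
  using ramp_deriv divide_nonneg_pos[OF bump_nonneg integral_bump_pos]
  by (intro DERIV_nonneg_imp_nondecreasing[of s t ramp]) blast+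

lemma ramp_bounds: "0 \<le> ramp t" "ramp t \<le> 1"
  using ramp_mono[of "min t 0" t] ramp_mono[of t "max t 1"] ramp_zero[of "min t 0"] ramp_one[of "max t 1"] by auto

text \<open>Rises over [a, a + d] and falls over [b, b + d]. Both transitions lie to the right of
  their base points, so only b + d < T has to be ensured for the support to stay inside (0, T) when
  a > 0.\<close>

definition plateau :: "real \<Rightarrow> real \<Rightarrow> real \<Rightarrow> real \<Rightarrow> real" where
  "plateau a b d t = ramp ((t - a) / d) - ramp ((t - b) / d)"

definition bump_kernel :: "real \<Rightarrow> real \<Rightarrow> real \<Rightarrow> real" where
  "bump_kernel a d t = bump ((t - a) / d) / (d * integral {0..1} bump)"

lemma ramp_scaled_deriv:
  assumes "d > 0" shows "((\<lambda>t. ramp ((t - a) / d)) has_real_derivative bump_kernel a d t) (at t)"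
proof -
  have "((\<lambda>t. ramp ((t - a) / d)) has_real_derivative (bump ((t - a) / d) / integral {0..1} bump) * (1 / d)) (at t)"
    by (rule DERIV_chain2[OF ramp_deriv]) (use assms in \<open>auto intro!: derivative_eq_intros\<close>)
  then show ?thesis by (simp add: bump_kernel_def mult.commute)
qed

lemma plateau_deriv:
  assumes "d > 0" shows "(plateau a b d has_real_derivative bump_kernel a d t - bump_kernel b d t) (at t)"
  unfolding plateau_def[abs_def] by (intro DERIV_diff ramp_scaled_deriv assms)

lemma test_fun_plateau:
  assumes "0 < a" "a \<le> b" "b + d < T" "d > 0"
  shows "test_fun T (plateau a b d)"
  unfolding test_fun_def
proof (intro conjI allI)
  fix n t
  define P where "P = insert (plateau a b d) (bumps d)"
  have "(\<lambda>t. (1 / (d * integral {0..1} bump)) * bump ((t - a) / d) + (- 1 / (d * integral {0..1} bump)) * bump ((t - b) / d)) \<in> bumps d"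
    by (intro bumps.add bumps.cmult bump_scaled)
  moreover have "(\<lambda>t. (1 / (d * integral {0..1} bump)) * bump ((t - a) / d) + (- 1 / (d * integral {0..1} bump)) * bump ((t - b) / d))
      = (\<lambda>t. bump_kernel a d t - bump_kernel b d t)"
    by (simp add: bump_kernel_def fun_eq_iff)
  ultimately have "(\<lambda>t. bump_kernel a d t - bump_kernel b d t) \<in> bumps d" by simp
  then have k: "(\<lambda>t. bump_kernel a d t - bump_kernel b d t) \<in> bumps d" .
  show "((deriv ^^ n) (plateau a b d)) differentiable (at t)"
  proof (rule smooth_coinduct[of _ P])
    fix f assume f: "f \<in> P"
    show "\<exists>g\<in>P. \<forall>t. (f has_real_derivative g t) (at t)"
    proof (cases "f \<in> bumps d")
      case True
      then show ?thesis using bumps_deriv[of f d] assms(4) by (auto simp: P_def)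
    next
      case False
      then have "f = plateau a b d" using f by (simp add: P_def)
      then show ?thesis using k plateau_deriv[OF assms(4), of a b]
        by (intro bexI[of _ "\<lambda>t. bump_kernel a d t - bump_kernel b d t"]) (auto simp: P_def)
    qed
  qed (simp add: P_def)
next
  have "plateau a b d t = 0" if t: "t \<notin> {a..b + d}" for t
  proof (cases "t < a")
    case True
    then have "(t - a) / d \<le> 0" "(t - b) / d \<le> 0" using assms by (auto simp: divide_nonpos_pos)
    then show ?thesis by (simp add: plateau_def ramp_zero)
  next
    case False
    then have "1 \<le> (t - a) / d" "1 \<le> (t - b) / d" using t assms by auto
    then show ?thesis by (simp add: plateau_def ramp_one)
  qed
  then show "\<exists>a' b'. 0 < a' \<and> b' < T \<and> (\<forall>t. t \<notin> {a'..b'} \<longrightarrow> plateau a b d t = 0)"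
    using assms by blast
qed

section \<open>From the weak derivative to increments\<close>

lemma kernel_average:
  assumes "0 \<le> a" "d > 0" "a + d \<le> T" "continuous_on {0..T} u"
    "\<And>t. t \<in> {a..a + d} \<Longrightarrow> \<bar>u t - u a\<bar> \<le> \<epsilon>"
  shows "\<bar>integral {0..T} (\<lambda>t. u t * bump_kernel a d t) - u a\<bar> \<le> \<epsilon>"
proof -
  have k0: "0 \<le> bump_kernel a d t" for t
    using assms(2) integral_bump_pos bump_nonneg by (simp add: bump_kernel_def)
  have kz: "bump_kernel a d t = 0" if "t \<notin> {a..a + d}" for t
  proof -
    have "(t - a) / d \<le> 0 \<or> 1 \<le> (t - a) / d" using that assms(2) by (auto simp: divide_nonpos_pos)
    then show ?thesis by (simp add: bump_kernel_def bump_zero)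
  qed
  have kc: "continuous_on S (bump_kernel a d)" for S
    unfolding bump_kernel_def using assms(2) integral_bump_pos
    by (intro continuous_intros continuous_on_compose2[OF continuous_on_bump[of UNIV]]) auto
  have "(bump_kernel a d has_integral (ramp ((T - a) / d) - ramp ((0 - a) / d))) {0..T}"
    using assms by (intro fundamental_theorem_of_calculus)
      (auto intro!: has_field_derivative_at_within ramp_scaled_deriv simp flip: has_real_derivative_iff_has_vector_derivative)
  moreover have "ramp ((T - a) / d) = 1" "ramp ((0 - a) / d) = 0"
    using assms by (auto intro!: ramp_one ramp_zero simp: divide_nonpos_pos)
  ultimately have k1: "(bump_kernel a d has_integral 1) {0..T}" by simp
  have "((\<lambda>t. u a * bump_kernel a d t) has_integral u a) {0..T}"
    using has_integral_mult_right[OF k1, of "u a"] by simp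
  moreover have "(\<lambda>t. u t * bump_kernel a d t) integrable_on {0..T}"
    by (intro integrable_continuous_real continuous_intros assms kc)
  ultimately have "integral {0..T} (\<lambda>t. u t * bump_kernel a d t - u a * bump_kernel a d t) =
      integral {0..T} (\<lambda>t. u t * bump_kernel a d t) - integral {0..T} (\<lambda>t. u a * bump_kernel a d t)"
    by (intro integral_diff) (auto intro: has_integral_integrable)
  also have "integral {0..T} (\<lambda>t. u a * bump_kernel a d t) = u a"
    using integral_unique[OF has_integral_mult_right[OF k1, of "u a"]] by simp
  finally have eq: "integral {0..T} (\<lambda>t. u t * bump_kernel a d t) - u a = integral {0..T} (\<lambda>t. u t * bump_kernel a d t - u a * bump_kernel a d t)" ..
  have "norm (integral {0..T} (\<lambda>t. u t * bump_kernel a d t - u a * bump_kernel a d t)) \<le> integral {0..T} (\<lambda>t. \<epsilon> * bump_kernel a d t)"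
  proof (rule Henstock_Kurzweil_Integration.integral_norm_bound_integral)
    show "(\<lambda>t. u t * bump_kernel a d t - u a * bump_kernel a d t) integrable_on {0..T}"
      "(\<lambda>t. \<epsilon> * bump_kernel a d t) integrable_on {0..T}"
      by (intro integrable_continuous_real continuous_intros assms kc)+
    show "norm (u t * bump_kernel a d t - u a * bump_kernel a d t) \<le> \<epsilon> * bump_kernel a d t" for t
    proof (cases "t \<in> {a..a + d}")
      case True
      have "norm (u t * bump_kernel a d t - u a * bump_kernel a d t) = \<bar>u t - u a\<bar> * bump_kernel a d t"
        using k0[of t] by (simp add: left_diff_distrib[symmetric] abs_mult)
      then show ?thesis using assms(5)[OF True] k0[of t] by (simp add: mult_right_mono)
    qed (simp add: kz)
  qed
  also have "\<dots> = \<epsilon>" using integral_unique[OF k1] by simp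
  finally show ?thesis unfolding eq by simp
qed

text \<open>Testing with a smoothed indicator of \<open>[t1, t2]\<close> turns the left-hand side into differences of local
  averages of \<open>u\<close>, which converge by continuity.\<close>
lemma weak_derivative_increment:
  fixes u g :: "real \<Rightarrow> real"
  assumes T: "T > 0" and u: "continuous_on {0..T} u"
    and g: "g \<in> borel_measurable (lebesgue_on {0<..<T})" "AE t in lebesgue_on {0<..<T}. \<bar>g t\<bar> \<le> C"
    and weak: "\<And>\<psi>. test_fun T \<psi> \<Longrightarrow>
      (LINT t|lebesgue_on {0<..<T}. u t * deriv \<psi> t) = - (LINT t|lebesgue_on {0<..<T}. g t * \<psi> t)"
    and t: "0 < t1" "t1 < t2" "t2 < T"
  shows "u t2 - u t1 = integral {t1..t2} g"
proof -
  \<comment> \<open>At most half the distance from t2 to T, so every plateau is supported inside (0,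
    T).\<close>
  define \<delta> where "\<delta> = (\<lambda>n. (T - t2) / 2 * inverse (real (Suc n)))"
  have \<delta>_pos: "0 < \<delta> n" and \<delta>_le: "t2 + \<delta> n < T" for n
  proof -
    show "0 < \<delta> n" using t by (simp add: \<delta>_def)
    have "(T - t2) / 2 * inverse (real (Suc n)) \<le> (T - t2) / 2 * 1"
      using t by (intro mult_left_mono) (auto simp: inverse_eq_divide)
    then have "\<delta> n \<le> (T - t2) / 2" unfolding \<delta>_def by simp
    then show "t2 + \<delta> n < T" using t by simp
  qed
  have \<delta>_lim: "\<delta> \<longlonglongrightarrow> 0"
    unfolding \<delta>_def by (rule tendsto_mult_right_zero[OF LIMSEQ_inverse_real_of_nat])
  have avg: "(\<lambda>n. integral {0..T} (\<lambda>s. u s * bump_kernel a (\<delta> n) s)) \<longlonglongrightarrow> u a"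
    if a: "0 < a" "a \<le> t2" for a
  proof (rule LIMSEQ_I)
    fix r :: real assume r: "0 < r"
    have "a \<in> {0..T}" using a t by auto
    then obtain \<eta> where \<eta>: "0 < \<eta>" "\<And>s. s \<in> {0..T} \<Longrightarrow> dist s a < \<eta> \<Longrightarrow> dist (u s) (u a) < r / 2"
      using u[unfolded continuous_on_iff, rule_format, of a "r / 2"] r by auto
    obtain n0 where n0: "\<And>n. n \<ge> n0 \<Longrightarrow> \<bar>\<delta> n\<bar> < \<eta>"
      using LIMSEQ_D[OF \<delta>_lim \<eta>(1)] by auto
    have "\<bar>integral {0..T} (\<lambda>s. u s * bump_kernel a (\<delta> n) s) - u a\<bar> \<le> r / 2" if "n \<ge> n0" for n
    proof (rule kernel_average[OF _ \<delta>_pos _ u])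
      show "a + \<delta> n \<le> T" using \<delta>_le[of n] a by simp
      show "\<bar>u s - u a\<bar> \<le> r / 2" if "s \<in> {a..a + \<delta> n}" for s
        using \<eta>(2)[of s] n0[OF \<open>n \<ge> n0\<close>] \<delta>_le[of n] a that by (auto simp: dist_real_def)
    qed (use a in simp)
    then show "\<exists>no. \<forall>n\<ge>no. norm (integral {0..T} (\<lambda>s. u s * bump_kernel a (\<delta> n) s) - u a) < r"
      using r by (intro exI[of _ n0]) fastforce
  qed
  have kc: "continuous_on S (bump_kernel a (\<delta> n))" for S a n
    unfolding bump_kernel_def using \<delta>_pos[of n] integral_bump_pos
    by (intro continuous_intros continuous_on_compose2[OF continuous_on_bump[of UNIV]]) auto
  have lhs: "(LINT s|lebesgue_on {0<..<T}. u s * deriv (plateau t1 t2 (\<delta> n)) s) =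
     integral {0..T} (\<lambda>s. u s * bump_kernel t1 (\<delta> n) s) - integral {0..T} (\<lambda>s. u s * bump_kernel t2 (\<delta> n) s)" for n
  proof -
    define w where "w = (\<lambda>s. u s * bump_kernel t1 (\<delta> n) s - u s * bump_kernel t2 (\<delta> n) s)"
    have "u s * deriv (plateau t1 t2 (\<delta> n)) s = w s" for s
      unfolding DERIV_imp_deriv[OF plateau_deriv[OF \<delta>_pos]] w_def by (simp add: right_diff_distrib)
    moreover have "continuous_on {0..T} w" unfolding w_def by (intro continuous_intros u kc)
    then have "w absolutely_integrable_on {0..T}" by (rule absolutely_integrable_continuous_real)
    then have "w absolutely_integrable_on {0<..<T}"
      by (rule set_integrable_subset) auto
    then have "integrable (lebesgue_on {0<..<T}) w"
      by (simp add: integrable_restrict_space set_integrable_def)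
    then have "(LINT s|lebesgue_on {0<..<T}. w s) = integral {0<..<T} w"
      by (intro lebesgue_integral_eq_integral) auto
    ultimately have "(LINT s|lebesgue_on {0<..<T}. u s * deriv (plateau t1 t2 (\<delta> n)) s) = integral {0..T} w"
      by (simp only: integral_open_interval_real)
    then show ?thesis unfolding w_def
      by (subst (asm) integral_diff) (auto intro!: integrable_continuous_real continuous_intros u kc)
  qed
  have lim1: "(\<lambda>n. LINT s|lebesgue_on {0<..<T}. u s * deriv (plateau t1 t2 (\<delta> n)) s) \<longlonglongrightarrow> u t1 - u t2"
    unfolding lhs by (intro tendsto_diff avg) (use t in auto)
  have ramp_ev: "eventually (\<lambda>n. ramp ((s - a) / \<delta> n) = (if a < s then 1 else 0)) sequentially" for s a
  proof (cases "a < s")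
    case True
    have "eventually (\<lambda>n. \<delta> n < s - a) sequentially"
      using order_tendstoD(2)[OF \<delta>_lim, of "s - a"] True by simp
    then show ?thesis
      by eventually_elim (use True \<delta>_pos in \<open>auto intro!: ramp_one simp: le_divide_eq\<close>)
  next
    case False
    then have "(s - a) / \<delta> n \<le> 0" for n using \<delta>_pos[of n] by (simp add: divide_nonpos_pos)
    then show ?thesis using False by (auto intro!: always_eventually ramp_zero)
  qed
  \<comment> \<open>The interval is open on the left and closed on the right because
    \<open>ramp\<close> vanishes at 0: at s = t1 both ramps are 0, while at s = t2 the first tends
    to 1 and the second is 0. The plateaus thus converge at every point.\<close>
  define ind :: "real \<Rightarrow> real" where "ind = indicator {t1<..t2}"
  have finm: "finite_measure (lebesgue_on {0<..<T})"
    by (intro finite_measure_lebesgue_on) auto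
  have g_int: "integrable (lebesgue_on {0<..<T}) g"
    using finite_measure.integrable_const_bound[OF finm, of g C] g by simp
  have plateau_meas: "plateau t1 t2 (\<delta> n) \<in> borel_measurable (lebesgue_on {0<..<T})" for n
  proof -
    have "continuous_on UNIV (plateau t1 t2 (\<delta> n))"
      using plateau_deriv[OF \<delta>_pos] DERIV_isCont by (blast intro: continuous_at_imp_continuous_on)
    then show ?thesis
      by (intro continuous_imp_measurable_on_sets_lebesgue) (auto intro: continuous_on_subset)
  qed
  have "(\<lambda>n. LINT s|lebesgue_on {0<..<T}. g s * plateau t1 t2 (\<delta> n) s) \<longlonglongrightarrow>
      (LINT s|lebesgue_on {0<..<T}. g s * ind s)"
  proof (rule integral_dominated_convergence[where w="\<lambda>s. \<bar>g s\<bar>"])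
    show "(\<lambda>s. g s * ind s) \<in> borel_measurable (lebesgue_on {0<..<T})"
      unfolding ind_def using g(1) t
      by (intro borel_measurable_times borel_measurable_indicator) (auto simp: sets_restrict_space_iff)
    show "(\<lambda>s. g s * plateau t1 t2 (\<delta> n) s) \<in> borel_measurable (lebesgue_on {0<..<T})" for n
      by (intro borel_measurable_times g plateau_meas)
    show "integrable (lebesgue_on {0<..<T}) (\<lambda>s. \<bar>g s\<bar>)" using g_int by simp
    show "AE s in lebesgue_on {0<..<T}. (\<lambda>n. g s * plateau t1 t2 (\<delta> n) s) \<longlonglongrightarrow> g s * ind s"
    proof (intro AE_I2 tendsto_mult_left tendsto_eventually)
      fix s
      show "eventually (\<lambda>n. plateau t1 t2 (\<delta> n) s = ind s) sequentially"
        using ramp_ev[of s t1] ramp_ev[of s t2]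
        by eventually_elim (use t in \<open>auto simp: plateau_def ind_def\<close>)
    qed
    show "AE s in lebesgue_on {0<..<T}. norm (g s * plateau t1 t2 (\<delta> n) s) \<le> \<bar>g s\<bar>" for n
    proof (intro AE_I2)
      fix s
      have "\<bar>plateau t1 t2 (\<delta> n) s\<bar> \<le> 1"
        using ramp_bounds[of "(s - t1) / \<delta> n"] ramp_bounds[of "(s - t2) / \<delta> n"] by (simp add: plateau_def)
      then show "norm (g s * plateau t1 t2 (\<delta> n) s) \<le> \<bar>g s\<bar>"
        by (simp add: abs_mult mult_left_le)
    qed
  qed
  moreover have "(LINT s|lebesgue_on {0<..<T}. g s * plateau t1 t2 (\<delta> n) s) =
      - (LINT s|lebesgue_on {0<..<T}. u s * deriv (plateau t1 t2 (\<delta> n)) s)" for n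
    using weak[OF test_fun_plateau[of t1 t2 "\<delta> n" T]] t \<delta>_pos[of n] \<delta>_le[of n] by simp
  ultimately have "(\<lambda>n. - (LINT s|lebesgue_on {0<..<T}. u s * deriv (plateau t1 t2 (\<delta> n)) s)) \<longlonglongrightarrow>
      (LINT s|lebesgue_on {0<..<T}. g s * ind s)" by simp
  then have "(LINT s|lebesgue_on {0<..<T}. g s * ind s) = - (u t1 - u t2)"
    using LIMSEQ_unique tendsto_minus[OF lim1] by blast
  moreover have "(LINT s|lebesgue_on {0<..<T}. g s * ind s) = integral {t1..t2} g"
  proof -
    have "integrable (lebesgue_on {0<..<T}) (\<lambda>s. g s * ind s)"
    proof -
      have "{t1<..t2} \<in> sets (lebesgue_on {0<..<T})" using t by (auto simp: sets_restrict_space_iff)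
      from integrable_mult_indicator[OF this g_int] show ?thesis by (simp add: ind_def mult.commute)
    qed
    then have "(LINT s|lebesgue_on {0<..<T}. g s * ind s) = integral {0<..<T} (\<lambda>s. g s * ind s)"
      by (intro lebesgue_integral_eq_integral) auto
    also have "\<dots> = integral {0<..<T} (\<lambda>s. if s \<in> {t1<..t2} then g s else 0)"
      by (intro Henstock_Kurzweil_Integration.integral_cong) (auto simp: ind_def)
    also have "\<dots> = integral {t1<..t2} g"
    proof -
      have "{t1<..t2} \<inter> {0<..<T} = {t1<..t2}" using t by auto
      then show ?thesis using integral_restrict_Int[of "{0<..<T}" "{t1<..t2}" g] by (simp add: Int_commute)
    qed
    also have "\<dots> = integral {t1..t2} g"
      by (rule integral_subset_negligible) (auto intro: negligible_subset[of "{t1}"])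
    finally show ?thesis .
  qed
  ultimately show ?thesis by simp
qed

text \<open>Extends the increment formula to the endpoints: u minus the primitive of g is constant
  on (0, T) and continuous on [0, T].\<close>

lemma weak_derivative_FTC:
  fixes u g :: "real \<Rightarrow> real"
  assumes T: "T > 0" and u: "continuous_on {0..T} u"
    and g: "g \<in> borel_measurable (lebesgue_on {0<..<T})" "AE t in lebesgue_on {0<..<T}. \<bar>g t\<bar> \<le> C"
    and weak: "\<And>\<psi>. test_fun T \<psi> \<Longrightarrow>
      (LINT t|lebesgue_on {0<..<T}. u t * deriv \<psi> t) = - (LINT t|lebesgue_on {0<..<T}. g t * \<psi> t)"
    and t: "0 \<le> t1" "t1 \<le> t2" "t2 \<le> T"
  shows "g integrable_on {t1..t2}" and "u t2 - u t1 = integral {t1..t2} g"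
proof -
  have finm: "finite_measure (lebesgue_on {0<..<T})"
    by (intro finite_measure_lebesgue_on) auto
  have "integrable (lebesgue_on {0<..<T}) g"
    using finite_measure.integrable_const_bound[OF finm, of g C] g by simp
  then have "g integrable_on {0<..<T}"
    by (intro integrable_on_lebesgue_on) auto
  then have gT: "g integrable_on {0..T}" by (simp add: integrable_on_open_interval_real)
  then show "g integrable_on {t1..t2}" by (rule integrable_on_subinterval) (use t in auto)
  define D where "D = (\<lambda>s. u s - integral {0..s} g)"
  have D_cont: "continuous_on {0..T} D"
    unfolding D_def by (intro continuous_intros u indefinite_integral_continuous_1 gT)
  have comb: "integral {0..a} g + integral {a..b} g = integral {0..b} g" if "0 \<le> a" "a \<le> b" "b \<le> T" for a b
    using that by (intro Henstock_Kurzweil_Integration.integral_combine integrable_on_subinterval[OF gT]) auto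
  have D_lt: "D a = D b" if "0 < a" "a < b" "b < T" for a b
    using weak_derivative_increment[OF T u g weak that] comb[of a b] that by (simp add: D_def)
  have D_open: "D s = D (T / 2)" if "s \<in> {0<..<T}" for s
  proof -
    consider "s < T / 2" | "s = T / 2" | "T / 2 < s" by linarith
    then show ?thesis
    proof cases
      case 1
      then show ?thesis using that T by (intro D_lt) auto
    next
      case 3
      then have "D (T / 2) = D s" using that T by (intro D_lt) auto
      then show ?thesis by simp
    next
      case 2
      show ?thesis unfolding 2 ..
    qed
  qed
  have const: "D s = D (T / 2)" if "s \<in> {0..T}" for s
    by (rule continuous_constant_on_closure[of "{0<..<T}" D, OF _ D_open]) (use D_cont T that in auto)
  have "D t1 = D t2" using const[of t1] const[of t2] t by simp
  then show "u t2 - u t1 = integral {t1..t2} g" using comb[of t1 t2] t by (simp add: D_def)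
qed

section \<open>Regularity of the exact solution\<close>

text \<open>Completeness of Lebesgue measure. It is needed for \<Delta>\<mu>, which is the limit of
  its difference quotients only off the exceptional null set.\<close>

lemma measurable_AE_lebesgue_on:
  fixes f g :: "real \<Rightarrow> real"
  assumes "f \<in> borel_measurable (lebesgue_on S)" "S \<in> sets lebesgue" "negligible Z"
    "\<And>s. s \<in> S - Z \<Longrightarrow> f s = g s"
  shows "g \<in> borel_measurable (lebesgue_on S)"
proof -
  have "(\<lambda>s. if s \<in> S then f s else 0) \<in> borel_measurable lebesgue"
    using assms(1,2) by (simp add: borel_measurable_if)
  moreover have "AE s in lebesgue. (if s \<in> S then f s else 0) = (if s \<in> S then g s else 0)"
  proof (rule AE_I')
    show "Z \<in> null_sets lebesgue" using assms(3) by (simp add: negligible_iff_null_sets)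
    show "{s \<in> space lebesgue. (if s \<in> S then f s else 0) \<noteq> (if s \<in> S then g s else 0)} \<subseteq> Z"
    proof
      fix s assume "s \<in> {s \<in> space lebesgue. (if s \<in> S then f s else 0) \<noteq> (if s \<in> S then g s else 0)}"
      then have "s \<in> S" "f s \<noteq> g s" by (auto split: if_splits)
      then show "s \<in> Z" using assms(4)[of s] by blast
    qed
  qed
  ultimately have "(\<lambda>s. if s \<in> S then g s else 0) \<in> borel_measurable lebesgue"
    by (rule borel_measurable_AE)
  then show ?thesis using assms(2) by (simp add: borel_measurable_if)
qed

lemma AE_lebesgue_on_iff:
  assumes "S \<in> sets lebesgue"
  shows "(AE s in lebesgue_on S. P s) \<longleftrightarrow> (\<exists>Z. negligible Z \<and> (\<forall>s\<in>S - Z. P s))"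
proof
  assume "AE s in lebesgue_on S. P s"
  then obtain Z where "Z \<in> null_sets (lebesgue_on S)" "{s \<in> space (lebesgue_on S). \<not> P s} \<subseteq> Z"
    using eventually_ae_filter[of P "lebesgue_on S"] by auto
  moreover from this(1) have "negligible Z"
    using assms by (auto simp: null_sets_restrict_space negligible_iff_null_sets)
  ultimately show "\<exists>Z. negligible Z \<and> (\<forall>s\<in>S - Z. P s)" by auto
next
  assume "\<exists>Z. negligible Z \<and> (\<forall>s\<in>S - Z. P s)"
  then obtain Z where Z: "negligible Z" "\<forall>s\<in>S - Z. P s" by blast
  have "AE s in lebesgue. s \<in> S \<longrightarrow> P s"
    using Z by (intro AE_I'[of Z]) (auto simp: negligible_iff_null_sets)
  then show "AE s in lebesgue_on S. P s" using assms by (subst AE_restrict_space_iff) auto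
qed

lemma closure_interval_minus_negligible:
  assumes "T > 0" "negligible Z" shows "closure ({0<..<T} - Z) = {0..T :: real}"
proof
  show "closure ({0<..<T} - Z) \<subseteq> {0..T}"
    by (rule closure_minimal) auto
  have "{0<..<T} \<subseteq> closure ({0<..<T} - Z)"
  proof (rule ccontr)
    assume "\<not> ?thesis"
    then have ne: "{0<..<T} - closure ({0<..<T} - Z) \<noteq> {}" by blast
    have "open ({0<..<T} - closure ({0<..<T} - Z))" by (intro open_Diff) auto
    then have "\<not> negligible ({0<..<T} - closure ({0<..<T} - Z))" using ne by (intro open_not_negligible)
    moreover have "{0<..<T} - closure ({0<..<T} - Z) \<subseteq> Z" using closure_subset[of "{0<..<T} - Z"] by blast
    ultimately show False using negligible_subset[OF assms(2)] by blast
  qed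
  then have "closure {0<..<T} \<subseteq> closure ({0<..<T} - Z)" by (rule closure_minimal) simp
  then show "{0..T} \<subseteq> closure ({0<..<T} - Z)" using assms(1) by simp
qed

text \<open>Exhibits the Laplacian as a limit of finite combinations of point values. In time,
  \<Delta>\<mu> thereby inherits measurability from \<mu>, without differentiating the logarithms
  explicitly.\<close>

lemma lapl_limit:
  assumes "CkB 4 C m"
  shows "(\<lambda>n. \<Sum>i\<in>UNIV. (m (x + inverse (real (Suc n)) *\<^sub>R axis i 1) + m (x - inverse (real (Suc n)) *\<^sub>R axis i 1) - 2 * m x)
    / (inverse (real (Suc n)))\<^sup>2) \<longlonglongrightarrow> lapl m x"
  unfolding lapl_def
proof (intro tendsto_sum)
  fix i :: 3
  define h where "h = (\<lambda>n. inverse (real (Suc n)))"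
  have hp: "h n > 0" for n by (simp add: h_def)
  have h_lim: "h \<longlonglongrightarrow> 0" unfolding h_def by (rule LIMSEQ_inverse_real_of_nat)
  have "(\<lambda>n. (m (x + h n *\<^sub>R axis i 1) + m (x - h n *\<^sub>R axis i 1) - 2 * m x) / (h n)\<^sup>2) \<longlonglongrightarrow> pd i (pd i m) x"
  proof (rule LIM_zero_cancel, rule Lim_null_comparison)
    show "eventually (\<lambda>n. norm ((m (x + h n *\<^sub>R axis i 1) + m (x - h n *\<^sub>R axis i 1) - 2 * m x) / (h n)\<^sup>2 - pd i (pd i m) x) \<le> C * (h n)\<^sup>2) sequentially"
    proof (intro always_eventually allI)
      fix n
      have "(m (x + h n *\<^sub>R axis i 1) + m (x - h n *\<^sub>R axis i 1) - 2 * m x) / (h n)\<^sup>2 - pd i (pd i m) x =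
        (m (x + h n *\<^sub>R axis i 1) + m (x - h n *\<^sub>R axis i 1) - 2 * m x - (h n)\<^sup>2 * pd i (pd i m) x) / (h n)\<^sup>2"
        using hp[of n] by (simp add: diff_divide_distrib)
      also have "\<bar>\<dots>\<bar> \<le> C * h n ^ 4 / (h n)\<^sup>2"
        using CkB_second_difference[OF assms hp[of n], of x i] by (simp add: abs_divide divide_right_mono)
      also have "\<dots> = C * (h n)\<^sup>2" using hp[of n] by (simp add: power_numeral_reduce)
      finally show "norm ((m (x + h n *\<^sub>R axis i 1) + m (x - h n *\<^sub>R axis i 1) - 2 * m x) / (h n)\<^sup>2 - pd i (pd i m) x) \<le> C * (h n)\<^sup>2" by simp
    qed
    have "(\<lambda>n. C * (h n)\<^sup>2) \<longlonglongrightarrow> C * 0\<^sup>2" by (intro tendsto_intros h_lim)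
    then show "(\<lambda>n. C * (h n)\<^sup>2) \<longlonglongrightarrow> 0" by simp
  qed
  then show "(\<lambda>n. (m (x + inverse (real (Suc n)) *\<^sub>R axis i 1) + m (x - inverse (real (Suc n)) *\<^sub>R axis i 1) - 2 * m x)
    / (inverse (real (Suc n)))\<^sup>2) \<longlonglongrightarrow> pd i (pd i m) x" by (simp only: h_def)
qed

lemma CH_exact_solution_regular:
  assumes "eps > 0" "theta0 > 0" and pos: "T > 0" "L > 0" and sol: "CH_exact_solution eps theta0 L T \<Phi>"
  shows "\<exists>C \<delta> Z. CH_regular eps theta0 L T C \<delta> \<Phi> Z"
proof -
  let ?mu = "\<lambda>s. CH_mu eps theta0 (\<Phi> s)"
  have linf: "Linf_Ck 6 L T \<Phi>" and cont: "continuous_on ({0..T} \<times> UNIV) (\<lambda>(t, x). \<Phi> t x)"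
    and lt1: "\<And>t x. t \<in> {0..T} \<Longrightarrow> \<bar>\<Phi> t x\<bar> < 1" and wd: "weak_time_deriv T \<Phi> (\<lambda>t. lapl (?mu t))"
    using sol unfolding CH_exact_solution_def by auto
  have S: "{0<..<T} \<in> sets lebesgue" by simp
  obtain M where M: "AE t in lebesgue_on {0<..<T}. Ck_norm 6 (\<Phi> t) \<le> M" and per: "AE t in lebesgue_on {0<..<T}. Cper 6 L (\<Phi> t)"
    and meas: "\<And>ds x. length ds \<le> 6 \<Longrightarrow> (\<lambda>t. dpd ds (\<Phi> t) x) \<in> borel_measurable (lebesgue_on {0<..<T})"
    using linf unfolding Linf_Ck_def by blast
  have "AE t in lebesgue_on {0<..<T}. Cper 6 L (\<Phi> t) \<and> Ck_norm 6 (\<Phi> t) \<le> M" using M per by eventually_elim simp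
  then obtain Z0 where Z0: "negligible Z0" "\<And>s. s \<in> {0<..<T} - Z0 \<Longrightarrow> Cper 6 L (\<Phi> s) \<and> Ck_norm 6 (\<Phi> s) \<le> M"
    unfolding AE_lebesgue_on_iff[OF S] by blast
  \<comment> \<open>The almost-everywhere statements concern the open interval, so the endpoints
    join the exceptional set.\<close>
  define Z where "Z = Z0 \<union> {0, T}"
  have Z: "negligible Z" unfolding Z_def by (intro negligible_Un Z0(1) negligible_finite) simp
  have good: "Cper 6 L (\<Phi> s)" "Ck_norm 6 (\<Phi> s) \<le> M" if "s \<in> {0..T} - Z" for s
    using Z0(2)[of s] that by (auto simp: Z_def)
  have t_cont: "continuous_on {0..T} (\<lambda>t. \<Phi> t x)" for x
  proof -
    have "continuous_on {0..T} (\<lambda>t. (\<lambda>(t, x). \<Phi> t x) (t, x))"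
      by (rule continuous_on_compose2[OF cont]) (auto intro!: continuous_intros)
    then show ?thesis by simp
  qed
  have x_cont: "continuous_on UNIV (\<Phi> t)" if "t \<in> {0..T}" for t
  proof -
    have "continuous_on UNIV (\<lambda>x. (\<lambda>(t, x). \<Phi> t x) (t, x))"
      by (rule continuous_on_compose2[OF cont]) (use that in \<open>auto intro!: continuous_intros\<close>)
    then show ?thesis by simp
  qed
  \<comment> \<open>Periodicity is known at good times, which are dense in [0, T], and the defect is
    continuous in time.\<close>
  have Phi_per: "periodic3 L (\<Phi> t)" if t: "t \<in> {0..T}" for t
    unfolding periodic3_def
  proof (intro allI)
    fix i x
    have "\<Phi> t (x + L *\<^sub>R axis i 1) - \<Phi> t x = 0"
    proof (rule continuous_constant_on_closure[of "{0<..<T} - Z" "\<lambda>t. \<Phi> t (x + L *\<^sub>R axis i 1) - \<Phi> t x"])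
      show "continuous_on (closure ({0<..<T} - Z)) (\<lambda>t. \<Phi> t (x + L *\<^sub>R axis i 1) - \<Phi> t x)"
        unfolding closure_interval_minus_negligible[OF pos(1) Z] by (intro continuous_intros t_cont)
      show "\<Phi> s (x + L *\<^sub>R axis i 1) - \<Phi> s x = 0" if "s \<in> {0<..<T} - Z" for s
        using good(1)[of s] that by (auto simp: Cper_def periodic3_def)
      show "t \<in> closure ({0<..<T} - Z)" unfolding closure_interval_minus_negligible[OF pos(1) Z] by (rule t)
    qed
    then show "\<Phi> t (x + L *\<^sub>R axis i 1) = \<Phi> t x" by simp
  qed
  \<comment> \<open>The pointwise bound |\<Phi>| < 1 becomes uniform: by periodicity |\<Phi>|
    attains its maximum on the compact product of [0, T] with one period cell.\<close>
  obtain \<delta> where \<delta>: "\<delta> > 0" "\<And>t x. t \<in> {0..T} \<Longrightarrow> \<bar>\<Phi> t x\<bar> \<le> 1 - \<delta>"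
  proof -
    let ?K = "{0..T} \<times> cbox (0 :: real^3) (\<chi> _. L)"
    have "continuous_on ?K (\<lambda>p. \<bar>case p of (t, x) \<Rightarrow> \<Phi> t x\<bar>)"
      by (intro continuous_on_rabs continuous_on_subset[OF cont]) auto
    moreover have "compact ?K" by (intro compact_Times compact_Icc compact_cbox)
    moreover have "(0, 0) \<in> ?K" using pos by (auto simp: mem_box_cart)
    ultimately obtain p where p: "p \<in> ?K" "\<And>q. q \<in> ?K \<Longrightarrow> \<bar>case q of (t, x) \<Rightarrow> \<Phi> t x\<bar> \<le> \<bar>case p of (t, x) \<Rightarrow> \<Phi> t x\<bar>"
      using continuous_attains_sup[of ?K "\<lambda>p. \<bar>case p of (t, x) \<Rightarrow> \<Phi> t x\<bar>"] by blast
    obtain t0 x0 where p_eq: "p = (t0, x0)" by (cases p)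
    have "\<bar>\<Phi> t x\<bar> \<le> \<bar>\<Phi> t0 x0\<bar>" if t: "t \<in> {0..T}" for t x
    proof -
      obtain y where "y \<in> cbox 0 (\<chi> _. L)" "\<Phi> t y = \<Phi> t x" using periodic3_cell[OF Phi_per[OF t] pos(2)] by blast
      then show ?thesis using p(2)[of "(t, y)"] t p_eq by simp
    qed
    moreover have "\<bar>\<Phi> t0 x0\<bar> < 1" using p(1) p_eq lt1 by simp
    ultimately show ?thesis using that[of "1 - \<bar>\<Phi> t0 x0\<bar>"] by simp
  qed
  obtain C1 where C1: "\<And>f. CkB 6 M f \<Longrightarrow> (\<forall>x. \<bar>f x\<bar> \<le> 1 - \<delta>) \<Longrightarrow> CkB 4 C1 (CH_mu eps theta0 f)"
    using CkB_CH_mu[OF \<delta>(1), of M eps theta0] by blast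
  define C where "C = max M C1"
  have Phi_M: "CkB 6 M (\<Phi> s)" if "s \<in> {0..T} - Z" for s
    using Cper_CkB[OF good(1)[OF that] pos(2) good(2)[OF that]] .
  have Phi_C: "CkB 6 C (\<Phi> s)" if "s \<in> {0..T} - Z" for s
    by (rule CkB_mono[OF Phi_M[OF that]]) (simp add: C_def)
  have mu_C: "CkB 4 C (?mu s)" if "s \<in> {0..T} - Z" for s
    by (rule CkB_mono[OF C1[OF Phi_M[OF that]]]) (use that \<delta>(2) in \<open>auto simp: C_def\<close>)
  have mu_meas: "(\<lambda>s. ?mu s x) \<in> borel_measurable (lebesgue_on {0<..<T})" for x
  proof -
    have [measurable]: "(\<lambda>s. \<Phi> s x) \<in> borel_measurable (lebesgue_on {0<..<T})"
      using meas[of "[]" x] by (simp add: dpd_def)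
    have [measurable]: "(\<lambda>s. pd i (pd i (\<Phi> s)) x) \<in> borel_measurable (lebesgue_on {0<..<T})" for i
      using meas[of "[i, i]" x] by (simp add: dpd_def)
    show ?thesis unfolding CH_mu_def lapl_def by measurable
  qed
  have lapl_meas: "(\<lambda>s. lapl (?mu s) x) \<in> borel_measurable (lebesgue_on {0<..<T})" for x
  proof (rule measurable_AE_lebesgue_on[OF _ S Z])
    define q where "q = (\<lambda>n s. \<Sum>i\<in>UNIV. (?mu s (x + inverse (real (Suc n)) *\<^sub>R axis i 1) + ?mu s (x - inverse (real (Suc n)) *\<^sub>R axis i 1) - 2 * ?mu s x)
      / (inverse (real (Suc n)))\<^sup>2)"
    have "q n \<in> borel_measurable (lebesgue_on {0<..<T})" for n
      unfolding q_def by (intro borel_measurable_sum borel_measurable_divide borel_measurable_diff borel_measurable_add borel_measurable_times mu_meas borel_measurable_const)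
    then show "(\<lambda>s. lim (\<lambda>n. q n s)) \<in> borel_measurable (lebesgue_on {0<..<T})"
      by (rule borel_measurable_lim_metric)
    show "lim (\<lambda>n. q n s) = lapl (?mu s) x" if "s \<in> {0<..<T} - Z" for s
      unfolding q_def using that by (intro limI lapl_limit[OF mu_C]) auto
  qed
  have mu_AE: "AE s in lebesgue_on {0<..<T}. \<bar>?mu s x\<bar> \<le> C" for x
    unfolding AE_lebesgue_on_iff[OF S] using Z CkB_bound[OF mu_C] by (intro exI[of _ Z]) auto
  have lapl_AE: "AE s in lebesgue_on {0<..<T}. \<bar>lapl (?mu s) x\<bar> \<le> 3 * C" for x
    unfolding AE_lebesgue_on_iff[OF S]
  proof (intro exI[of _ Z] conjI Z ballI)
    fix s assume "s \<in> {0<..<T} - Z"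
    then have "CkB 4 C (?mu s)" by (intro mu_C) auto
    then have "CkB 2 (3 * C) (lapl (?mu s))" using CkB_lapl[of 2 C "?mu s"] by simp
    then show "\<bar>lapl (?mu s) x\<bar> \<le> 3 * C" by (rule CkB_bound)
  qed
  have mu_int: "(\<lambda>s. ?mu s x) integrable_on {a..b}" if "0 \<le> a" "a \<le> b" "b \<le> T" for a b x
  proof -
    have "finite_measure (lebesgue_on {0<..<T})" by (intro finite_measure_lebesgue_on) auto
    then have "integrable (lebesgue_on {0<..<T}) (\<lambda>s. ?mu s x)"
      using mu_meas[of x] mu_AE[of x] by (intro finite_measure.integrable_const_bound[of _ _ C]) auto
    then have "(\<lambda>s. ?mu s x) integrable_on {0<..<T}" by (intro integrable_on_lebesgue_on) auto
    then have "(\<lambda>s. ?mu s x) integrable_on {0..T}" by (simp add: integrable_on_open_interval_real)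
    then show ?thesis by (rule integrable_on_subinterval) (use that in auto)
  qed
  have lapl_int: "(\<lambda>s. lapl (?mu s) x) integrable_on {a..b} \<and> \<Phi> b x - \<Phi> a x = integral {a..b} (\<lambda>s. lapl (?mu s) x)"
    if "0 \<le> a" "a \<le> b" "b \<le> T" for a b x
  proof -
    have weak: "(LINT t|lebesgue_on {0<..<T}. \<Phi> t x * deriv \<psi> t) = - (LINT t|lebesgue_on {0<..<T}. lapl (?mu t) x * \<psi> t)"
      if "test_fun T \<psi>" for \<psi>
      using wd that unfolding weak_time_deriv_def by blast
    show ?thesis
      using weak_derivative_FTC[OF pos(1) t_cont[of x] lapl_meas[of x] lapl_AE[of x] weak that] by (rule conjI)
  qed
  have "CH_regular eps theta0 L T C \<delta> \<Phi> Z"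
    by (rule CH_regular.intro[OF assms(1,2) pos(2,1) \<delta>(1) Z Phi_C mu_C \<delta>(2) Phi_per x_cont mu_int
          conjunct1[OF lapl_int] conjunct2[OF lapl_int]])
  then show ?thesis by blast
qed

section \<open>Error estimate\<close>

text \<open>The potential of the sum is the potential v of e plus a potential of the perturbation;
  the latter is bounded through the L2 norm, so only the pointwise size of \<rho> enters.\<close>

lemma gneg_norm_add_sq_le:
  assumes v: "gper N v" "gsum N v = 0" "\<And>i j k. - glap h v i j k = e i j k"
    and \<psi>: "gper N \<psi>" "gsum N \<psi> = 0" "\<And>i j k. \<psi> i j k = e i j k + \<rho> i j k"
    and \<rho>: "\<And>i j k. \<bar>\<rho> i j k\<bar> \<le> B" and pos: "h > 0" "N > 0"
  shows "(gneg_norm N h \<psi>)\<^sup>2 \<le> 2 * gform N h v v + 2 * (3 / 2 * (real N * h)\<^sup>2 * ((real N * h) ^ 3 * B\<^sup>2))"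
proof -
  obtain w where w: "gper N w" "gsum N w = 0" "\<And>i j k. - glap h w i j k = \<psi> i j k"
    using glap_solvable[OF \<psi>(1,2) pos] by blast
  define z where "z = (\<lambda>i j k. w i j k - v i j k)"
  have z: "gper N z" "gsum N z = 0" "- glap h z i j k = \<rho> i j k" for i j k
  proof -
    show "gper N z" unfolding z_def by (intro gper_comp2[where F="(-)"] w v)
    show "gsum N z = 0" unfolding z_def gsum_diff using w v by simp
    show "- glap h z i j k = \<rho> i j k" unfolding z_def glap_diff using w(3)[of i j k] v(3)[of i j k] \<psi>(3)[of i j k] by linarith
  qed
  have "(gneg_norm N h \<psi>)\<^sup>2 = gform N h w w"
    unfolding gneg_norm_eq[OF w pos] using gform_diag_nonneg[OF pos(1)] by simp
  also have "w = (\<lambda>i j k. v i j k + z i j k)" by (simp add: z_def)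
  also have "gform N h \<dots> \<dots> \<le> 2 * gform N h v v + 2 * gform N h z z" by (rule gform_add_le[OF pos(1)])
  also have "gform N h z z \<le> 3 / 2 * (real N * h)\<^sup>2 * (h ^ 3 * gsum N (\<lambda>i j k. (\<rho> i j k)\<^sup>2))"
    by (rule gform_inverse_le[OF z pos])
  also have "\<dots> \<le> 3 / 2 * (real N * h)\<^sup>2 * ((real N * h) ^ 3 * B\<^sup>2)"
    by (intro mult_left_mono gsum_sq_le_bound pos \<rho>) auto
  finally show ?thesis by simp
qed

lemma gneg_norm_nonneg:
  assumes "gper N \<psi>" "gsum N \<psi> = 0" "h > 0" "N > 0"
  shows "0 \<le> gneg_norm N h \<psi>"
proof -
  obtain w where w: "gper N w" "gsum N w = 0" "\<And>i j k. - glap h w i j k = \<psi> i j k"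
    using glap_solvable[OF assms] by blast
  show ?thesis unfolding gneg_norm_eq[OF w assms(3,4)] using gform_diag_nonneg[OF assms(3)] by simp
qed

text \<open>Neighbouring values differ by at most 2B, in three directions, hence the 12. No
  smoothness of \<rho> is used, so with Nh = L the bound is B^2/h^2 up to constants: this is why B
  must be O(h^3).\<close>

lemma gform_bound:
  assumes "\<And>i j k. \<bar>\<rho> i j k\<bar> \<le> B" "h > 0"
  shows "gform N h \<rho> \<rho> \<le> 12 * (real N ^ 3 * h * B\<^sup>2)"
proof -
  have sq: "(x - y) * (x - y) \<le> 4 * B\<^sup>2" if "\<bar>x\<bar> \<le> B" "\<bar>y\<bar> \<le> B" for x y :: real
  proof -
    have "\<bar>x - y\<bar> \<le> 2 * B" using that by linarith
    then have "\<bar>x - y\<bar>\<^sup>2 \<le> (2 * B)\<^sup>2" by (intro power_mono) auto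
    then show ?thesis by (simp add: power2_eq_square)
  qed
  have "gform N h \<rho> \<rho> \<le> h * gsum N (\<lambda>i j k. 4 * B\<^sup>2 + 4 * B\<^sup>2 + 4 * B\<^sup>2)"
    unfolding gform_def using assms by (intro mult_left_mono gsum_mono add_mono sq) auto
  then show ?thesis unfolding gsum_const by (simp add: algebra_simps)
qed

lemma add_sqrt_le:
  assumes "0 \<le> x" "0 \<le> y" "x\<^sup>2 + y \<le> D * S\<^sup>2" "0 \<le> S"
  shows "x + sqrt y \<le> sqrt (2 * D) * S"
proof -
  have "(x + sqrt y)\<^sup>2 \<le> 2 * (x\<^sup>2 + (sqrt y)\<^sup>2)"
    using sum_squares_bound[of x "sqrt y"] by (simp add: power2_sum)
  also have "\<dots> \<le> 2 * D * S\<^sup>2" using assms by simp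
  finally have "x + sqrt y \<le> sqrt (2 * D * S\<^sup>2)" by (rule real_le_rsqrt)
  then show ?thesis using assms(4) by (simp add: real_sqrt_mult)
qed

context CH_regular
begin

section \<open>Constants and the final estimate\<close>

text \<open>The constants below are those of the general lemmas with N h = L. In
  \<open>init_const\<close> the factor 2 counts the projection error and the constant shift, each at
  most \<open>proj_const\<close> L h^2. \<open>consistency_const\<close> bounds both residuals
  relative to dt + h^2, and \<open>source_const\<close> is the source of \<open>energy_step\<close>
  for that size.\<close>

definition poincare_const where "poincare_const = 3 / 2 * L\<^sup>2"
definition init_const where "init_const = poincare_const * (L ^ 3 * (2 * (proj_const * L))\<^sup>2)"
definition consistency_const where "consistency_const = (4 / \<delta> + theta0) * (3 * C + proj_const * L) + eps\<^sup>2 * (12 * C) + 3 * C"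
definition source_const where "source_const = 4 * (poincare_const + poincare_const ^ 3) / eps\<^sup>2 * L ^ 3 * consistency_const\<^sup>2"
definition growth_const where "growth_const = exp (T * (2 * theta0\<^sup>2 / eps\<^sup>2))"
text \<open>Passing from the shifted nodal error to the projected one doubles the Gronwall bound;
  the other two terms are the perturbation in the negative norm and its gradient summed over time.
  There 96 is twice 12 times 4, from \<open>gform_bound\<close> with B = 2 \<open>proj_const\<close>
  h^3.\<close>

definition error_const where "error_const = 2 * (growth_const * (init_const + T * source_const)) + 2 * init_const + 96 * eps\<^sup>2 * T * proj_const\<^sup>2 * L ^ 3"

lemma const_nonneg: "0 \<le> poincare_const" "0 \<le> init_const" "0 \<le> consistency_const" "0 \<le> source_const" "0 \<le> growth_const" "0 \<le> error_const"
proof -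
  show poincare_const: "0 \<le> poincare_const" by (simp add: poincare_const_def)
  show init_const: "0 \<le> init_const" using poincare_const pos by (simp add: init_const_def)
  show "0 \<le> consistency_const" using pos C_nonneg proj_const_nonneg by (simp add: consistency_const_def)
  show source_const: "0 \<le> source_const" using poincare_const pos by (simp add: source_const_def)
  show growth_const: "0 \<le> growth_const" by (simp add: growth_const_def)
  show "0 \<le> error_const" using init_const source_const growth_const pos by (simp add: error_const_def)
qed

text \<open>The smallness condition bounds the constant shift by \<delta>/2, so the shifted nodal
  values stay inside (-1, 1) with a margin, as monotonicity and the Lipschitz bound of the
  logarithms require.\<close>

lemma scheme_error:
  fixes \<phi> :: "nat \<Rightarrow> grid" and n :: nat
  assumes K: "K \<ge> 1" and N: "N = 2 * K + 1" and h: "h = L / real N" and small: "proj_const * L * h\<^sup>2 \<le> \<delta> / 2"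
    and dt: "0 < dt"
    and init: "\<phi> 0 = grid_eval h N (fourier_proj K L (\<Phi> 0))"
    and scheme: "CH_scheme eps theta0 N h dt T \<phi>"
    and n: "real n * dt \<le> T"
    and err: "err = (\<lambda>m i j k. grid_eval h N (fourier_proj K L (\<Phi> (real m * dt))) i j k - \<phi> m i j k)"
  shows "gneg_norm N h (err n) + sqrt (eps\<^sup>2 * dt * (\<Sum>m\<in>{1..n}. ggrad_sq N h (err m))) \<le> sqrt (2 * error_const) * (dt + h\<^sup>2)"
proof -
  define S where "S = dt + h\<^sup>2"
  have Npos: "N > 0" using N by simp
  have hpos: "h > 0" using pos(3) Npos h by simp
  have Nh: "real N * h = L" using Npos h by simp
  have hL: "h \<le> L" unfolding h using pos(3) Npos by (simp add: divide_le_eq)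
  have S: "0 \<le> S" "h\<^sup>2 \<le> S" "dt \<le> S" using dt by (auto simp: S_def)
  define \<gamma> where "\<gamma> = proj_const * h ^ 3"
  \<comment> \<open>One power of h is traded for L. The cubic form of \<gamma> is retained for the
    gradient, which loses a power of h; elsewhere the quadratic form suffices.\<close>
  have \<gamma>_le: "\<gamma> \<le> proj_const * L * h\<^sup>2"
    unfolding \<gamma>_def power3_eq_cube using proj_const_nonneg hL hpos
    by (simp add: power2_eq_square mult.assoc mult_left_mono mult_right_mono)
  have \<gamma>: "0 \<le> \<gamma>" "\<gamma> \<le> \<delta> / 2" using proj_const_nonneg hpos \<gamma>_le small by (auto simp: \<gamma>_def)
  have time: "real m * dt \<in> {0..T}" if "m \<le> n" for m
    using that dt order.trans[OF mult_right_mono[of "real m" "real n" dt] n] by auto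
  have step: "gper N (\<phi> (Suc m))" "\<bar>\<phi> (Suc m) i j k\<bar> < 1"
    "(\<phi> (Suc m) i j k - \<phi> m i j k) / dt = glap h (disc_mu eps theta0 h (\<phi> m) (\<phi> (Suc m))) i j k"
    if "m < n" for m i j k
    using scheme time[of "Suc m"] that unfolding CH_scheme_def by auto
  have phi_per: "gper N (\<phi> m)" if "m \<le> n" for m
  proof (cases m)
    case 0
    then show ?thesis unfolding 0 init
      by (intro gper_grid_eval[OF periodic3_fourier_proj[OF pos(3)]]) (use Nh in \<open>simp add: mult.commute\<close>)
  next
    case (Suc l)
    then show ?thesis using step(1)[of l] that by simp
  qed
  have phi_sum: "gsum N (\<phi> m) = real N ^ 3 * mean 0" if "m \<le> n" for m
    using that
  proof (induction m)
    case 0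
    show ?case unfolding init mean_def by (rule gsum_fourier_proj[OF pos(3) N h])
  next
    case (Suc m)
    have "\<phi> (Suc m) i j k - \<phi> m i j k = dt * glap h (disc_mu eps theta0 h (\<phi> m) (\<phi> (Suc m))) i j k" for i j k
      using step(3)[of m i j k] Suc.prems dt by (simp add: field_simps)
    then have "gsum N (\<lambda>i j k. \<phi> (Suc m) i j k - \<phi> m i j k) = dt * gsum N (glap h (disc_mu eps theta0 h (\<phi> m) (\<phi> (Suc m))))"
      by (simp add: gsum_cmult)
    also have "gper N (disc_mu eps theta0 h (\<phi> m) (\<phi> (Suc m)))"
      unfolding disc_mu_def using phi_per[of m] phi_per[of "Suc m"] Suc.prems
      by (intro gper_comp2[where F="\<lambda>x y. x - eps\<^sup>2 * y"] gper_comp2[where F="\<lambda>x y. ln (1 + x) - ln (1 - x) - theta0 * y"] gper_glap) auto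
    then have "gsum N (glap h (disc_mu eps theta0 h (\<phi> m) (\<phi> (Suc m)))) = 0" by (rule gsum_glap[OF _ hpos])
    finally show ?case using Suc unfolding gsum_diff by simp
  qed
  define F where "F = (\<lambda>m. grid_eval h N (\<Phi> (real m * dt)))"
  \<comment> \<open>The deviation of the grid mean from the conserved mean; subtracting it gives
    \<open>W m\<close> exactly the mass of the numerical solution.\<close>
  define c where "c = (\<lambda>m. gsum N (F m) / real N ^ 3 - mean 0)"
  define W where "W = (\<lambda>m i j k. F m i j k - c m)"
  define e where "e = (\<lambda>m i j k. W m i j k - \<phi> m i j k)"
  have c_le: "\<bar>c m\<bar> \<le> \<gamma>" if "m \<le> n" for m
    using grid_mean[OF time[OF that] K N h] mean_conserved[OF time[OF that]] by (simp add: c_def F_def \<gamma>_def)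
  have F_per: "gper N (F m)" if "m \<le> n" for m
    unfolding F_def by (intro gper_grid_eval[OF Phi_per[OF time[OF that]]]) (use Nh in \<open>simp add: mult.commute\<close>)
  have W_per: "gper N (W m)" if "m \<le> n" for m
    unfolding W_def by (intro gper_comp1[where F="\<lambda>x. x - c m"] F_per that)
  have e_per: "gper N (e m)" if "m \<le> n" for m
    unfolding e_def by (intro gper_comp2[where F="(-)"] W_per phi_per that)
  have e_sum: "gsum N (e m) = 0" if "m \<le> n" for m
    unfolding e_def W_def gsum_diff gsum_const phi_sum[OF that] using Npos by (simp add: c_def field_simps)
  define v where "v = (\<lambda>m. SOME u. gper N u \<and> gsum N u = 0 \<and> (\<forall>i j k. - glap h u i j k = e m i j k))"
  have v: "gper N (v m)" "gsum N (v m) = 0" "- glap h (v m) i j k = e m i j k" if "m \<le> n" for m i j k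
    using someI_ex[OF glap_solvable[OF e_per[OF that] e_sum[OF that] hpos Npos]] unfolding v_def by blast+
  define a where "a = (\<lambda>m. gform N h (v m) (v m))"
  define g where "g = (\<lambda>m. eps\<^sup>2 * dt * gform N h (e m) (e m))"
  have energy: "a (Suc m) + g (Suc m) \<le> (1 + dt * (2 * theta0\<^sup>2 / eps\<^sup>2)) * a m + dt * (source_const * S\<^sup>2)" if m: "m < n" for m
  proof -
    define s t where "s = real m * dt" and "t = real (Suc m) * dt"
    have st: "0 \<le> s" "s < t" "t \<le> T" "t - s = dt" using time[of m] time[of "Suc m"] m dt by (auto simp: s_def t_def algebra_simps)
    define G where "G = grid_eval h N (mu_integral s t)"
    \<comment> \<open>A is the spatial truncation of the integrated equation, B the defect of the
      potential. B stays under the discrete Laplacian: only its pointwise size is known, and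
      estimating its Laplacian from that would cost h^-2.\<close>
    define A where "A = (\<lambda>i j k. ((F (Suc m) i j k - F m i j k) - glap h G i j k) / dt)"
    define B where "B = (\<lambda>i j k. G i j k / dt - disc_mu eps theta0 h (W m) (W (Suc m)) i j k)"
    have G_per: "gper N G" unfolding G_def
      by (intro gper_grid_eval[OF mu_integral_per]) (use st Nh in \<open>auto simp: mult.commute\<close>)
    have A_le: "\<bar>A i j k\<bar> \<le> consistency_const * S" for i j k
    proof -
      have "\<bar>(F (Suc m) i j k - F m i j k) - glap h G i j k\<bar> \<le> 3 * C * h\<^sup>2 * dt"
        using increment_consistent[of s t h N i j k] st hpos unfolding F_def G_def s_def t_def by simp
      then have "\<bar>A i j k\<bar> \<le> 3 * C * h\<^sup>2" using dt by (simp add: A_def abs_divide divide_le_eq)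
      also have "\<dots> \<le> consistency_const * S"
      proof (rule mult_mono)
        show "3 * C \<le> consistency_const" using pos C_nonneg proj_const_nonneg by (simp add: consistency_const_def)
      qed (use S const_nonneg in auto)
      finally show ?thesis .
    qed
    have B_le: "\<bar>B i j k\<bar> \<le> consistency_const * S" for i j k
    proof -
      have "\<bar>G i j k / (t - s) - disc_mu eps theta0 h (W m) (W (Suc m)) i j k\<bar>
        \<le> (4 / \<delta> + theta0) * (3 * C * (t - s) + \<gamma>) + eps\<^sup>2 * (3 * C * h\<^sup>2 + 9 * C * (t - s))"
        unfolding G_def
        by (rule disc_mu_consistent[OF st(1-3) hpos c_le[of m] c_le[of "Suc m"] \<gamma>(2)])
          (use m in \<open>auto simp: W_def F_def s_def t_def\<close>)
      then have "\<bar>B i j k\<bar> \<le> (4 / \<delta> + theta0) * (3 * C * dt + \<gamma>) + eps\<^sup>2 * (3 * C * h\<^sup>2 + 9 * C * dt)"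
        unfolding B_def st(4) .
      also have "\<dots> \<le> (4 / \<delta> + theta0) * ((3 * C + proj_const * L) * S) + eps\<^sup>2 * (12 * C * S)"
      proof (intro add_mono mult_left_mono)
        have "3 * C * dt \<le> 3 * C * S" "proj_const * L * h\<^sup>2 \<le> proj_const * L * S"
          using S C_nonneg proj_const_nonneg pos by (auto intro: mult_left_mono)
        then show "3 * C * dt + \<gamma> \<le> (3 * C + proj_const * L) * S" using \<gamma>_le by (simp add: distrib_right)
        have "3 * C * h\<^sup>2 \<le> 3 * C * S" "9 * C * dt \<le> 9 * C * S"
          using S C_nonneg by (auto intro: mult_left_mono)
        then show "3 * C * h\<^sup>2 + 9 * C * dt \<le> 12 * C * S" by linarith
      qed (use pos in auto)
      also have "\<dots> \<le> consistency_const * S" using S C_nonneg by (simp add: consistency_const_def distrib_right mult.assoc)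
      finally show ?thesis .
    qed
    have small_W: "\<bar>W (Suc m) i j k\<bar> < 1" for i j k
      using Phi_bound[OF time[of "Suc m"], of "cell_center h i j k"]
        c_le[of "Suc m"] \<gamma>(2) pos(5) m unfolding W_def F_def grid_eval_def by auto
    have D_per: "gper N (disc_mu eps theta0 h (W m) (W (Suc m)))"
      unfolding disc_mu_def using W_per[of m] W_per[of "Suc m"] m
      by (intro gper_comp2[where F="\<lambda>x y. x - eps\<^sup>2 * y"] gper_comp2[where F="\<lambda>x y. ln (1 + x) - ln (1 - x) - theta0 * y"] gper_glap) auto
    have A_per: "gper N A"
      unfolding A_def using F_per[of m] F_per[of "Suc m"] m
      by (intro gper_comp2[where F="\<lambda>x y. (x - y) / dt"] gper_comp2[where F="(-)"] gper_glap G_per) auto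
    have B_per: "gper N B"
      unfolding B_def by (intro gper_comp2[where F="\<lambda>x y. x / dt - y"] G_per D_per)
    \<comment> \<open>The rate of change of the shift plays the part of \<kappa>. It is not
      estimated, since the bound on c alone would give only h^3/dt.\<close>
    have cons: "(W (Suc m) i j k - W m i j k) / dt + (c (Suc m) - c m) / dt =
        glap h (disc_mu eps theta0 h (W m) (W (Suc m))) i j k + glap h B i j k + A i j k" for i j k
    proof -
      have "glap h (disc_mu eps theta0 h (W m) (W (Suc m))) i j k + glap h B i j k = glap h (\<lambda>i j k. (1 / dt) * G i j k) i j k"
        unfolding B_def glap_diff by simp
      also have "\<dots> = glap h G i j k / dt" unfolding glap_cmult by simp
      finally show ?thesis using dt by (simp add: W_def A_def diff_divide_distrib)
    qed
    have "gform N h (v (Suc m)) (v (Suc m)) + eps\<^sup>2 * dt * gform N h (e (Suc m)) (e (Suc m)) \<le>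
       (1 + dt * (2 * theta0\<^sup>2 / eps\<^sup>2)) * gform N h (v m) (v m)
       + dt * (4 * (3 / 2 * (real N * h)\<^sup>2 + (3 / 2 * (real N * h)\<^sup>2) ^ 3) / eps\<^sup>2 * (real N * h) ^ 3 * (consistency_const * S)\<^sup>2)"
    proof (rule energy_step[OF pos(1,2) hpos Npos dt _ _ _ _ A_per B_per small_W step(2)[OF m] A_le B_le])
      show "e m = (\<lambda>i j k. W m i j k - \<phi> m i j k)" "e (Suc m) = (\<lambda>i j k. W (Suc m) i j k - \<phi> (Suc m) i j k)"
        by (simp_all add: e_def)
      show "(W (Suc m) i j k - W m i j k) / dt + (c (Suc m) - c m) / dt =
        glap h (disc_mu eps theta0 h (W m) (W (Suc m))) i j k + glap h B i j k + A i j k" for i j k by (rule cons)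
    qed (use m in \<open>auto intro!: W_per phi_per v e_sum step(3)\<close>)
    also have "4 * (3 / 2 * (real N * h)\<^sup>2 + (3 / 2 * (real N * h)\<^sup>2) ^ 3) / eps\<^sup>2 * (real N * h) ^ 3 * (consistency_const * S)\<^sup>2 = source_const * S\<^sup>2"
      unfolding Nh source_const_def poincare_const_def by (simp add: power_mult_distrib)
    finally show ?thesis unfolding a_def g_def .
  qed
  have g_nonneg: "0 \<le> g m" for m using dt gform_diag_nonneg[OF hpos] by (simp add: g_def)
  \<comment> \<open>The initial error does not vanish: the scheme starts from the projection,
    whereas W carries shifted nodal values of \<Phi>.\<close>
  have a0: "a 0 \<le> init_const * S\<^sup>2"
  proof -
    have "\<bar>e 0 i j k\<bar> \<le> 2 * (proj_const * L) * S" for i j k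
    proof -
      have "\<bar>F 0 i j k - \<phi> 0 i j k\<bar> \<le> \<gamma>"
        using proj_error_h[OF time[of 0] K, of h] N h unfolding F_def init grid_eval_def \<gamma>_def
        by (simp add: abs_minus_commute)
      then have "\<bar>e 0 i j k\<bar> \<le> 2 * \<gamma>" using c_le[of 0] unfolding e_def W_def by linarith
      also have "2 * \<gamma> \<le> 2 * (proj_const * L * h\<^sup>2)" using \<gamma>_le by simp
      also have "\<dots> \<le> 2 * (proj_const * L * S)" using S proj_const_nonneg pos by (intro mult_left_mono) auto
      finally show ?thesis by (simp add: mult.assoc)
    qed
    then have "h ^ 3 * gsum N (\<lambda>i j k. (e 0 i j k)\<^sup>2) \<le> L ^ 3 * (2 * (proj_const * L) * S)\<^sup>2"
      using gsum_sq_le_bound[OF hpos, of "e 0" "2 * (proj_const * L) * S" N] Nh by simp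
    then have "poincare_const * (h ^ 3 * gsum N (\<lambda>i j k. (e 0 i j k)\<^sup>2)) \<le> poincare_const * (L ^ 3 * (2 * (proj_const * L) * S)\<^sup>2)"
      by (intro mult_left_mono const_nonneg)
    moreover have "a 0 \<le> poincare_const * (h ^ 3 * gsum N (\<lambda>i j k. (e 0 i j k)\<^sup>2))"
      using gform_inverse_le[OF v(1,2,3) hpos Npos, of 0] unfolding a_def poincare_const_def Nh by simp
    ultimately show ?thesis by (simp add: init_const_def power_mult_distrib mult.assoc)
  qed
  have gron: "a n + (\<Sum>m\<in>{1..n}. g m) \<le> growth_const * ((init_const + T * source_const) * S\<^sup>2)"
  proof -
    have "a n + (\<Sum>m\<in>{1..n}. g m) \<le> exp (real n * (dt * (2 * theta0\<^sup>2 / eps\<^sup>2))) * (a 0 + real n * (dt * (source_const * S\<^sup>2)))"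
    proof (rule discrete_gronwall[where a=a and g=g])
      show "a (Suc m) + g (Suc m) \<le> (1 + dt * (2 * theta0\<^sup>2 / eps\<^sup>2)) * a m + dt * (source_const * S\<^sup>2)" if "m < n" for m
        by (rule energy[OF that])
    qed (use g_nonneg dt const_nonneg gform_diag_nonneg[OF hpos] in \<open>auto simp: a_def\<close>)
    also have "\<dots> \<le> growth_const * (init_const * S\<^sup>2 + T * (source_const * S\<^sup>2))"
    proof (rule mult_mono)
      have "real n * dt * (2 * theta0\<^sup>2 / eps\<^sup>2) \<le> T * (2 * theta0\<^sup>2 / eps\<^sup>2)"
        using n by (intro mult_right_mono) auto
      then show "exp (real n * (dt * (2 * theta0\<^sup>2 / eps\<^sup>2))) \<le> growth_const" unfolding growth_const_def by (simp add: mult.assoc)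
      have "real n * dt * (source_const * S\<^sup>2) \<le> T * (source_const * S\<^sup>2)" using n const_nonneg by (intro mult_right_mono) auto
      then show "a 0 + real n * (dt * (source_const * S\<^sup>2)) \<le> init_const * S\<^sup>2 + T * (source_const * S\<^sup>2)" using a0 by (simp add: mult.assoc)
      show "0 \<le> a 0 + real n * (dt * (source_const * S\<^sup>2))"
        using gform_diag_nonneg[OF hpos] dt const_nonneg by (simp add: a_def)
    qed (use const_nonneg in auto)
    finally show ?thesis by (simp add: distrib_right mult.assoc)
  qed
  \<comment> \<open>The projection error plus the constant shift, hence at most 2\<gamma> at each
    time level.\<close>
  define \<rho> where "\<rho> = (\<lambda>m i j k. err m i j k - e m i j k)"
  have \<rho>_le_cube: "\<bar>\<rho> m i j k\<bar> \<le> 2 * \<gamma>" if "m \<le> n" for m i j k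
  proof -
    have "\<bar>grid_eval h N (fourier_proj K L (\<Phi> (real m * dt))) i j k - F m i j k\<bar> \<le> \<gamma>"
      using proj_error_h[OF time[OF that] K, of h] N h unfolding F_def grid_eval_def \<gamma>_def by simp
    moreover have "\<rho> m i j k = grid_eval h N (fourier_proj K L (\<Phi> (real m * dt))) i j k - F m i j k + c m"
      by (simp add: \<rho>_def err e_def W_def)
    ultimately show ?thesis using c_le[OF that] by linarith
  qed
  have \<rho>_le: "\<bar>\<rho> m i j k\<bar> \<le> 2 * (proj_const * L) * h\<^sup>2" if "m \<le> n" for m i j k
    using \<rho>_le_cube[OF that, of i j k] \<gamma>_le by simp
  have err_eq: "err m i j k = e m i j k + \<rho> m i j k" for m i j k by (simp add: \<rho>_def)
  have h4: "(h\<^sup>2)\<^sup>2 \<le> S\<^sup>2" using S by (intro power_mono) auto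
  have err_per: "gper N (err n)" unfolding err
    by (intro gper_comp2[where F="(-)"] phi_per gper_grid_eval[OF periodic3_fourier_proj[OF pos(3)]])
      (use Nh in \<open>auto simp: mult.commute\<close>)
  \<comment> \<open>The mass of the actual error is exactly zero: exact quadrature for the
    projection, conservation of the continuous mean and of the discrete mass. Otherwise its negative
    norm would be undefined.\<close>
  have err_sum: "gsum N (err n) = 0"
    unfolding err gsum_diff gsum_fourier_proj[OF pos(3) N h] phi_sum[OF order.refl]
    using mean_conserved[OF time[OF order.refl]] by (simp add: mean_def)
  have neg: "(gneg_norm N h (err n))\<^sup>2 \<le> 2 * a n + 2 * (init_const * S\<^sup>2)"
  proof -
    have "(gneg_norm N h (err n))\<^sup>2 \<le> 2 * gform N h (v n) (v n) + 2 * (3 / 2 * (real N * h)\<^sup>2 * ((real N * h) ^ 3 * (2 * (proj_const * L) * h\<^sup>2)\<^sup>2))"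
      by (rule gneg_norm_add_sq_le[OF v[OF order.refl] err_per err_sum err_eq \<rho>_le[OF order.refl] hpos Npos])
    also have "3 / 2 * (real N * h)\<^sup>2 * ((real N * h) ^ 3 * (2 * (proj_const * L) * h\<^sup>2)\<^sup>2) = init_const * (h\<^sup>2)\<^sup>2"
      unfolding Nh init_const_def poincare_const_def by (simp add: power_mult_distrib mult.assoc)
    also have "\<dots> \<le> init_const * S\<^sup>2" using h4 const_nonneg by (intro mult_left_mono)
    finally show ?thesis by (simp add: a_def)
  qed
  have grad: "eps\<^sup>2 * dt * (\<Sum>m\<in>{1..n}. ggrad_sq N h (err m)) \<le> 2 * (\<Sum>m\<in>{1..n}. g m) + 96 * eps\<^sup>2 * T * proj_const\<^sup>2 * L ^ 3 * S\<^sup>2"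
  proof -
    have G1: "ggrad_sq N h (err m) \<le> 2 * gform N h (e m) (e m) + 96 * proj_const\<^sup>2 * L ^ 3 * S\<^sup>2" if "m \<in> {1..n}" for m
    proof -
      have "ggrad_sq N h (err m) = gform N h (\<lambda>i j k. e m i j k + \<rho> m i j k) (\<lambda>i j k. e m i j k + \<rho> m i j k)"
        unfolding ggrad_sq_eq_gform[OF hpos] by (simp add: \<rho>_def)
      also have "\<dots> \<le> 2 * gform N h (e m) (e m) + 2 * gform N h (\<rho> m) (\<rho> m)" by (rule gform_add_le[OF hpos])
      also have "gform N h (\<rho> m) (\<rho> m) \<le> 48 * proj_const\<^sup>2 * L ^ 3 * S\<^sup>2"
      proof -
        have "gform N h (\<rho> m) (\<rho> m) \<le> 12 * (real N ^ 3 * h * (2 * \<gamma>)\<^sup>2)"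
          using that by (intro gform_bound \<rho>_le_cube hpos) auto
        also have "\<dots> = 48 * proj_const\<^sup>2 * (real N * h) ^ 3 * (h\<^sup>2)\<^sup>2"
          by (simp add: \<gamma>_def power_mult_distrib power_numeral_reduce mult_ac)
        also have "\<dots> \<le> 48 * proj_const\<^sup>2 * L ^ 3 * S\<^sup>2"
          unfolding Nh using h4 pos by (intro mult_left_mono) auto
        finally show ?thesis .
      qed
      finally show ?thesis by simp
    qed
    have "(\<Sum>m\<in>{1..n}. ggrad_sq N h (err m)) \<le> (\<Sum>m\<in>{1..n}. 2 * gform N h (e m) (e m) + 96 * proj_const\<^sup>2 * L ^ 3 * S\<^sup>2)"
      by (intro sum_mono G1)
    then have "eps\<^sup>2 * dt * (\<Sum>m\<in>{1..n}. ggrad_sq N h (err m)) \<le>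
       eps\<^sup>2 * dt * (\<Sum>m\<in>{1..n}. 2 * gform N h (e m) (e m) + 96 * proj_const\<^sup>2 * L ^ 3 * S\<^sup>2)"
      using dt by (intro mult_left_mono) auto
    also have "\<dots> = 2 * (\<Sum>m\<in>{1..n}. g m) + (real n * dt) * (96 * eps\<^sup>2 * proj_const\<^sup>2 * L ^ 3 * S\<^sup>2)"
      unfolding g_def sum.distrib sum_distrib_left[symmetric] by (simp add: algebra_simps)
    also have "(real n * dt) * (96 * eps\<^sup>2 * proj_const\<^sup>2 * L ^ 3 * S\<^sup>2) \<le> T * (96 * eps\<^sup>2 * proj_const\<^sup>2 * L ^ 3 * S\<^sup>2)"
      using n pos by (intro mult_right_mono) auto
    finally show ?thesis by (simp add: mult_ac)
  qed
  have "(gneg_norm N h (err n))\<^sup>2 + eps\<^sup>2 * dt * (\<Sum>m\<in>{1..n}. ggrad_sq N h (err m)) \<le> error_const * S\<^sup>2"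
    using gron neg grad unfolding error_const_def by (simp add: distrib_right mult.assoc)
  moreover have "0 \<le> gneg_norm N h (err n)" by (rule gneg_norm_nonneg[OF err_per err_sum hpos Npos])
  moreover have "0 \<le> eps\<^sup>2 * dt * (\<Sum>m\<in>{1..n}. ggrad_sq N h (err m))"
    using dt ggrad_sq_eq_gform[OF hpos] gform_diag_nonneg[OF hpos] by (simp add: sum_nonneg)
  ultimately show ?thesis using add_sqrt_le S(1) unfolding S_def by blast
qed

end

theorem theorem5p1:
  fixes eps theta0 T L :: real and \<Phi> :: "real \<Rightarrow> real^3 \<Rightarrow> real"
  assumes "eps > 0" and "theta0 > 0" and "T > 0" and "L > 0"
    and "CH_exact_solution eps theta0 L T \<Phi>"
  shows "\<exists>C>0. \<exists>dt0>0. \<exists>h0>0. \<forall>(K::nat) (dt::real) (\<phi>::nat \<Rightarrow> grid).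
     0 < dt \<longrightarrow> dt < dt0 \<longrightarrow> L / real (2 * K + 1) < h0 \<longrightarrow>
     \<phi> 0 = grid_eval (L / real (2 * K + 1)) (2 * K + 1) (fourier_proj K L (\<Phi> 0)) \<longrightarrow>
     CH_scheme eps theta0 (2 * K + 1) (L / real (2 * K + 1)) dt T \<phi> \<longrightarrow>
     (\<forall>n::nat. 1 \<le> n \<longrightarrow> real n * dt \<le> T \<longrightarrow>
        (let N = 2 * K + 1; h = L / real N;
             err = (\<lambda>m i j k. grid_eval h N (fourier_proj K L (\<Phi> (real m * dt))) i j k - \<phi> m i j k)
         in gneg_norm N h (err n) + sqrt (eps\<^sup>2 * dt * (\<Sum>m\<in>{1..n}. ggrad_sq N h (err m)))
            \<le> C * (dt + h\<^sup>2)))"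
proof -
  obtain C \<delta> Z where "CH_regular eps theta0 L T C \<delta> \<Phi> Z"
    using CH_exact_solution_regular[OF assms] by blast
  then interpret CH_regular eps theta0 L T C \<delta> \<Phi> Z .
  define h0 where "h0 = min L (min 1 (\<delta> / (2 * (proj_const * L + 1))))"
  have RL: "0 \<le> proj_const * L" using proj_const_nonneg pos(3) by simp
  have h0: "h0 > 0" using pos RL by (simp add: h0_def add_nonneg_pos)
  show ?thesis
  \<comment> \<open>Adding 1 makes the constant strictly positive, as \<open>error_const\<close> is
    only known to be nonnegative.\<close>
  proof (rule exI[of _ "sqrt (2 * error_const) + 1"], intro conjI, simp add: const_nonneg add_nonneg_pos,
      rule exI[of _ 1], intro conjI, simp, rule exI[of _ h0], intro conjI allI impI, rule h0)
    fix K n :: nat and dt :: real and \<phi> :: "nat \<Rightarrow> grid"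
    assume dt: "0 < dt" and h_small: "L / real (2 * K + 1) < h0"
      and init: "\<phi> 0 = grid_eval (L / real (2 * K + 1)) (2 * K + 1) (fourier_proj K L (\<Phi> 0))"
      and scheme: "CH_scheme eps theta0 (2 * K + 1) (L / real (2 * K + 1)) dt T \<phi>"
      and n: "real n * dt \<le> T"
    define N where "N = 2 * K + 1"
    define h where "h = L / real N"
    define err where "err = (\<lambda>m i j k. grid_eval h N (fourier_proj K L (\<Phi> (real m * dt))) i j k - \<phi> m i j k)"
    have h: "h < L" "h \<le> 1" "h < \<delta> / (2 * (proj_const * L + 1))" "0 < h"
      using h_small pos(3) unfolding h0_def h_def N_def by auto
    have "K \<ge> 1" using h(1) by (cases K) (auto simp: h_def N_def)
    moreover have "proj_const * L * h\<^sup>2 \<le> \<delta> / 2"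
    proof -
      have "proj_const * L * h\<^sup>2 \<le> (proj_const * L + 1) * h"
        using h RL by (intro mult_mono) (auto simp: power2_eq_square mult_left_le)
      also have "\<dots> \<le> \<delta> / 2" using h(3) RL by (simp add: pos_less_divide_eq algebra_simps)
      finally show ?thesis .
    qed
    ultimately have "gneg_norm N h (err n) + sqrt (eps\<^sup>2 * dt * (\<Sum>m\<in>{1..n}. ggrad_sq N h (err m))) \<le> sqrt (2 * error_const) * (dt + h\<^sup>2)"
      using init scheme by (intro scheme_error[OF _ N_def h_def _ dt _ _ n err_def]) (simp_all add: N_def h_def)
    also have "\<dots> \<le> (sqrt (2 * error_const) + 1) * (dt + h\<^sup>2)" using dt by (intro mult_right_mono) auto
    finally show "let N = 2 * K + 1; h = L / real N;
             err = (\<lambda>m i j k. grid_eval h N (fourier_proj K L (\<Phi> (real m * dt))) i j k - \<phi> m i j k)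
         in gneg_norm N h (err n) + sqrt (eps\<^sup>2 * dt * (\<Sum>m\<in>{1..n}. ggrad_sq N h (err m)))
            \<le> (sqrt (2 * error_const) + 1) * (dt + h\<^sup>2)"
      by (simp only: Let_def N_def h_def err_def)
  qed
qed

end
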